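(* Let $I\subset\mathbb{Z}$ be a set of consecutive integers and let $G$ be the group presented by generators $(g_i)_{i\in I}$ subject to the relations $$g_{i-1}g_ig_{i+1}=g_ig_{i+1}g_{i-1}g_i\qquad\text{for all } i \text{ with } i-1,i,i+1\in I,$$ $$[g_i,g_j]=1\qquad\text{for all } i,j\in I \text{ with } |i-j|\geq 2.$$ Then: (i) If $I=\{0,1,2,\dots,n\}$ with $n\geq 4$, then $G\cong F$. (ii) If $I=\mathbb{Z}$, then $G\cong F'$. (iii) If $I=\mathbb{N}=\{0,1,2,\dots\}$, then $G\cong D$.
   Context: $F$ denotes Thompson's group: the group (under composition) of all piecewise linear homeomorphisms $f:[0,1]\to[0,1]$ that are differentiable except at finitely many dyadic rationals and such that on intervals of differentiability the derivatives are (integer) powers of $2$. $F'$ denotes the subgroup $$F'=\{f\in F \mid \exists\, \delta,\epsilon\in(0,1)\text{ such that } f|_{[0,\epsilon]}=\mathrm{id}\text{ and } f|_{[\delta,1]}=\mathrm{id}\},$$ which coincides with the commutator (derived) subgroup of $F$. $D$ denotes the intermediate subgroup $$D=\{f\in F \mid \exists\, \delta\in(0,1)\text{ such that } f|_{[\delta,1]}=\mathrm{id}\}.$$ $[a,b]$ denotes the group commutator of $a$ and $b$, so $[a,b]=1$ means $ab=ba$. *)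

theory Defs
  imports "HOL-Analysis.Analysis" "HOL-Algebra.Bij"
begin

section \<open>Group presentations\<close>

text \<open>The letter \<open>(x, True)\<close> stands for the generator \<open>x\<close> and \<open>(x, False)\<close> for its inverse.\<close>

type_synonym 'a gen_word = "('a \<times> bool) list"

definition gen_words :: "'a set \<Rightarrow> 'a gen_word set" where
  "gen_words X = lists (X \<times> UNIV)"

text \<open>
  Relations are pairs \<open>(u, v)\<close> of words, read as \<open>u = v\<close>. Two words are equivalent if they
  represent the same element of the group with generators \<open>X\<close> and defining relations \<open>R\<close>. All
  words involved are words over \<open>X\<close>; pairs in \<open>R\<close> that are not are disregarded.
\<close>

inductive word_eq :: "'a set \<Rightarrow> ('a gen_word \<times> 'a gen_word) set \<Rightarrow> 'a gen_word \<Rightarrow> 'a gen_word \<Rightarrow> bool"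
  for X R where
  refl: "u \<in> gen_words X \<Longrightarrow> word_eq X R u u"
| sym: "word_eq X R u v \<Longrightarrow> word_eq X R v u"
| trans: "word_eq X R u v \<Longrightarrow> word_eq X R v w \<Longrightarrow> word_eq X R u w"
| append: "word_eq X R u u' \<Longrightarrow> word_eq X R v v' \<Longrightarrow> word_eq X R (u @ v) (u' @ v')"
| cancel: "x \<in> X \<Longrightarrow> word_eq X R [(x, b), (x, \<not> b)] []"
| relation: "(u, v) \<in> R \<Longrightarrow> u \<in> gen_words X \<Longrightarrow> v \<in> gen_words X \<Longrightarrow> word_eq X R u v"

definition word_class :: "'a set \<Rightarrow> ('a gen_word \<times> 'a gen_word) set \<Rightarrow> 'a gen_word \<Rightarrow> 'a gen_word set" where
  "word_class X R u = {v. word_eq X R u v}"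

definition presented_group ::
    "'a set \<Rightarrow> ('a gen_word \<times> 'a gen_word) set \<Rightarrow> 'a gen_word set monoid" where
  "presented_group X R =
    \<lparr>carrier = word_class X R ` gen_words X,
     mult = \<lambda>A B. \<Union>u\<in>A. \<Union>v\<in>B. word_class X R (u @ v),
     one = word_class X R []\<rparr>"

lemma word_eq_imp_gen_words:
  "word_eq X R u v \<Longrightarrow> u \<in> gen_words X \<and> v \<in> gen_words X"
  by (induction rule: word_eq.induct) (auto simp: gen_words_def)

lemma word_class_eq_iff:
  "u \<in> gen_words X \<Longrightarrow> word_class X R u = word_class X R v \<longleftrightarrow> word_eq X R u v"
  unfolding word_class_def
  by (auto intro: word_eq.refl dest: word_eq.sym intro: word_eq.trans)

lemma presented_group_mult:
  assumes "u \<in> gen_words X" "v \<in> gen_words X"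
  shows "word_class X R u \<otimes>\<^bsub>presented_group X R\<^esub> word_class X R v = word_class X R (u @ v)"
  using assms
  by (auto simp: presented_group_def word_class_def
      intro: word_eq.refl word_eq.trans word_eq.append)

lemma group_presented_group: "group (presented_group X R)"
proof (rule groupI)
  let ?G = "presented_group X R"
  have app: "u @ v \<in> gen_words X" if "u \<in> gen_words X" "v \<in> gen_words X" for u v :: "'a gen_word"
    using that by (auto simp: gen_words_def)
  have nil: "[] \<in> gen_words X"
    by (simp add: gen_words_def)
  have one: "\<one>\<^bsub>?G\<^esub> = word_class X R []" and carr: "carrier ?G = word_class X R ` gen_words X"
    by (simp_all add: presented_group_def)
  show "\<one>\<^bsub>?G\<^esub> \<in> carrier ?G"
    using nil by (simp add: one carr)
  show "x \<otimes>\<^bsub>?G\<^esub> y \<in> carrier ?G" if "x \<in> carrier ?G" "y \<in> carrier ?G" for x y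
    using that app by (auto simp: carr presented_group_mult)
  show "x \<otimes>\<^bsub>?G\<^esub> y \<otimes>\<^bsub>?G\<^esub> z = x \<otimes>\<^bsub>?G\<^esub> (y \<otimes>\<^bsub>?G\<^esub> z)"
    if "x \<in> carrier ?G" "y \<in> carrier ?G" "z \<in> carrier ?G" for x y z
    using that app by (auto simp: carr presented_group_mult)
  show "\<one>\<^bsub>?G\<^esub> \<otimes>\<^bsub>?G\<^esub> x = x" if "x \<in> carrier ?G" for x
    using that nil by (auto simp: carr one presented_group_mult)
  show "\<exists>y\<in>carrier ?G. y \<otimes>\<^bsub>?G\<^esub> x = \<one>\<^bsub>?G\<^esub>" if "x \<in> carrier ?G" for x
  proof -
    have *: "\<exists>v\<in>gen_words X. word_eq X R (v @ u) []" if "u \<in> gen_words X" for u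
      using that
    proof (induction u)
      case Nil
      then show ?case
        using word_eq.refl nil by (metis append.left_neutral)
    next
      case (Cons a u)
      obtain g b where a: "a = (g, b)" by (cases a)
      have g: "g \<in> X" and u: "u \<in> gen_words X"
        using Cons.prems by (auto simp: a gen_words_def)
      obtain v where v: "v \<in> gen_words X" "word_eq X R (v @ u) []"
        using Cons.IH u by blast
      have "word_eq X R ([(g, \<not> b), (g, b)] @ u) ([] @ u)"
        using word_eq.cancel[OF g, of R "\<not> b"] word_eq.refl[OF u] by (intro word_eq.append) auto
      then have "word_eq X R (v @ [(g, \<not> b), (g, b)] @ u) (v @ u)"
        using word_eq.append[OF word_eq.refl[OF v(1)]] by fastforce
      then have "word_eq X R ((v @ [(g, \<not> b)]) @ a # u) []"
        using v(2) word_eq.trans by (fastforce simp: a)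
      moreover have "v @ [(g, \<not> b)] \<in> gen_words X"
        using v g by (auto simp: gen_words_def)
      ultimately show ?case by blast
    qed
    obtain u where u: "u \<in> gen_words X" "x = word_class X R u"
      using \<open>x \<in> carrier ?G\<close> unfolding carr by blast
    with * obtain v where "v \<in> gen_words X" "word_eq X R (v @ u) []" by blast
    then show ?thesis
      using u app by (force simp: carr one presented_group_mult word_class_eq_iff)
  qed
qed

section \<open>The presentation on consecutive integers\<close>

definition consec_rels :: "int set \<Rightarrow> (int gen_word \<times> int gen_word) set" where
  "consec_rels I =
     {([(i - 1, True), (i, True), (i + 1, True)],
       [(i, True), (i + 1, True), (i - 1, True), (i, True)]) | i.
         i - 1 \<in> I \<and> i \<in> I \<and> i + 1 \<in> I}
   \<union> {([(i, True), (j, True), (i, False), (j, False)], []) | i j.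
         i \<in> I \<and> j \<in> I \<and> \<bar>i - j\<bar> \<ge> 2}"

definition consec_group :: "int set \<Rightarrow> int gen_word set monoid" where
  "consec_group I = presented_group I (consec_rels I)"

section \<open>Thompson's group and its subgroups\<close>

definition piecewise_linear :: "(real \<Rightarrow> real) \<Rightarrow> bool" where
  "piecewise_linear f \<longleftrightarrow>
     (\<exists>P. finite P \<and>
       (\<forall>a b. 0 \<le> a \<and> a < b \<and> b \<le> 1 \<and> {a<..<b} \<inter> P = {} \<longrightarrow>
         (\<exists>m c. \<forall>x\<in>{a..b}. f x = m * x + c)))"

text \<open>
  A homeomorphism of \<open>[0,1]\<close> is represented by its extension by \<open>undefined\<close> outside \<open>[0,1]\<close>, as
  in \<^const>\<open>BijGroup\<close>. Derivatives at \<open>0\<close> and \<open>1\<close> are one-sided. The set \<^const>\<open>dyadics\<close>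
  consists of the nonnegative dyadic rationals.
\<close>

definition thompson_F_carrier :: "(real \<Rightarrow> real) set" where
  "thompson_F_carrier =
     {f \<in> Bij {0..1}.
        (\<exists>g. homeomorphism {0..1} {0..1} f g) \<and>
        piecewise_linear f \<and>
        (\<exists>S. finite S \<and> S \<subseteq> dyadics \<and>
          (\<forall>x\<in>{0..1} - S. \<exists>k::int.
            (f has_real_derivative 2 powi k) (at x within {0..1})))}"

definition thompson_F :: "(real \<Rightarrow> real) monoid" where
  "thompson_F = (BijGroup {0..1})\<lparr>carrier := thompson_F_carrier\<rparr>"

definition thompson_F' :: "(real \<Rightarrow> real) monoid" where
  "thompson_F' = thompson_F\<lparr>carrier :=
     {f \<in> carrier thompson_F. \<exists>\<delta>\<in>{0<..<1}. \<exists>\<epsilon>\<in>{0<..<1}.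
        (\<forall>x\<in>{0..\<epsilon>}. f x = x) \<and> (\<forall>x\<in>{\<delta>..1}. f x = x)}\<rparr>"

definition thompson_D :: "(real \<Rightarrow> real) monoid" where
  "thompson_D = thompson_F\<lparr>carrier :=
     {f \<in> carrier thompson_F. \<exists>\<delta>\<in>{0<..<1}. \<forall>x\<in>{\<delta>..1}. f x = x}\<rparr>"

end

theory Submission
  imports Defs "HOL-Algebra.Generated_Groups"
begin

text \<open>
  Thompson's group \<open>F\<close> is generated by homeomorphisms \<open>x 0\<close>, \<open>x 1\<close>, ... with the relations
  \<open>x j \<otimes> x i = x i \<otimes> x (j + 1)\<close> for \<open>i < j\<close>. The letters of the presentations on consecutive
  integers are interpreted as the slides \<open>g i = x i \<otimes> inv (x (i + 1))\<close>, whose supports overlap for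
  neighbouring indices only. The slides satisfy the relations because their products telescope.

  Conversely, let \<open>g 0\<close>, ..., \<open>g n\<close> satisfy the relations of the finite presentation, where the last
  letter is interpreted as \<open>x n\<close> itself. By telescoping, \<open>x i\<close> has to be the product of \<open>g i\<close>, ...,
  \<open>g n\<close>. These products satisfy the Thompson relations as far as the indices make sense
  (\<open>tail_mult\<close>), and conjugation by the first of them extends the sequence to all indices. The
  Thompson relations of the extended sequence follow from two of them, which exist if \<open>n \<ge> 4\<close>
  (\<open>shifts_by_1\<close>). So the presented group is generated by a sequence with the Thompson relations. In
  such a group every element is a quotient of two positive words, and positive words can be sorted.
  As sorted words are distinguished by their homeomorphisms (\<open>sorted_F_word_inj\<close>), the map to \<open>F\<close> is
  injective (\<open>hom_to_F_gen_inj\<close>).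

  For surjectivity, note that a positive word maps the intervals of a fixed subdivision of the unit
  interval, the right vine, affinely to the intervals of some partition into standard dyadic
  intervals, and that all such partitions arise in this way: two of the shortest intervals of a
  partition are siblings, and merging them means splitting off a generator
  (\<open>positive_word_of_partition\<close>). A map in \<open>F\<close> sends a sufficiently fine partition of this kind to
  another one, hence is a quotient of two positive words (\<open>F_eq_fraction\<close>).

  If the map is the identity near \<open>1\<close>, then the two words have the same length, and then their
  quotient is a product of slides (\<open>balanced_fraction_in_generate\<close>). So the slides generate \<open>D\<close>. A
  word in the slides that is trivial in \<open>D\<close> is trivial by virtue of the relations between finitely
  many letters, by the result on \<open>F\<close>. Finally, conjugation by \<open>x 0\<close> shifts the slides with
  positive indices, which extends them to a family indexed by all integers. Conjugation by powers of
  \<open>x 0\<close> moves any given word of this family to positive indices, and any given map of \<open>F'\<close> into the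
  set of maps with support right of \<open>1 / 2\<close>. This reduces the case of \<open>F'\<close> to the previous one.
\<close>

section \<open>Homomorphisms out of a presented group\<close>

definition word_val :: "('b, 'c) monoid_scheme \<Rightarrow> ('a \<Rightarrow> 'b) \<Rightarrow> 'a gen_word \<Rightarrow> 'b" where
  "word_val G h w =
     foldr (\<lambda>(x, b) a. (if b then h x else inv\<^bsub>G\<^esub> h x) \<otimes>\<^bsub>G\<^esub> a) w \<one>\<^bsub>G\<^esub>"

lemma word_val_Nil [simp]: "word_val G h [] = \<one>\<^bsub>G\<^esub>"
  by (simp add: word_val_def)

lemma word_val_Cons [simp]:
  "word_val G h ((x, b) # w) = (if b then h x else inv\<^bsub>G\<^esub> h x) \<otimes>\<^bsub>G\<^esub> word_val G h w"
  by (simp add: word_val_def)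

lemma gen_words_simps [simp]:
  "[] \<in> gen_words X"
  "(x, b) # w \<in> gen_words X \<longleftrightarrow> x \<in> X \<and> w \<in> gen_words X"
  "u @ v \<in> gen_words X \<longleftrightarrow> u \<in> gen_words X \<and> v \<in> gen_words X"
  by (auto simp: gen_words_def)

lemma gen_words_iff: "w \<in> gen_words X \<longleftrightarrow> fst ` set w \<subseteq> X"
  by (auto simp: gen_words_def lists_eq_set)

context group
begin

lemma word_val_closed [simp]:
  assumes "h \<in> X \<rightarrow> carrier G" "w \<in> gen_words X"
  shows "word_val G h w \<in> carrier G"
  using assms(2)
proof (induction w)
  case (Cons p w)
  then show ?case using assms(1) by (cases p) auto
qed simp

lemma word_val_append:
  assumes "h \<in> X \<rightarrow> carrier G" "u \<in> gen_words X" "v \<in> gen_words X"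
  shows "word_val G h (u @ v) = word_val G h u \<otimes> word_val G h v"
  using assms(2)
proof (induction u)
  case Nil
  then show ?case using assms by simp
next
  case (Cons p u)
  then show ?case using assms(1,3) by (cases p) (auto simp: m_assoc Pi_iff)
qed

lemma word_val_image:
  assumes h: "h \<in> X \<rightarrow> carrier G"
  shows "word_val G h ` gen_words X = generate G (h ` X)"
proof
  show "word_val G h ` gen_words X \<subseteq> generate G (h ` X)"
  proof clarify
    fix w assume "w \<in> gen_words X"
    then show "word_val G h w \<in> generate G (h ` X)"
    proof (induction w)
      case Nil
      then show ?case by (simp add: generate.one)
    next
      case (Cons p w)
      then show ?case
        by (cases p) (auto intro!: generate.eng intro: generate.incl generate.inv)
    qed
  qed
  show "generate G (h ` X) \<subseteq> word_val G h ` gen_words X"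
  proof
    fix a assume "a \<in> generate G (h ` X)"
    then show "a \<in> word_val G h ` gen_words X"
    proof induction
      case one
      show ?case by (rule image_eqI[of _ _ "[]"]) auto
    next
      case (incl a)
      then obtain x where "x \<in> X" "a = h x" by auto
      then show ?case using h by (intro image_eqI[of _ _ "[(x, True)]"]) (auto simp: Pi_iff)
    next
      case (inv a)
      then obtain x where "x \<in> X" "a = h x" by auto
      then show ?case using h by (intro image_eqI[of _ _ "[(x, False)]"]) (auto simp: Pi_iff)
    next
      case (eng a b)
      then obtain u v where "u \<in> gen_words X" "v \<in> gen_words X"
        "a = word_val G h u" "b = word_val G h v" by auto
      then show ?case using h by (intro image_eqI[of _ _ "u @ v"]) (auto simp: word_val_append)
    qed
  qed
qed

lemma word_val_cong:
  assumes "\<And>x. x \<in> X \<Longrightarrow> h x = k x" "w \<in> gen_words X"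
  shows "word_val G h w = word_val G k w"
  using assms(2)
proof (induction w)
  case (Cons p w)
  then show ?case using assms(1) by (cases p) auto
qed simp

lemma word_val_word_eq:
  assumes h: "h \<in> X \<rightarrow> carrier G"
    and rels: "\<And>u v. (u, v) \<in> R \<Longrightarrow> u \<in> gen_words X \<Longrightarrow> v \<in> gen_words X \<Longrightarrow>
                 word_val G h u = word_val G h v"
    and eq: "word_eq X R u v"
  shows "word_val G h u = word_val G h v"
  using eq
proof induction
  case (append u u' v v')
  then show ?case
    using h by (metis word_val_append word_eq_imp_gen_words)
next
  case (cancel x b)
  then show ?case using h by (cases b) (auto simp: Pi_iff)
qed (use rels in auto)

end

definition presented_lift ::
    "('b, 'c) monoid_scheme \<Rightarrow> ('a \<Rightarrow> 'b) \<Rightarrow> 'a gen_word set \<Rightarrow> 'b" where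
  "presented_lift G h A = word_val G h (SOME w. w \<in> A)"

lemma carrier_presented_group: "carrier (presented_group X R) = word_class X R ` gen_words X"
  by (simp add: presented_group_def)

lemma one_presented_group: "\<one>\<^bsub>presented_group X R\<^esub> = word_class X R []"
  by (simp add: presented_group_def)

context group
begin

lemma presented_lift_word_class:
  assumes h: "h \<in> X \<rightarrow> carrier G"
    and rels: "\<And>u v. (u, v) \<in> R \<Longrightarrow> u \<in> gen_words X \<Longrightarrow> v \<in> gen_words X \<Longrightarrow>
                 word_val G h u = word_val G h v"
    and w: "w \<in> gen_words X"
  shows "presented_lift G h (word_class X R w) = word_val G h w"
proof -
  have "w \<in> word_class X R w"
    using w by (simp add: word_class_def word_eq.refl)
  then have "(SOME v. v \<in> word_class X R w) \<in> word_class X R w"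
    by (rule someI)
  then have "word_eq X R w (SOME v. v \<in> word_class X R w)"
    by (simp add: word_class_def)
  with word_val_word_eq[OF h rels] show ?thesis
    unfolding presented_lift_def by metis
qed

lemma presented_lift_hom:
  assumes h: "h \<in> X \<rightarrow> carrier G"
    and rels: "\<And>u v. (u, v) \<in> R \<Longrightarrow> u \<in> gen_words X \<Longrightarrow> v \<in> gen_words X \<Longrightarrow>
                 word_val G h u = word_val G h v"
  shows "presented_lift G h \<in> hom (presented_group X R) G"
  using h
  by (auto simp: hom_def carrier_presented_group presented_group_mult
      presented_lift_word_class[OF h rels] word_val_append)

text \<open>
  The target is the subgroup generated by the images of the generators, so surjectivity costs
  nothing. What remains is that every word with trivial value is trivial by virtue of the
  relations.
\<close>

lemma presented_group_iso:
  assumes h: "h \<in> X \<rightarrow> carrier G"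
    and rels: "\<And>u v. (u, v) \<in> R \<Longrightarrow> u \<in> gen_words X \<Longrightarrow> v \<in> gen_words X \<Longrightarrow>
                 word_val G h u = word_val G h v"
    and ker: "\<And>w. w \<in> gen_words X \<Longrightarrow> word_val G h w = \<one> \<Longrightarrow> word_eq X R w []"
  shows "presented_group X R \<cong> G\<lparr>carrier := generate G (h ` X)\<rparr>"
proof -
  let ?P = "presented_group X R" and ?H = "G\<lparr>carrier := generate G (h ` X)\<rparr>"
  let ?f = "presented_lift G h"
  have sub: "subgroup (generate G (h ` X)) G"
    using h by (intro generate_is_subgroup) auto
  interpret P: group ?P by (rule group_presented_group)
  interpret H: group ?H by (rule subgroup.subgroup_is_group[OF sub is_group])
  have img: "?f ` carrier ?P = generate G (h ` X)"
    by (simp add: carrier_presented_group image_image presented_lift_word_class[OF h rels]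
        flip: word_val_image[OF h])
  have hom: "?f \<in> hom ?P ?H"
    using presented_lift_hom[OF h rels] img by (auto simp: hom_def)
  interpret f: group_hom ?P ?H ?f
    by (unfold_locales) (rule hom)
  have "inj_on ?f (carrier ?P)"
    unfolding f.inj_on_one_iff
  proof (intro allI impI)
    fix A assume "A \<in> carrier ?P" and one: "?f A = \<one>\<^bsub>?H\<^esub>"
    then obtain w where w: "w \<in> gen_words X" "A = word_class X R w"
      by (auto simp: carrier_presented_group)
    show "A = \<one>\<^bsub>?P\<^esub>"
      using w one ker[of w]
      by (simp add: one_presented_group word_class_eq_iff presented_lift_word_class[OF h rels])
  qed
  then have "?f \<in> iso ?P ?H"
    using hom img by (simp add: iso_def bij_betw_def)
  then show ?thesis by (auto simp: is_iso_def)
qed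

end

definition rename :: "('a \<Rightarrow> 'b) \<Rightarrow> 'a gen_word \<Rightarrow> 'b gen_word" where
  "rename f = map (apfst f)"

lemma rename_simps [simp]:
  "rename f [] = []"
  "rename f ((x, b) # w) = (f x, b) # rename f w"
  "rename f (u @ v) = rename f u @ rename f v"
  by (simp_all add: rename_def)

lemma rename_id: "rename id w = w"
  by (induction w) auto

lemma rename_gen_words: "f ` X \<subseteq> Y \<Longrightarrow> w \<in> gen_words X \<Longrightarrow> rename f w \<in> gen_words Y"
  by (force simp: gen_words_iff rename_def)

text \<open>
  Used for the inclusion of a presentation into a larger one, and for shifts of the index set.
\<close>

lemma word_eq_rename:
  assumes eq: "word_eq X R u v"
    and X: "f ` X \<subseteq> Y"
    and R: "\<And>u v. (u, v) \<in> R \<Longrightarrow> u \<in> gen_words X \<Longrightarrow> v \<in> gen_words X \<Longrightarrow> (rename f u, rename f v) \<in> S"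
  shows "word_eq Y S (rename f u) (rename f v)"
  using eq
proof induction
  case (refl u)
  then show ?case using rename_gen_words[OF X] by (auto intro: word_eq.refl)
next
  case (cancel x b)
  then show ?case using X by (auto intro!: word_eq.cancel)
next
  case (relation u v)
  then show ?case using rename_gen_words[OF X] R by (auto intro!: word_eq.relation)
qed (auto intro: word_eq.sym word_eq.trans word_eq.append)

lemma (in group) inv_cancel_left:
  assumes "a \<in> carrier G" "b \<in> carrier G"
  shows "inv b \<otimes> (b \<otimes> a) = a" "b \<otimes> (inv b \<otimes> a) = a"
  using assms by (simp_all flip: m_assoc)

section \<open>Positive words in a family of Thompson type\<close>

text \<open>
  These are the relations of the infinite presentation of \<open>F\<close>, where \<open>X j\<close> is conjugated to
  \<open>X (j + 1)\<close> by every \<open>X i\<close> with a smaller index.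
\<close>

locale thompson_family = group G for G (structure) +
  fixes X :: "nat \<Rightarrow> 'a"
  assumes X_closed [simp]: "X i \<in> carrier G"
    and X_rel: "i < j \<Longrightarrow> X j \<otimes> X i = X i \<otimes> X (Suc j)"

definition pos_val :: "('a, 'c) monoid_scheme \<Rightarrow> (nat \<Rightarrow> 'a) \<Rightarrow> nat list \<Rightarrow> 'a" where
  "pos_val G X w = foldr (\<lambda>i a. X i \<otimes>\<^bsub>G\<^esub> a) w \<one>\<^bsub>G\<^esub>"

lemma pos_val_simps [simp]:
  "pos_val G X [] = \<one>\<^bsub>G\<^esub>"
  "pos_val G X (i # w) = X i \<otimes>\<^bsub>G\<^esub> pos_val G X w"
  by (simp_all add: pos_val_def)

text \<open>Insertion sort, except that moving \<open>j\<close> past a smaller letter costs an increment of \<open>j\<close>.\<close>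

fun pos_insert :: "nat \<Rightarrow> nat list \<Rightarrow> nat list" where
  "pos_insert j [] = [j]"
| "pos_insert j (i # v) = (if j \<le> i then j # i # v else i # pos_insert (Suc j) v)"

lemma pos_insert_lower_bound:
  "k \<in> set (pos_insert j v) \<Longrightarrow> i \<le> j \<Longrightarrow> \<forall>l\<in>set v. i \<le> l \<Longrightarrow> i \<le> k"
  by (induction j v rule: pos_insert.induct) (auto split: if_splits)

lemma sorted_pos_insert: "sorted v \<Longrightarrow> sorted (pos_insert j v)"
proof (induction j v rule: pos_insert.induct)
  case (2 j i v)
  then show ?case using pos_insert_lower_bound[of _ "Suc j" v i] by auto
qed simp

context thompson_family
begin

lemma pos_val_closed [simp]: "pos_val G X w \<in> carrier G"
  by (induction w) auto

lemma pos_val_append: "pos_val G X (u @ v) = pos_val G X u \<otimes> pos_val G X v"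
  by (induction u) (auto simp: m_assoc)

lemma X_rel_assoc:
  assumes "i < j" "a \<in> carrier G"
  shows "X j \<otimes> (X i \<otimes> a) = X i \<otimes> (X (Suc j) \<otimes> a)"
  using assms by (metis X_closed X_rel m_assoc)

lemma inv_X_mult_less: "i < j \<Longrightarrow> a \<in> carrier G \<Longrightarrow> inv (X i) \<otimes> (X j \<otimes> a) = X (Suc j) \<otimes> (inv (X i) \<otimes> a)"
  using X_rel_assoc[of i j "inv (X i) \<otimes> a"] by (simp add: inv_cancel_left)

lemma inv_X_mult_greater: "i < j \<Longrightarrow> a \<in> carrier G \<Longrightarrow> inv (X j) \<otimes> (X i \<otimes> a) = X i \<otimes> (inv (X (Suc j)) \<otimes> a)"
proof -
  assume "i < j" "a \<in> carrier G"
  then have "inv (X j) \<otimes> (X j \<otimes> (X i \<otimes> (inv (X (Suc j)) \<otimes> a))) = inv (X j) \<otimes> (X i \<otimes> a)"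
    using X_rel_assoc[of i j "inv (X (Suc j)) \<otimes> a"] by (simp add: inv_cancel_left)
  then show ?thesis using \<open>a \<in> carrier G\<close> by (simp add: inv_cancel_left)
qed

lemma pos_val_pos_insert: "pos_val G X (pos_insert j v) = X j \<otimes> pos_val G X v"
  by (induction j v rule: pos_insert.induct) (auto simp: X_rel_assoc)

lemma sorted_word_exists: "\<exists>v. sorted v \<and> pos_val G X v = pos_val G X w"
proof (induction w)
  case Nil
  show ?case by (rule exI[of _ "[]"]) simp
next
  case (Cons j w)
  then obtain v where "sorted v" "pos_val G X v = pos_val G X w" by blast
  then show ?case
    by (intro exI[of _ "pos_insert j v"]) (simp add: pos_val_pos_insert sorted_pos_insert)
qed

text \<open>
  The relations allow inverse letters to be moved to the right through a positive word, so the
  elements of this form are closed under multiplication by letters and their inverses and exhaust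
  the subgroup generated by \<open>X\<close>.
\<close>

definition fractions :: "'a set" where
  "fractions = {pos_val G X u \<otimes> inv (pos_val G X v) | u v. True}"

lemma fractions_subset: "fractions \<subseteq> carrier G"
  by (auto simp: fractions_def)

lemma X_mult_fraction:
  assumes "a \<in> fractions" shows "X i \<otimes> a \<in> fractions"
proof -
  obtain u v where "a = pos_val G X u \<otimes> inv (pos_val G X v)"
    using assms by (auto simp: fractions_def)
  then have "X i \<otimes> a = pos_val G X (i # u) \<otimes> inv (pos_val G X v)"
    by (simp add: m_assoc)
  then show ?thesis unfolding fractions_def by blast
qed

lemma inv_X_pos_val:
  "(\<exists>u. inv (X i) \<otimes> pos_val G X w = pos_val G X u) \<or>
   (\<exists>u j. inv (X i) \<otimes> pos_val G X w = pos_val G X u \<otimes> inv (X j))"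
proof (induction w arbitrary: i)
  case Nil
  have "inv (X i) \<otimes> pos_val G X [] = pos_val G X [] \<otimes> inv (X i)" by simp
  then show ?case by blast
next
  case (Cons j w)
  have *: ?case if "inv (X i) \<otimes> pos_val G X (j # w) = X k \<otimes> (inv (X l) \<otimes> pos_val G X w)" for k l
    using Cons[of l]
  proof (elim disjE exE)
    fix u assume "inv (X l) \<otimes> pos_val G X w = pos_val G X u"
    then have "inv (X i) \<otimes> pos_val G X (j # w) = pos_val G X (k # u)"
      using that by simp
    then show ?thesis by blast
  next
    fix u m assume "inv (X l) \<otimes> pos_val G X w = pos_val G X u \<otimes> inv (X m)"
    then have "inv (X i) \<otimes> pos_val G X (j # w) = pos_val G X (k # u) \<otimes> inv (X m)"
      using that by (simp add: m_assoc)
    then show ?thesis by blast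
  qed
  consider "i = j" | "i < j" | "j < i" by linarith
  then show ?case
  proof cases
    case 1
    then have "inv (X i) \<otimes> pos_val G X (j # w) = pos_val G X w" by (simp add: inv_cancel_left)
    then show ?thesis by blast
  next
    case 2
    then show ?thesis by (intro *[of "Suc j" i]) (simp add: inv_X_mult_less)
  next
    case 3
    then show ?thesis by (intro *[of j "Suc i"]) (simp add: inv_X_mult_greater)
  qed
qed

lemma inv_X_mult_fraction:
  assumes "a \<in> fractions" shows "inv (X i) \<otimes> a \<in> fractions"
proof -
  obtain u v where a: "a = pos_val G X u \<otimes> inv (pos_val G X v)"
    using assms by (auto simp: fractions_def)
  show ?thesis
    using inv_X_pos_val[of i u]
  proof (elim disjE exE)
    fix w assume "inv (X i) \<otimes> pos_val G X u = pos_val G X w"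
    then have "inv (X i) \<otimes> a = pos_val G X w \<otimes> inv (pos_val G X v)"
      by (simp add: a flip: m_assoc)
    then show ?thesis by (auto simp: fractions_def)
  next
    fix w j assume "inv (X i) \<otimes> pos_val G X u = pos_val G X w \<otimes> inv (X j)"
    then have "inv (X i) \<otimes> a = (pos_val G X w \<otimes> inv (X j)) \<otimes> inv (pos_val G X v)"
      by (simp add: a flip: m_assoc)
    also have "\<dots> = pos_val G X w \<otimes> inv (pos_val G X (v @ [j]))"
      by (simp add: pos_val_append inv_mult_group m_assoc)
    finally show ?thesis by (auto simp: fractions_def)
  qed
qed

lemma one_fraction: "\<one> \<in> fractions"
  unfolding fractions_def by (force intro: exI[of _ "[]"])

text \<open>
  In a Thompson family these elements satisfy the relations on consecutive integers.
\<close>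

definition slide :: "nat \<Rightarrow> 'a" where
  "slide i = X i \<otimes> inv (X (Suc i))"

lemma slide_closed [simp]: "slide i \<in> carrier G"
  by (simp add: slide_def)

text \<open>
  Both \<open>X i\<close> and \<open>X (i + 1)\<close> conjugate \<open>X j\<close> to \<open>X (j + 1)\<close>, so their quotient centralizes it.
\<close>

lemma slide_commutes_X:
  assumes "i + 2 \<le> j" shows "slide i \<otimes> X j = X j \<otimes> slide i"
proof -
  have "slide i \<otimes> X j = X i \<otimes> (inv (X (Suc i)) \<otimes> (X j \<otimes> \<one>))"
    by (simp add: slide_def m_assoc)
  also have "\<dots> = X i \<otimes> (X (Suc j) \<otimes> inv (X (Suc i)))"
    using assms by (subst inv_X_mult_less) auto
  also have "\<dots> = X j \<otimes> slide i"
    using assms by (simp add: slide_def X_rel_assoc)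
  finally show ?thesis .
qed

lemma commute_inv:
  assumes "a \<in> carrier G" "b \<in> carrier G" "a \<otimes> b = b \<otimes> a"
  shows "a \<otimes> inv b = inv b \<otimes> a"
proof -
  have "a \<otimes> inv b = inv b \<otimes> ((b \<otimes> a) \<otimes> inv b)"
    using assms(1,2) by (simp add: m_assoc inv_cancel_left)
  also have "\<dots> = inv b \<otimes> a"
    using assms(1,2) by (simp add: m_assoc flip: assms(3))
  finally show ?thesis .
qed

lemma slide_commutes:
  assumes "i + 2 \<le> j" shows "slide i \<otimes> slide j = slide j \<otimes> slide i"
proof -
  have "slide i \<otimes> slide j = (slide i \<otimes> X j) \<otimes> inv (X (Suc j))"
    by (simp add: slide_def[of j] m_assoc)
  also have "\<dots> = X j \<otimes> (slide i \<otimes> inv (X (Suc j)))"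
    using assms by (simp add: slide_commutes_X m_assoc)
  also have "\<dots> = slide j \<otimes> slide i"
    using commute_inv[OF _ _ slide_commutes_X[of i "Suc j"]] assms
    by (simp add: slide_def[of j] m_assoc)
  finally show ?thesis .
qed

lemma slide_mult_X: "slide i \<otimes> X (Suc i) = X i"
  by (simp add: slide_def m_assoc)

lemma slide_slide_X: "slide i \<otimes> (slide (Suc i) \<otimes> X (Suc (Suc i))) = X i"
  by (simp add: slide_mult_X)

lemma slide_triple_X:
  "slide (Suc i) \<otimes> (X (Suc (Suc i)) \<otimes> (slide i \<otimes> slide (Suc i))) = X i"
proof -
  have s: "slide i \<otimes> slide (Suc i) = X i \<otimes> inv (X (Suc (Suc i)))"
    by (simp add: slide_def m_assoc inv_cancel_left)
  have "slide (Suc i) \<otimes> (X (Suc (Suc i)) \<otimes> (slide i \<otimes> slide (Suc i)))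
      = (slide (Suc i) \<otimes> X (Suc (Suc i))) \<otimes> (slide i \<otimes> slide (Suc i))"
    by (simp add: m_assoc)
  also have "\<dots> = X (Suc i) \<otimes> (slide i \<otimes> slide (Suc i))"
    by (simp only: slide_mult_X)
  also have "\<dots> = X i"
    unfolding s by (simp add: X_rel_assoc)
  finally show ?thesis .
qed

text \<open>
  The left-hand side telescopes to \<open>X i \<otimes> inv (X (i + 3))\<close>. In the right-hand side, \<open>X (i + 3)\<close>
  commutes with the slides \<open>i\<close> and \<open>i + 1\<close>, and moving its inverse to the end leaves a product that
  telescopes to \<open>X i\<close> as well.
\<close>

lemma slide_triple:
  "slide i \<otimes> (slide (Suc i) \<otimes> slide (Suc (Suc i))) =
   slide (Suc i) \<otimes> (slide (Suc (Suc i)) \<otimes> (slide i \<otimes> slide (Suc i)))"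
proof -
  let ?Y = "X (Suc (Suc (Suc i)))"
  have s: "slide (Suc (Suc i)) = X (Suc (Suc i)) \<otimes> inv ?Y" by (simp add: slide_def)
  have c: "inv ?Y \<otimes> (slide i \<otimes> slide (Suc i)) = (slide i \<otimes> slide (Suc i)) \<otimes> inv ?Y"
  proof -
    have "(slide i \<otimes> slide (Suc i)) \<otimes> ?Y = slide i \<otimes> (?Y \<otimes> slide (Suc i))"
      by (simp add: m_assoc slide_commutes_X)
    also have "\<dots> = ?Y \<otimes> (slide i \<otimes> slide (Suc i))"
      by (simp add: slide_commutes_X flip: m_assoc)
    finally show ?thesis by (intro commute_inv[symmetric]) auto
  qed
  have "slide (Suc i) \<otimes> (slide (Suc (Suc i)) \<otimes> (slide i \<otimes> slide (Suc i)))
      = slide (Suc i) \<otimes> (X (Suc (Suc i)) \<otimes> (inv ?Y \<otimes> (slide i \<otimes> slide (Suc i))))"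
    by (simp add: s m_assoc)
  also have "\<dots> = (slide (Suc i) \<otimes> (X (Suc (Suc i)) \<otimes> (slide i \<otimes> slide (Suc i)))) \<otimes> inv ?Y"
    by (simp only: c) (simp add: m_assoc)
  also have "\<dots> = X i \<otimes> inv ?Y" by (simp only: slide_triple_X)
  also have "\<dots> = slide i \<otimes> (slide (Suc i) \<otimes> slide (Suc (Suc i)))"
    by (simp add: slide_def m_assoc inv_cancel_left)
  finally show ?thesis by simp
qed

lemma slide_conj_X0:
  assumes "0 < i" shows "inv (X 0) \<otimes> slide i \<otimes> X 0 = slide (Suc i)"
proof -
  have "slide i \<otimes> X 0 = X i \<otimes> (inv (X (Suc i)) \<otimes> (X 0 \<otimes> \<one>))"
    by (simp add: slide_def m_assoc)
  also have "\<dots> = X 0 \<otimes> slide (Suc i)"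
    using assms by (subst inv_X_mult_greater) (auto simp: slide_def X_rel_assoc)
  finally show ?thesis by (simp add: m_assoc inv_cancel_left)
qed

lemma X_mult_inv_X_in_generate:
  assumes "j \<le> a" "a \<le> b"
  shows "X a \<otimes> inv (X b) \<in> generate G (slide ` {j..})"
  using assms(2)
proof (induction b rule: dec_induct)
  case base
  then show ?case by (simp add: generate.one)
next
  case (step b)
  have "X a \<otimes> inv (X (Suc b)) = (X a \<otimes> inv (X b)) \<otimes> slide b"
    by (simp add: slide_def m_assoc inv_cancel_left)
  moreover have "slide b \<in> generate G (slide ` {j..})"
    using assms(1) step.hyps by (intro generate.incl) auto
  ultimately show ?case using step.IH by (simp add: generate.eng)
qed

text \<open>
  Up to the subgroup of slides, a positive word depends on its length only. Namely, in the product
  of the elements \<open>X a \<otimes> inv (X N)\<close>, where \<open>a\<close> runs through the letters of a word of length \<open>k\<close> and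
  \<open>N\<close> is large, each \<open>inv (X N)\<close> can be moved to the right, its index going up by one with every
  letter passed. This leaves the word times the inverse of \<open>X N \<otimes> \<dots> \<otimes> X (N + k - 1)\<close>.
\<close>

lemma pos_val_cofactor:
  assumes "\<forall>a\<in>set w. j \<le> a \<and> a < N"
  shows "pos_val G X w \<otimes> inv (pos_val G X [N..<N + length w]) \<in> generate G (slide ` {j..})"
  using assms
proof (induction w arbitrary: N)
  case Nil
  then show ?case by (simp add: generate.one)
next
  case (Cons a w)
  let ?k = "generate G (slide ` {j..})"
  have "\<forall>a\<in>set w. j \<le> a \<and> a < Suc N" using Cons.prems by auto
  have shift: "inv (X N) \<otimes> pos_val G X w = pos_val G X w \<otimes> inv (X (N + length w))"
    if "\<forall>a\<in>set w. a < N" for w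
    using that
  proof (induction w arbitrary: N)
    case (Cons a w)
    then have "inv (X N) \<otimes> pos_val G X (a # w) = X a \<otimes> (inv (X (Suc N)) \<otimes> pos_val G X w)"
      by (simp add: inv_X_mult_greater)
    also have "inv (X (Suc N)) \<otimes> pos_val G X w = pos_val G X w \<otimes> inv (X (Suc N + length w))"
      using Cons.prems by (intro Cons.IH) auto
    finally show ?case by (simp add: m_assoc)
  qed simp
  have "pos_val G X w \<otimes> inv (pos_val G X [N..<N + length w]) \<in> ?k"
    using Cons.prems by (intro Cons.IH) auto
  moreover have "X a \<otimes> inv (X N) \<in> ?k"
    using Cons.prems by (intro X_mult_inv_X_in_generate) auto
  ultimately have "(X a \<otimes> inv (X N)) \<otimes> (pos_val G X w \<otimes> inv (pos_val G X [N..<N + length w])) \<in> ?k"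
    by (rule generate.eng[rotated])
  also have "(X a \<otimes> inv (X N)) \<otimes> (pos_val G X w \<otimes> inv (pos_val G X [N..<N + length w]))
      = X a \<otimes> ((inv (X N) \<otimes> pos_val G X w) \<otimes> inv (pos_val G X [N..<N + length w]))"
    by (simp add: m_assoc)
  also have "\<dots> = X a \<otimes> (pos_val G X w \<otimes> inv (pos_val G X ([N..<N + length w] @ [N + length w])))"
    using Cons.prems by (simp add: shift pos_val_append inv_mult_group m_assoc)
  also have "[N..<N + length w] @ [N + length w] = [N..<N + length (a # w)]"
    by simp
  finally show ?case by (simp add: m_assoc)
qed

text \<open>
  Numerator and denominator have the same cofactor in the preceding lemma, so it cancels.
\<close>

lemma balanced_fraction_in_generate:
  assumes "length u = length v" "\<forall>a\<in>set u. j \<le> a" "\<forall>a\<in>set v. j \<le> a"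
  shows "pos_val G X u \<otimes> inv (pos_val G X v) \<in> generate G (slide ` {j..})"
proof -
  define N where "N = Suc (Max (set (u @ v)))"
  define W where "W = pos_val G X [N..<N + length u]"
  have W: "W \<in> carrier G" by (simp add: W_def)
  have N: "a < N" if "a \<in> set (u @ v)" for a
    using that unfolding N_def by (metis List.finite_set Max_ge le_imp_less_Suc)
  have sub: "subgroup (generate G (slide ` {j..})) G"
    by (intro generate_is_subgroup) auto
  have "pos_val G X u \<otimes> inv W \<in> generate G (slide ` {j..})"
    unfolding W_def using assms N by (intro pos_val_cofactor) auto
  moreover have "pos_val G X v \<otimes> inv W \<in> generate G (slide ` {j..})"
    unfolding W_def using assms N by (simp only: assms(1)) (intro pos_val_cofactor, auto)
  ultimately have "(pos_val G X u \<otimes> inv W) \<otimes> inv (pos_val G X v \<otimes> inv W) \<in> generate G (slide ` {j..})"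
    using sub by (simp add: subgroup.m_closed subgroup.m_inv_closed)
  then show ?thesis
    using W by (simp add: inv_mult_group m_assoc inv_cancel_left)
qed

end



section \<open>A Thompson family in the presented group\<close>

text \<open>
  The defining relations of the finite presentation, with products nested to the right as they are
  by \<open>m_assoc\<close>.
\<close>

locale consecutive_family = group G for G (structure) +
  fixes g :: "nat \<Rightarrow> 'a" and n :: nat
  assumes n: "4 \<le> n"
    and g_closed [simp]: "g i \<in> carrier G"
    and g_triple: "Suc (Suc i) \<le> n \<Longrightarrow>
      g i \<otimes> (g (Suc i) \<otimes> g (Suc (Suc i))) =
      g (Suc i) \<otimes> (g (Suc (Suc i)) \<otimes> (g i \<otimes> g (Suc i)))"
    and g_commute: "i + 2 \<le> j \<Longrightarrow> j \<le> n \<Longrightarrow> g i \<otimes> g j = g j \<otimes> g i"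
begin

text \<open>In \<open>F\<close> the product of \<open>g i\<close>, ..., \<open>g n\<close> telescopes to the standard generator with index \<open>i\<close>.\<close>

definition tail :: "nat \<Rightarrow> 'a" where
  "tail i = foldr (\<lambda>k a. g k \<otimes> a) [i..<Suc n] \<one>"

lemma tail_beyond: "n < i \<Longrightarrow> tail i = \<one>"
  by (simp add: tail_def)

lemma tail_rec: "i \<le> n \<Longrightarrow> tail i = g i \<otimes> tail (Suc i)"
  by (simp add: tail_def upt_conv_Cons del: upt_Suc)

lemma tail_closed [simp]: "tail i \<in> carrier G"
proof -
  have "foldr (\<lambda>k a. g k \<otimes> a) w \<one> \<in> carrier G" for w
    by (induction w) auto
  then show ?thesis by (simp add: tail_def del: upt_Suc)
qed

lemma g_commute_assoc:
  "i + 2 \<le> j \<Longrightarrow> j \<le> n \<Longrightarrow> a \<in> carrier G \<Longrightarrow> g j \<otimes> (g i \<otimes> a) = g i \<otimes> (g j \<otimes> a)"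
  using g_commute[of i j] by (metis g_closed m_assoc)

lemma tail_commute_g:
  assumes "i + 2 \<le> j" shows "tail j \<otimes> g i = g i \<otimes> tail j"
  using assms
proof (induction "Suc n - j" arbitrary: j)
  case 0
  then show ?case by (simp add: tail_beyond)
next
  case (Suc m)
  then have "tail (Suc j) \<otimes> g i = g i \<otimes> tail (Suc j)" by simp
  moreover have "j \<le> n" using Suc.hyps by simp
  ultimately show ?case using Suc.prems by (simp add: tail_rec m_assoc g_commute_assoc)
qed

lemma tail_commute_g_assoc:
  assumes "i + 2 \<le> j" "a \<in> carrier G" shows "tail j \<otimes> (g i \<otimes> a) = g i \<otimes> (tail j \<otimes> a)"
  using tail_commute_g[OF assms(1)] assms(2) by (metis g_closed tail_closed m_assoc)

text \<open>
  By the three-term relation, multiplying \<open>g (i + 1) \<otimes> g (i + 2)\<close> by \<open>g i \<otimes> g (i + 1)\<close> from the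
  right is the same as multiplying it by \<open>g i\<close> from the left. This extends to \<open>tail (i + 1)\<close> because
  its other letters commute with \<open>g i\<close> and \<open>g (i + 1)\<close>.
\<close>

lemma tail_Suc_mult:
  assumes "i + 2 \<le> n" shows "tail (Suc i) \<otimes> tail i = tail i \<otimes> tail (Suc (Suc i))"
proof -
  let ?T = "tail (Suc (Suc (Suc i)))"
  have T: "tail (Suc i) = g (Suc i) \<otimes> (g (Suc (Suc i)) \<otimes> ?T)"
    using assms by (simp add: tail_rec[of "Suc i"] tail_rec[of "Suc (Suc i)"])
  have "tail (Suc i) \<otimes> (g i \<otimes> g (Suc i)) =
      (g (Suc i) \<otimes> (g (Suc (Suc i)) \<otimes> (g i \<otimes> g (Suc i)))) \<otimes> ?T"
    by (simp add: T m_assoc tail_commute_g_assoc tail_commute_g)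
  also have "\<dots> = (g i \<otimes> (g (Suc i) \<otimes> g (Suc (Suc i)))) \<otimes> ?T"
    using assms by (subst g_triple) auto
  also have "\<dots> = g i \<otimes> tail (Suc i)"
    by (simp add: T m_assoc)
  finally have key: "tail (Suc i) \<otimes> (g i \<otimes> g (Suc i)) = g i \<otimes> tail (Suc i)" .
  have "tail (Suc i) \<otimes> tail i = (tail (Suc i) \<otimes> (g i \<otimes> g (Suc i))) \<otimes> tail (Suc (Suc i))"
    using assms by (simp add: tail_rec[of i] tail_rec[of "Suc i"] m_assoc)
  also have "\<dots> = tail i \<otimes> tail (Suc (Suc i))"
    unfolding key using assms by (simp add: tail_rec[of i] m_assoc)
  finally show ?thesis .
qed

text \<open>
  The step from \<open>i + 1\<close> to \<open>i\<close> adds a letter \<open>g i\<close> that commutes with \<open>tail j\<close>; only neighbouring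
  indices involve the three-term relation.
\<close>

lemma tail_mult:
  assumes "i < j" "j < n" shows "tail j \<otimes> tail i = tail i \<otimes> tail (Suc j)"
  using assms
proof (induction "j - i" arbitrary: i)
  case (Suc m)
  show ?case
  proof (cases "j = Suc i")
    case True
    then show ?thesis using tail_Suc_mult[of i] Suc.prems by simp
  next
    case False
    have IH: "tail j \<otimes> tail (Suc i) = tail (Suc i) \<otimes> tail (Suc j)"
      using Suc False by (intro Suc.hyps(1)) auto
    have "tail j \<otimes> tail i = g i \<otimes> (tail j \<otimes> tail (Suc i))"
      using Suc.prems False by (simp add: tail_rec[of i] tail_commute_g_assoc)
    also have "\<dots> = tail i \<otimes> tail (Suc j)"
      unfolding IH using Suc.prems by (simp add: tail_rec[of i] m_assoc)
    finally show ?thesis .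
  qed
qed simp

text \<open>
  The products \<open>tail j\<close>, where \<open>j \<le> n\<close>, are the beginning of a Thompson family. Conjugation by
  \<open>tail 0\<close> raises indices by one, so it continues the family beyond \<open>n\<close>.
\<close>

fun thompson_gen :: "nat \<Rightarrow> 'a" where
  "thompson_gen 0 = tail 0"
| "thompson_gen (Suc 0) = tail 1"
| "thompson_gen (Suc (Suc j)) = inv (tail 0) \<otimes> (thompson_gen (Suc j) \<otimes> tail 0)"

lemma thompson_gen_closed [simp]: "thompson_gen j \<in> carrier G"
  by (induction j rule: thompson_gen.induct) auto

lemma thompson_gen_rel_0:
  assumes "0 < j"
  shows "thompson_gen j \<otimes> thompson_gen 0 = thompson_gen 0 \<otimes> thompson_gen (Suc j)"
  using assms by (cases j) (auto simp: inv_cancel_left)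

lemma thompson_gen_eq_tail: "j \<le> n \<Longrightarrow> thompson_gen j = tail j"
proof (induction j rule: thompson_gen.induct)
  case (3 j)
  then have "thompson_gen (Suc (Suc j)) = inv (tail 0) \<otimes> (tail (Suc j) \<otimes> tail 0)" by simp
  also have "tail (Suc j) \<otimes> tail 0 = tail 0 \<otimes> tail (Suc (Suc j))"
    using 3 by (intro tail_mult) auto
  finally show ?case by (simp add: inv_cancel_left)
qed auto

definition shifts_by :: "nat \<Rightarrow> nat \<Rightarrow> bool" where
  "shifts_by i j \<longleftrightarrow>
     thompson_gen j \<otimes> thompson_gen i = thompson_gen i \<otimes> thompson_gen (Suc j)"

lemma shifts_by_Suc:
  assumes "0 < i" "0 < j" "shifts_by i j" shows "shifts_by (Suc i) (Suc j)"
proof -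
  have S: "thompson_gen (Suc k) = inv (tail 0) \<otimes> (thompson_gen k \<otimes> tail 0)" if "0 < k" for k
    using that by (cases k) auto
  have "thompson_gen (Suc j) \<otimes> thompson_gen (Suc i)
      = inv (tail 0) \<otimes> ((thompson_gen j \<otimes> thompson_gen i) \<otimes> tail 0)"
    using assms(1,2) by (simp add: S m_assoc inv_cancel_left)
  also have "thompson_gen j \<otimes> thompson_gen i = thompson_gen i \<otimes> thompson_gen (Suc j)"
    using assms(3) by (simp add: shifts_by_def)
  also have "inv (tail 0) \<otimes> ((thompson_gen i \<otimes> thompson_gen (Suc j)) \<otimes> tail 0)
      = thompson_gen (Suc i) \<otimes> thompson_gen (Suc (Suc j))"
    using assms(1,2) by (simp add: S m_assoc inv_cancel_left del: thompson_gen.simps)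
  finally show ?thesis by (simp add: shifts_by_def)
qed

lemma shifts_by_add:
  assumes "0 < i" "0 < j" "shifts_by i j" shows "shifts_by (i + k) (j + k)"
  by (induction k) (use assms shifts_by_Suc in auto)

text \<open>
  The cases \<open>j = 2\<close> and \<open>j = 3\<close> are relations between \<open>tail 1\<close>, ..., \<open>tail 4\<close>, and this is where
  \<open>n \<ge> 4\<close> is needed. The other cases follow by induction because \<open>x (j + 2)\<close> is the conjugate of
  \<open>x (j + 1)\<close> by \<open>x j\<close>.
\<close>

lemma shifts_by_1: "2 \<le> j \<Longrightarrow> shifts_by 1 j"
proof (induction j rule: less_induct)
  case (less j)
  show ?case
  proof (cases "j \<le> 3")
    case True
    then have "tail j \<otimes> tail 1 = tail 1 \<otimes> tail (Suc j)"
      using less.prems n by (intro tail_mult) auto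
    then show ?thesis
      using True less.prems n by (simp only: shifts_by_def thompson_gen_eq_tail)
  next
    case False
    define m where "m = j - 2"
    have j: "j = Suc (Suc m)" and m: "2 \<le> m" using False by (auto simp: m_def)
    let ?x = thompson_gen
    have r1: "?x m \<otimes> ?x 1 = ?x 1 \<otimes> ?x (Suc m)"
      and r2: "?x (Suc m) \<otimes> ?x 1 = ?x 1 \<otimes> ?x (Suc (Suc m))"
      using less.IH[of m] less.IH[of "Suc m"] m by (auto simp only: shifts_by_def j)
    have "shifts_by 1 2" using less.IH[of 2] m j by simp
    then have "shifts_by m (Suc m)" "shifts_by (Suc m) (Suc (Suc m))"
      using shifts_by_add[of 1 2 "m - 1"] shifts_by_add[of 1 2 m] m by (simp_all add: eval_nat_numeral)
    then have r3: "?x (Suc m) \<otimes> ?x m = ?x m \<otimes> ?x (Suc (Suc m))"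
      and r4: "?x (Suc (Suc m)) \<otimes> ?x (Suc m) = ?x (Suc m) \<otimes> ?x (Suc (Suc (Suc m)))"
      by (simp_all only: shifts_by_def)
    have "?x m \<otimes> (?x (Suc (Suc m)) \<otimes> ?x 1) = ?x (Suc m) \<otimes> (?x m \<otimes> ?x 1)"
      using r3 by (metis m_assoc thompson_gen_closed)
    also have "\<dots> = ?x 1 \<otimes> (?x (Suc (Suc m)) \<otimes> ?x (Suc m))"
      using r1 r2 by (metis m_assoc thompson_gen_closed)
    also have "\<dots> = ?x m \<otimes> (?x 1 \<otimes> ?x (Suc (Suc (Suc m))))"
      unfolding r4 using r1 by (metis m_assoc thompson_gen_closed)
    finally have "?x (Suc (Suc m)) \<otimes> ?x 1 = ?x 1 \<otimes> ?x (Suc (Suc (Suc m)))"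
      by (simp del: thompson_gen.simps)
    then show ?thesis by (simp only: shifts_by_def j)
  qed
qed

lemma thompson_family: "thompson_family G thompson_gen"
proof unfold_locales
  fix i j :: nat assume "i < j"
  have "shifts_by i j"
  proof (cases i)
    case 0
    then show ?thesis using thompson_gen_rel_0 \<open>i < j\<close> by (simp add: shifts_by_def)
  next
    case (Suc k)
    then have "shifts_by (1 + k) (j - k + k)"
      using \<open>i < j\<close> by (intro shifts_by_add shifts_by_1) auto
    then show ?thesis using Suc \<open>i < j\<close> by simp
  qed
  then show "thompson_gen j \<otimes> thompson_gen i = thompson_gen i \<otimes> thompson_gen (Suc j)"
    by (simp add: shifts_by_def)
qed simp

lemma g_eq_thompson_gen:
  "i < n \<Longrightarrow> g i = thompson_gen i \<otimes> inv (thompson_gen (Suc i))"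
  "g n = thompson_gen n"
  by (simp_all add: thompson_gen_eq_tail tail_rec m_assoc tail_beyond inv_cancel_left
      del: thompson_gen.simps)

end



section \<open>The standard generators as homeomorphisms\<close>

abbreviation interval_bij :: "(real \<Rightarrow> real) monoid" where
  "interval_bij \<equiv> BijGroup {0..1}"

interpretation interval_bij: group interval_bij
  by (rule group_BijGroup)

lemma carrier_interval_bij: "carrier interval_bij = Bij {0..1}"
  by (simp add: BijGroup_def)

lemma mult_interval_bij_apply:
  assumes "f \<in> Bij {0..1}" "g \<in> Bij {0..1}" "x \<in> {0..1}"
  shows "(f \<otimes>\<^bsub>interval_bij\<^esub> g) x = f (g x)"
  using assms by (simp add: BijGroup_def compose_def)

lemma one_interval_bij_apply: "x \<in> {0..1} \<Longrightarrow> \<one>\<^bsub>interval_bij\<^esub> x = x"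
  by (simp add: BijGroup_def)

lemma Bij_apply_mem: "f \<in> Bij S \<Longrightarrow> x \<in> S \<Longrightarrow> f x \<in> S"
  using Bij_imp_funcset by (auto simp: Pi_iff)

lemma Bij_eqI:
  assumes "f \<in> Bij S" "g \<in> Bij S" "\<And>x. x \<in> S \<Longrightarrow> f x = g x"
  shows "f = g"
  using assms by (intro extensionalityI[of f S g]) (auto simp: Bij_imp_extensional)

lemma inv_interval_bij_apply:
  assumes "f \<in> Bij {0..1}" "x \<in> {0..1}"
  shows "f ((inv\<^bsub>interval_bij\<^esub> f) x) = x" "(inv\<^bsub>interval_bij\<^esub> f) (f x) = x"
    "(inv\<^bsub>interval_bij\<^esub> f) x \<in> {0..1}"
proof -
  have c: "inv\<^bsub>interval_bij\<^esub> f \<in> Bij {0..1}"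
    using assms(1) interval_bij.inv_closed by (simp add: carrier_interval_bij)
  then show "(inv\<^bsub>interval_bij\<^esub> f) x \<in> {0..1}"
    using assms(2) by (rule Bij_apply_mem)
  show "f ((inv\<^bsub>interval_bij\<^esub> f) x) = x" "(inv\<^bsub>interval_bij\<^esub> f) (f x) = x"
    using assms c interval_bij.r_inv[of f] interval_bij.l_inv[of f]
    by (simp_all add: carrier_interval_bij one_interval_bij_apply flip: mult_interval_bij_apply)
qed

text \<open>
  A standard generator with support between \<open>p\<close> and \<open>1\<close>: right of \<open>p\<close> it has slopes
  \<open>1 / 2\<close>, \<open>1\<close> and \<open>2\<close>, with breaks at \<open>(1 + p) / 2\<close> and \<open>(3 + p) / 4\<close>. As the slopes increase, it is
  the maximum of its three linear pieces there, and left of \<open>p\<close> the identity is smaller than this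
  maximum. Maps that move points to the left make the Thompson relations come out with composition
  as the product.
\<close>

definition contraction :: "real \<Rightarrow> real \<Rightarrow> real" where
  "contraction p t = min t (max ((t + p) / 2) (max (t - (1 - p) / 4) (2 * t - 1)))"

definition expansion :: "real \<Rightarrow> real \<Rightarrow> real" where
  "expansion p t = max t (min (2 * t - p) (min (t + (1 - p) / 4) ((t + 1) / 2)))"

lemma contraction_cases:
  assumes "p \<le> 1"
  shows "t \<le> p \<Longrightarrow> contraction p t = t"
    "p \<le> t \<Longrightarrow> t \<le> (1 + p) / 2 \<Longrightarrow> contraction p t = (t + p) / 2"
    "(1 + p) / 2 \<le> t \<Longrightarrow> t \<le> (3 + p) / 4 \<Longrightarrow> contraction p t = t - (1 - p) / 4"
    "(3 + p) / 4 \<le> t \<Longrightarrow> t \<le> 1 \<Longrightarrow> contraction p t = 2 * t - 1"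
  using assms by (auto simp: contraction_def min_def max_def field_simps)

lemma contraction_expansion:
  assumes "p \<le> 1" "t \<le> 1"
  shows "contraction p (expansion p t) = t" "expansion p (contraction p t) = t"
  using assms by (auto simp: contraction_def expansion_def min_def max_def field_simps)

lemma contraction_strict_mono: "s < t \<Longrightarrow> contraction p s < contraction p t"
  by (auto simp: contraction_def min_def max_def field_simps)

lemma contraction_mono: "s \<le> t \<Longrightarrow> contraction p s \<le> contraction p t"
  using contraction_strict_mono[of s t p] by (cases "s = t") auto

lemma contraction_le: "contraction p t \<le> t"
  by (simp add: contraction_def)

lemma contraction_less: "p < t \<Longrightarrow> t < 1 \<Longrightarrow> contraction p t < t"
  by (auto simp: contraction_def min_def max_def field_simps)

lemma contraction_bounds:
  assumes "0 \<le> p" "p < 1" "t \<in> {0..1}"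
  shows "contraction p t \<in> {0..1}" "expansion p t \<in> {0..1}"
  using assms by (auto simp: contraction_def expansion_def min_def max_def field_simps)

text \<open>
  Right of \<open>(3 + p) / 4\<close> the contraction towards \<open>p\<close> is the dilation by \<open>2\<close> with centre \<open>1\<close>, and
  contractions with scaled base points are conjugate under this dilation.
\<close>

lemma contraction_comm:
  assumes "p < 1" "(1 + p) / 2 \<le> q" "q < 1" "t \<le> 1"
  shows "contraction q (contraction p t) = contraction p (contraction ((1 + q) / 2) t)"
proof (cases "t \<le> (1 + q) / 2")
  case True
  have "contraction p ((1 + q) / 2) = q"
    using assms by (subst contraction_cases(4)) (auto simp: field_simps)
  then have "contraction p t \<le> q"
    using contraction_mono[OF True, of p] by simp
  then show ?thesis using True assms by (simp add: contraction_cases(1))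
next
  case False
  have "contraction ((1 + q) / 2) ((1 + q) / 2) = (1 + q) / 2"
    using assms by (subst contraction_cases(1)) auto
  then have "(1 + q) / 2 < contraction ((1 + q) / 2) t"
    using contraction_strict_mono[of "(1 + q) / 2" t "(1 + q) / 2"] False by auto
  moreover have "contraction ((1 + q) / 2) t \<le> 1"
    using contraction_le[of "(1 + q) / 2" t] assms by simp
  ultimately have "contraction p (contraction ((1 + q) / 2) t) = 2 * contraction ((1 + q) / 2) t - 1"
    using assms by (intro contraction_cases(4)) auto
  also have "\<dots> = contraction q (2 * t - 1)"
    using assms by (auto simp: contraction_def min_def max_def field_simps)
  also have "2 * t - 1 = contraction p t"
    using assms False by (intro contraction_cases(4)[symmetric]) auto
  finally show ?thesis by simp
qed

text \<open>
  The end points of the right vine, that is, of the intervals which arise from the unit interval by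
  always halving the last one.
\<close>

definition vine_pt :: "nat \<Rightarrow> real" where
  "vine_pt j = 1 - 1 / 2 ^ j"

lemma vine_pt_Suc: "vine_pt (Suc j) = (1 + vine_pt j) / 2"
  by (simp add: vine_pt_def field_simps)

lemma vine_pt_0 [simp]: "vine_pt 0 = 0"
  by (simp add: vine_pt_def)

lemma vine_pt_bounds [simp]: "0 \<le> vine_pt j" "vine_pt j < 1" "vine_pt j \<le> 1"
  by (simp_all add: vine_pt_def)

lemma vine_pt_less_iff [simp]: "vine_pt i < vine_pt j \<longleftrightarrow> i < j"
  by (simp add: vine_pt_def field_simps)

lemma vine_pt_le_iff [simp]: "vine_pt i \<le> vine_pt j \<longleftrightarrow> i \<le> j"
  by (simp add: vine_pt_def field_simps)

definition F_gen :: "nat \<Rightarrow> real \<Rightarrow> real" where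
  "F_gen j = (\<lambda>t\<in>{0..1}. contraction (vine_pt j) t)"

lemma F_gen_Bij: "F_gen j \<in> Bij {0..1}"
proof -
  have "bij_betw (F_gen j) {0..1} {0..1}"
  proof (rule bij_betw_byWitness[where f' = "expansion (vine_pt j)"])
    show "F_gen j ` {0..1} \<subseteq> {0..1}"
      using contraction_bounds(1)[OF vine_pt_bounds(1,2)] by (force simp: F_gen_def simp del: atLeastAtMost_iff)
    show "expansion (vine_pt j) ` {0..1} \<subseteq> {0..1}"
      using contraction_bounds(2)[OF vine_pt_bounds(1,2)] by (force simp del: atLeastAtMost_iff)
    show "\<forall>t\<in>{0..1}. expansion (vine_pt j) (F_gen j t) = t"
      by (simp add: F_gen_def contraction_expansion)
    show "\<forall>t\<in>{0..1}. F_gen j (expansion (vine_pt j) t) = t"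
      using contraction_bounds(2)[OF vine_pt_bounds(1,2)]
      by (simp add: F_gen_def contraction_expansion del: atLeastAtMost_iff) (simp add: contraction_expansion)
  qed
  then show ?thesis by (auto simp: Bij_def F_gen_def)
qed

lemma F_gen_apply: "t \<in> {0..1} \<Longrightarrow> F_gen j t = contraction (vine_pt j) t"
  by (simp add: F_gen_def)

interpretation F_gen: thompson_family interval_bij F_gen
proof unfold_locales
  show "F_gen i \<in> carrier interval_bij" for i
    by (simp add: carrier_interval_bij F_gen_Bij)
  then have closed: "F_gen i \<otimes>\<^bsub>interval_bij\<^esub> F_gen j \<in> Bij {0..1}" for i j
    using interval_bij.m_closed by (simp add: carrier_interval_bij)
  fix i j :: nat assume "i < j"
  show "F_gen j \<otimes>\<^bsub>interval_bij\<^esub> F_gen i = F_gen i \<otimes>\<^bsub>interval_bij\<^esub> F_gen (Suc j)"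
  proof (rule Bij_eqI[OF closed closed])
    fix t :: real assume t: "t \<in> {0..1}"
    have "(1 + vine_pt i) / 2 \<le> vine_pt j"
      using \<open>i < j\<close> by (simp flip: vine_pt_Suc)
    then have "contraction (vine_pt j) (contraction (vine_pt i) t)
        = contraction (vine_pt i) (contraction (vine_pt (Suc j)) t)"
      using t by (simp add: contraction_comm vine_pt_Suc)
    then show "(F_gen j \<otimes>\<^bsub>interval_bij\<^esub> F_gen i) t
        = (F_gen i \<otimes>\<^bsub>interval_bij\<^esub> F_gen (Suc j)) t"
      using t contraction_bounds[OF vine_pt_bounds(1,2)]
      by (simp add: mult_interval_bij_apply F_gen_Bij F_gen_apply del: atLeastAtMost_iff)
  qed
qed

abbreviation F_word :: "nat list \<Rightarrow> real \<Rightarrow> real" where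
  "F_word \<equiv> pos_val interval_bij F_gen"

lemma F_word_Bij: "F_word w \<in> Bij {0..1}"
  using F_gen.pos_val_closed by (simp add: carrier_interval_bij)

lemma F_word_Cons_apply:
  "t \<in> {0..1} \<Longrightarrow> F_word (i # w) t = contraction (vine_pt i) (F_word w t)"
  using Bij_apply_mem[OF F_word_Bij]
  by (simp add: mult_interval_bij_apply F_gen_Bij F_word_Bij F_gen_apply del: atLeastAtMost_iff)

lemma F_word_Nil_apply: "t \<in> {0..1} \<Longrightarrow> F_word [] t = t"
  by (simp add: one_interval_bij_apply)

lemma F_word_le: "t \<in> {0..1} \<Longrightarrow> F_word w t \<le> t"
proof (induction w)
  case (Cons i w)
  then show ?case using contraction_le[of "vine_pt i" "F_word w t"]
    by (simp add: F_word_Cons_apply del: pos_val_simps)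
qed (simp add: F_word_Nil_apply del: pos_val_simps)

lemma F_word_fixes:
  "\<forall>i\<in>set w. j \<le> i \<Longrightarrow> t \<in> {0..vine_pt j} \<Longrightarrow> F_word w t = t"
proof (induction w)
  case Nil
  then show ?case using vine_pt_bounds(3)[of j] by (simp add: F_word_Nil_apply del: pos_val_simps vine_pt_bounds)
next
  case (Cons i w)
  have "vine_pt j \<le> vine_pt i" using Cons.prems by simp
  then have "t \<le> vine_pt i" using Cons.prems by (simp del: vine_pt_le_iff)
  moreover have "t \<in> {0..1}" using Cons.prems vine_pt_bounds(3)[of j] by (simp del: vine_pt_bounds)
  ultimately show ?case using Cons
    by (simp add: F_word_Cons_apply contraction_cases(1) del: pos_val_simps)
qed

text \<open>
  A sorted word with first letter \<open>i\<close> starts to move points precisely at \<open>vine_pt i\<close>, so its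
  homeomorphism determines \<open>i\<close>, and by cancellation all other letters.
\<close>

lemma F_word_moves:
  assumes "vine_pt i < t" "t < 1" shows "F_word (i # w) t < t"
proof -
  have t: "t \<in> {0..1}" using assms vine_pt_bounds(1)[of i] by (simp del: vine_pt_bounds)
  have "F_word (i # w) t = contraction (vine_pt i) (F_word w t)"
    using t by (rule F_word_Cons_apply)
  also have "\<dots> \<le> contraction (vine_pt i) t"
    using F_word_le[OF t, of w] by (rule contraction_mono)
  also have "\<dots> < t" using assms by (rule contraction_less)
  finally show ?thesis .
qed

lemma sorted_F_word_head_le:
  assumes "F_word (i # u) = F_word v" "sorted v" "v = j # w"
  shows "j \<le> i"
proof (rule ccontr)
  assume "\<not> j \<le> i"
  then obtain t where t: "vine_pt i < t" "t < vine_pt j"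
    using dense[of "vine_pt i" "vine_pt j"] by auto
  then have "F_word (i # u) t < t"
    using vine_pt_bounds(2)[of j] by (intro F_word_moves) (auto simp del: vine_pt_bounds)
  moreover have "F_word v t = t"
    using assms t vine_pt_bounds(1)[of i] by (intro F_word_fixes[of _ j]) (auto simp del: vine_pt_bounds)
  ultimately show False using assms(1) by simp
qed

lemma F_word_Cons_nontrivial: "F_word (i # u) \<noteq> F_word []"
proof
  assume eq: "F_word (i # u) = F_word []"
  obtain t where t: "vine_pt i < t" "t < 1" using dense[OF vine_pt_bounds(2)[of i]] by auto
  moreover have "0 \<le> t" using t vine_pt_bounds(1)[of i] by linarith
  ultimately show False
    using F_word_moves[of i t u] eq F_word_Nil_apply[of t] by (simp del: pos_val_simps)
qed

lemma sorted_F_word_inj: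
  "sorted u \<Longrightarrow> sorted v \<Longrightarrow> F_word u = F_word v \<Longrightarrow> u = v"
proof (induction u arbitrary: v)
  case Nil
  then show ?case using F_word_Cons_nontrivial by (metis neq_Nil_conv)
next
  case (Cons i u)
  then obtain j w where v: "v = j # w"
    using F_word_Cons_nontrivial by (metis neq_Nil_conv)
  have "i = j"
    using sorted_F_word_head_le[of i u v j w] sorted_F_word_head_le[of j w "i # u" i u] Cons.prems v
    by (simp del: pos_val_simps)
  then have "F_word u = F_word w"
    using Cons.prems(3) v by (simp add: carrier_interval_bij F_gen_Bij F_word_Bij)
  then show ?case using Cons v \<open>i = j\<close> by simp
qed

text \<open>
  A fraction with trivial image has numerator and denominator with the same homeomorphism. Their
  sorted forms, which are available in \<open>G\<close> already, have the same homeomorphism too and hence are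
  the same word.
\<close>

lemma (in thompson_family) hom_to_F_gen_inj:
  assumes hom: "\<phi> \<in> hom G interval_bij" and X: "\<And>i. \<phi> (X i) = F_gen i"
    and a: "a \<in> fractions" and one: "\<phi> a = \<one>\<^bsub>interval_bij\<^esub>"
  shows "a = \<one>"
proof -
  interpret h: group_hom G interval_bij \<phi>
    by unfold_locales (rule hom)
  have val: "\<phi> (pos_val G X w) = F_word w" for w
    by (induction w) (auto simp: X)
  obtain u v where uv: "a = pos_val G X u \<otimes> inv (pos_val G X v)"
    using a by (auto simp: fractions_def)
  obtain u' where u': "sorted u'" "pos_val G X u' = pos_val G X u"
    using sorted_word_exists by blast
  obtain v' where v': "sorted v'" "pos_val G X v' = pos_val G X v"
    using sorted_word_exists by blast
  have "F_word u' \<otimes>\<^bsub>interval_bij\<^esub> inv\<^bsub>interval_bij\<^esub> F_word v' = \<one>\<^bsub>interval_bij\<^esub>"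
    using one by (simp add: uv u' v' flip: val)
  then have "F_word u' = F_word v'"
    using interval_bij.inv_equality[of "F_word u'" "inv\<^bsub>interval_bij\<^esub> F_word v'"] by simp
  then have "u' = v'" using u' v' sorted_F_word_inj by blast
  then show ?thesis using u' v' by (simp add: uv)
qed



section \<open>Dyadic piecewise linear maps\<close>

definition dyadic_reals :: "real set" where
  "dyadic_reals = {x. \<exists>n::nat. x * 2 ^ n \<in> \<int>}"

lemma dyadic_realsI: "x * 2 ^ n \<in> \<int> \<Longrightarrow> x \<in> dyadic_reals"
  by (auto simp: dyadic_reals_def)

lemma dyadic_reals_scale_mono:
  fixes x :: real
  assumes "x * 2 ^ m \<in> \<int>" "m \<le> n" shows "x * 2 ^ n \<in> \<int>"
proof -
  have "(2::real) ^ n = 2 ^ m * 2 ^ (n - m)"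
    using assms(2) by (simp flip: power_add)
  then have "x * 2 ^ n = (x * 2 ^ m) * 2 ^ (n - m)" by simp
  then show ?thesis using assms(1) by (metis Ints_mult Ints_numeral Ints_power)
qed

lemma dyadic_reals_common:
  assumes "x \<in> dyadic_reals" "y \<in> dyadic_reals"
  obtains n :: nat where "x * 2 ^ n \<in> \<int>" "y * 2 ^ n \<in> \<int>"
proof -
  obtain m k where "x * 2 ^ m \<in> \<int>" "y * 2 ^ k \<in> \<int>"
    using assms by (auto simp: dyadic_reals_def)
  then have "x * 2 ^ max m k \<in> \<int>" "y * 2 ^ max m k \<in> \<int>"
    by (auto elim: dyadic_reals_scale_mono)
  then show thesis by (rule that)
qed

lemma dyadic_reals_add:
  assumes "x \<in> dyadic_reals" "y \<in> dyadic_reals" shows "x + y \<in> dyadic_reals"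
proof -
  obtain n :: nat where "x * 2 ^ n \<in> \<int>" "y * 2 ^ n \<in> \<int>"
    using assms by (rule dyadic_reals_common)
  then have "(x + y) * 2 ^ n \<in> \<int>" by (simp add: distrib_right)
  then show ?thesis by (rule dyadic_realsI)
qed

lemma dyadic_reals_diff:
  assumes "x \<in> dyadic_reals" "y \<in> dyadic_reals" shows "x - y \<in> dyadic_reals"
proof -
  obtain n :: nat where "x * 2 ^ n \<in> \<int>" "y * 2 ^ n \<in> \<int>"
    using assms by (rule dyadic_reals_common)
  then have "(x - y) * 2 ^ n \<in> \<int>" by (simp add: left_diff_distrib)
  then show ?thesis by (rule dyadic_realsI)
qed

lemma dyadic_reals_mult_power: "x \<in> dyadic_reals \<Longrightarrow> x * 2 ^ n \<in> dyadic_reals"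
  by (auto simp: dyadic_reals_def mult.assoc mult.commute[of "2 ^ n"])
     (metis Ints_mult Ints_numeral Ints_power mult.assoc)

lemma dyadic_reals_div_power: "x \<in> dyadic_reals \<Longrightarrow> x / 2 ^ n \<in> dyadic_reals"
proof -
  assume "x \<in> dyadic_reals"
  then obtain m where "x * 2 ^ m \<in> \<int>" by (auto simp: dyadic_reals_def)
  then have "(x / 2 ^ n) * 2 ^ (m + n) \<in> \<int>" by (simp add: power_add)
  then show ?thesis by (rule dyadic_realsI)
qed

lemma two_powi_cases:
  obtains n :: nat where "(2::real) powi s = 2 ^ n" | n :: nat where "(2::real) powi s = 1 / 2 ^ n"
  by (cases "0 \<le> s") (auto simp: power_int_def field_simps)

lemma dyadic_reals_mult_powi [simp]: "2 powi s * x \<in> dyadic_reals \<longleftrightarrow> x \<in> dyadic_reals"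
proof -
  have *: "2 powi s * x \<in> dyadic_reals" if "x \<in> dyadic_reals" for s x
    using that dyadic_reals_mult_power dyadic_reals_div_power
    by (cases s rule: two_powi_cases) (auto simp: mult.commute)
  have "2 powi (- s) * (2 powi s * x) = x"
    by (simp add: power_int_minus flip: mult.assoc)
  then show ?thesis using *[of x s] *[of "2 powi s * x" "- s"] by metis
qed

lemma dyadic_reals_01 [simp]: "0 \<in> dyadic_reals" "1 \<in> dyadic_reals"
  by (rule dyadic_realsI[of _ 0], simp)+

lemma dyadic_reals_inverse_power [simp]: "1 / 2 ^ n \<in> dyadic_reals"
  by (intro dyadic_reals_div_power) simp

lemma dyadics_eq: "dyadics = dyadic_reals \<inter> {0..}"
proof
  show "dyadics \<subseteq> dyadic_reals \<inter> {0..}"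
  proof
    fix x :: real assume "x \<in> dyadics"
    then obtain m n where x: "x = of_nat m / 2 ^ n" by (auto simp: dyadics_def)
    then have "x * 2 ^ n \<in> \<int>" by simp
    then have "x \<in> dyadic_reals" by (rule dyadic_realsI)
    then show "x \<in> dyadic_reals \<inter> {0..}" using x by simp
  qed
  show "dyadic_reals \<inter> {0..} \<subseteq> dyadics"
  proof
    fix x :: real assume x: "x \<in> dyadic_reals \<inter> {0..}"
    then obtain n where "x * 2 ^ n \<in> \<int>" "0 \<le> x" by (auto simp: dyadic_reals_def)
    then have "x * 2 ^ n \<in> \<nat>" by (simp add: Nats_altdef2)
    then obtain m where "x * 2 ^ n = of_nat m" by (auto elim: Nats_cases)
    then have "x = of_nat m / 2 ^ n" by (simp add: field_simps)
    then show "x \<in> dyadics" by (auto simp: dyadics_def)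
  qed
qed

definition dyadic_affine :: "(real \<Rightarrow> real) \<Rightarrow> real \<Rightarrow> real \<Rightarrow> bool" where
  "dyadic_affine f a b \<longleftrightarrow> (\<exists>s::int. \<forall>x\<in>{a..b}. f x = f a + 2 powi s * (x - a))"

lemma dyadic_affineI:
  "(\<And>x. x \<in> {a..b} \<Longrightarrow> f x = f a + 2 powi s * (x - a)) \<Longrightarrow> dyadic_affine f a b"
  unfolding dyadic_affine_def by blast

lemma dyadic_affineE:
  assumes "dyadic_affine f a b"
  obtains s :: int where "\<And>x. x \<in> {a..b} \<Longrightarrow> f x = f a + 2 powi s * (x - a)"
  using assms unfolding dyadic_affine_def by blast

lemma dyadic_affine_subinterval:
  assumes "dyadic_affine f a b" "a \<le> c" "d \<le> b" shows "dyadic_affine f c d"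
proof -
  obtain s where s: "\<And>x. x \<in> {a..b} \<Longrightarrow> f x = f a + 2 powi s * (x - a)"
    using assms(1) by (rule dyadic_affineE) blast
  have "f x = f c + 2 powi s * (x - c)" if "x \<in> {c..d}" for x
    using that assms(2,3) s[of x] s[of c] by (simp add: algebra_simps)
  then show ?thesis by (rule dyadic_affineI)
qed

text \<open>
  Break points and slopes in a single condition. Being a statement about intervals, it can be
  transported through compositions and inverses without reference to derivatives.
\<close>

definition dyadic_pl :: "real set \<Rightarrow> (real \<Rightarrow> real) \<Rightarrow> bool" where
  "dyadic_pl S f \<longleftrightarrow> finite S \<and> S \<subseteq> dyadic_reals \<and>
     (\<forall>a b. 0 \<le> a \<and> a < b \<and> b \<le> 1 \<and> {a<..<b} \<inter> S = {} \<longrightarrow> dyadic_affine f a b)"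

text \<open>Induction on the number of points of \<open>S\<close> between \<open>a\<close> and \<open>b\<close>.\<close>

lemma subdivision_induct [consumes 4, case_names piece join]:
  fixes a b :: real
  assumes "finite S" "0 \<le> a" "a < b" "b \<le> 1"
    and piece: "\<And>a b. 0 \<le> a \<Longrightarrow> a < b \<Longrightarrow> b \<le> 1 \<Longrightarrow> {a<..<b} \<inter> S = {} \<Longrightarrow> Q a b"
    and join: "\<And>a p b. 0 \<le> a \<Longrightarrow> a < p \<Longrightarrow> p < b \<Longrightarrow> b \<le> 1 \<Longrightarrow> p \<in> S \<Longrightarrow>
                 Q a p \<Longrightarrow> Q p b \<Longrightarrow> Q a b"
  shows "Q a b"
  using assms(2-4)
proof (induction "card ({a<..<b} \<inter> S)" arbitrary: a b rule: less_induct)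
  case less
  show ?case
  proof (cases "{a<..<b} \<inter> S = {}")
    case True
    then show ?thesis using less.prems by (intro piece)
  next
    case False
    then obtain p where p: "a < p" "p < b" "p \<in> S" by auto
    have "Q a p"
      using less.prems p assms(1) by (intro less.hyps psubset_card_mono) auto
    moreover have "Q p b"
      using less.prems p assms(1) by (intro less.hyps psubset_card_mono) auto
    ultimately show ?thesis using less.prems p by (intro join[of a p b])
  qed
qed

lemma dyadic_affine_strict_mono:
  assumes "dyadic_affine f a b" "x \<in> {a..b}" "y \<in> {a..b}" "x < y" shows "f x < f y"
proof -
  obtain s where s: "\<And>x. x \<in> {a..b} \<Longrightarrow> f x = f a + 2 powi s * (x - a)"
    using assms(1) by (rule dyadic_affineE) blast
  have "2 powi s * (x - a) < 2 powi s * (y - a)" using assms(4) by simp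
  then show ?thesis using s[OF assms(2)] s[OF assms(3)] by linarith
qed

lemma dyadic_pl_strict_mono:
  assumes "dyadic_pl S f" "0 \<le> x" "x < y" "y \<le> 1" shows "f x < f y"
proof -
  have "finite S" using assms(1) by (simp add: dyadic_pl_def)
  then show ?thesis using assms(2-4)
  proof (induction rule: subdivision_induct)
    case (piece a b)
    then have "dyadic_affine f a b" using assms(1) by (auto simp: dyadic_pl_def)
    then show ?case using dyadic_affine_strict_mono[of f a b a b] piece by auto
  qed auto
qed

lemma dyadic_pl_continuous:
  assumes "dyadic_pl S f" shows "continuous_on {0..1} f"
proof -
  have "finite S" using assms(1) by (simp add: dyadic_pl_def)
  moreover have "(0::real) \<le> 0" "(0::real) < 1" "(1::real) \<le> 1" by auto
  ultimately show ?thesis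
  proof (induction rule: subdivision_induct)
    case (piece a b)
    then have "dyadic_affine f a b" using assms(1) by (auto simp: dyadic_pl_def)
    then obtain s where s: "\<And>x. x \<in> {a..b} \<Longrightarrow> f x = f a + 2 powi s * (x - a)"
      by (rule dyadic_affineE) blast
    have "continuous_on {a..b} (\<lambda>x. f a + 2 powi s * (x - a))"
      by (intro continuous_intros)
    moreover have "continuous_on {a..b} f \<longleftrightarrow> continuous_on {a..b} (\<lambda>x. f a + 2 powi s * (x - a))"
      by (rule continuous_on_cong[OF HOL.refl s])
    ultimately show ?case by (simp only:)
  next
    case (join a p b)
    have "continuous_on ({a..p} \<union> {p..b}) f"
      using join by (intro continuous_on_closed_Un) auto
    moreover have "{a..p} \<union> {p..b} = {a..b}" using join by auto
    ultimately show ?case by simp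
  qed
qed

lemma dyadic_pl_endpoints:
  assumes "dyadic_pl S f" "f \<in> Bij {0..1}" shows "f 0 = 0" "f 1 = 1"
proof -
  have bij: "f ` {0..1} = {0..1}" using assms(2) by (auto simp: Bij_def bij_betw_def)
  have mem: "f 0 \<in> {0..1}" "f 1 \<in> {0..1}"
    by (rule Bij_apply_mem[OF assms(2)], simp)+
  have "0 \<in> f ` {0..1}" "1 \<in> f ` {0..1}" by (simp_all add: bij)
  then obtain x y where x: "x \<in> {0..1}" "f x = 0" and y: "y \<in> {0..1}" "f y = 1"
    by (metis imageE)
  show "f 0 = 0" using x mem dyadic_pl_strict_mono[OF assms(1), of 0 x] by (cases "x = 0") auto
  show "f 1 = 1" using y mem dyadic_pl_strict_mono[OF assms(1), of y 1] by (cases "y = 1") auto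
qed

lemma dyadic_pl_mono:
  assumes "dyadic_pl S f" "0 \<le> x" "x \<le> y" "y \<le> 1" shows "f x \<le> f y"
  using dyadic_pl_strict_mono[OF assms(1,2), of y] assms(3,4) by (cases "x = y") auto

text \<open>
  The break points are dyadic and the slopes are powers of two. So, beginning with \<open>f 0 = 0\<close>, the
  values at the break points are dyadic, and then each linear piece preserves and reflects dyadic
  numbers.
\<close>

lemma dyadic_pl_dyadic_iff:
  assumes f: "dyadic_pl S f" "f \<in> Bij {0..1}" and x: "x \<in> {0..1}"
  shows "f x \<in> dyadic_reals \<longleftrightarrow> x \<in> dyadic_reals"
proof -
  have S: "finite S" "S \<subseteq> dyadic_reals" using f(1) by (simp_all add: dyadic_pl_def)
  have "0 \<in> dyadic_reals \<longrightarrow> f 0 \<in> dyadic_reals \<longrightarrow>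
      (\<forall>x\<in>{0..1}. f x \<in> dyadic_reals \<longleftrightarrow> x \<in> dyadic_reals)"
    using S(1) order.refl zero_less_one order.refl
  proof (induction rule: subdivision_induct)
    case (piece a b)
    then have "dyadic_affine f a b" using f(1) by (auto simp: dyadic_pl_def)
    then obtain s where s: "\<And>x. x \<in> {a..b} \<Longrightarrow> f x = f a + 2 powi s * (x - a)"
      by (rule dyadic_affineE) blast
    show ?case
    proof (intro impI ballI)
      fix x assume a: "a \<in> dyadic_reals" "f a \<in> dyadic_reals" and x: "x \<in> {a..b}"
      have "f x \<in> dyadic_reals \<longleftrightarrow> 2 powi s * (x - a) \<in> dyadic_reals"
        using dyadic_reals_add[OF a(2), of "2 powi s * (x - a)"] dyadic_reals_diff[OF _ a(2), of "f x"]
          s[OF x] by auto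
      also have "\<dots> \<longleftrightarrow> x \<in> dyadic_reals"
        using dyadic_reals_add[OF a(1), of "x - a"] dyadic_reals_diff[OF _ a(1), of x] by auto
      finally show "f x \<in> dyadic_reals \<longleftrightarrow> x \<in> dyadic_reals" .
    qed
  next
    case (join a p b)
    have "p \<in> dyadic_reals" using join S(2) by auto
    show ?case
    proof (intro impI ballI)
      fix x assume a: "a \<in> dyadic_reals" "f a \<in> dyadic_reals" and x: "x \<in> {a..b}"
      have left: "\<forall>x\<in>{a..p}. f x \<in> dyadic_reals \<longleftrightarrow> x \<in> dyadic_reals"
        using join.IH(1) a by blast
      then have "f p \<in> dyadic_reals"
        using \<open>p \<in> dyadic_reals\<close> join.hyps by auto
      then have "\<forall>x\<in>{p..b}. f x \<in> dyadic_reals \<longleftrightarrow> x \<in> dyadic_reals"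
        using join.IH(2) \<open>p \<in> dyadic_reals\<close> by blast
      with left show "f x \<in> dyadic_reals \<longleftrightarrow> x \<in> dyadic_reals"
        using x by (cases "x \<le> p") auto
    qed
  qed
  then show ?thesis using dyadic_pl_endpoints[OF f] x by simp
qed

text \<open>
  One-sided information suffices, so this applies at both sides of a point where two pieces meet.
\<close>

lemma slope_unique:
  fixes f :: "real \<Rightarrow> real"
  assumes "(f has_real_derivative D) (at p within T)" "{l..r} \<subseteq> T" "l < r" "p \<in> {l..r}"
    and f: "\<And>x. x \<in> {l..r} \<Longrightarrow> f x = f p + m * (x - p)"
  shows "D = m"
proof -
  have "(f has_real_derivative D) (at p within {l..r})"
    using assms(1,2) by (rule DERIV_subset)
  moreover have "((\<lambda>x. f p + m * (x - p)) has_real_derivative m) (at p within {l..r})"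
    by (auto intro!: derivative_eq_intros)
  then have "(f has_real_derivative m) (at p within {l..r})"
    by (rule has_field_derivative_transform_within[where d = 1]) (use assms(4) f[symmetric] in auto)
  moreover have "at p within {l..r} \<noteq> bot"
    using assms(3,4) by (simp add: trivial_limit_within islimpt_Icc)
  ultimately show ?thesis
    using vector_derivative_unique_within
    by (metis has_real_derivative_iff_has_vector_derivative)
qed

text \<open>
  At a point outside \<open>S\<close> where two linear pieces meet, \<open>f\<close> is differentiable, so the pieces have the
  same slope and merge into one. Thus only the points of \<open>S\<close> remain as break points.
\<close>

lemma thompson_F_imp_dyadic_pl:
  assumes "f \<in> thompson_F_carrier" obtains S where "dyadic_pl S f"
proof -
  have "piecewise_linear f" using assms by (simp add: thompson_F_carrier_def)
  then obtain P where P': "finite P \<and> (\<forall>a b. 0 \<le> a \<and> a < b \<and> b \<le> 1 \<and> {a<..<b} \<inter> P = {} \<longrightarrow>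
      (\<exists>m c. \<forall>x\<in>{a..b}. f x = m * x + c))"
    unfolding piecewise_linear_def ..
  note P = P'[THEN conjunct1]
  have lin: "\<exists>m c. \<forall>x\<in>{a..b}. f x = m * x + c"
    if "0 \<le> a" "a < b" "b \<le> 1" "{a<..<b} \<inter> P = {}" for a b
    using P'[THEN conjunct2, rule_format, of a b] that by (simp only:)
  have "\<exists>S. finite S \<and> S \<subseteq> dyadics \<and>
        (\<forall>x\<in>{0..1} - S. \<exists>k::int. (f has_real_derivative 2 powi k) (at x within {0..1}))"
    using assms unfolding thompson_F_carrier_def mem_Collect_eq by (elim conjE)
  then obtain S where S': "finite S \<and> S \<subseteq> dyadics \<and>
        (\<forall>x\<in>{0..1} - S. \<exists>k::int. (f has_real_derivative 2 powi k) (at x within {0..1}))" ..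
  note S = S'[THEN conjunct1] S'[THEN conjunct2, THEN conjunct1]
  note der = bspec[OF S'[THEN conjunct2, THEN conjunct2]]
  have "dyadic_affine f a b" if "0 \<le> a" "a < b" "b \<le> 1" "{a<..<b} \<inter> S = {}" for a b
  proof -
    have "{a<..<b} \<inter> S = {} \<longrightarrow> dyadic_affine f a b"
      using P that(1-3)
    proof (induction rule: subdivision_induct)
      case (piece a b)
      show ?case
      proof
        assume S0: "{a<..<b} \<inter> S = {}"
        obtain m where "\<exists>c. \<forall>x\<in>{a..b}. f x = m * x + c"
          using lin[OF piece] ..
        then obtain c where "\<forall>x\<in>{a..b}. f x = m * x + c" ..
        note mc = bspec[OF this]
        define p where "p = (a + b) / 2"
        have p: "a < p" "p < b" using piece by (auto simp: p_def)
        then have "p \<in> {0..1} - S" using S0 piece by auto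
        from der[OF this] obtain k :: int where "(f has_real_derivative 2 powi k) (at p within {0..1})" ..
        then have "2 powi k = m"
        proof (rule slope_unique[of _ _ _ _ a b])
          show "f x = f p + m * (x - p)" if "x \<in> {a..b}" for x
            using mc[OF that] mc[of p] p by (simp add: algebra_simps)
        qed (use piece p in auto)
        then have "f x = f a + 2 powi k * (x - a)" if "x \<in> {a..b}" for x
          using that mc[of x] mc[of a] piece by (simp add: algebra_simps)
        then show "dyadic_affine f a b" by (rule dyadic_affineI)
      qed
    next
      case (join a p b)
      show ?case
      proof
        assume S0: "{a<..<b} \<inter> S = {}"
        have "{a<..<p} \<subseteq> {a<..<b}" "{p<..<b} \<subseteq> {a<..<b}"
          using join.hyps by auto
        then have "{a<..<p} \<inter> S = {}" "{p<..<b} \<inter> S = {}"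
          using S0 by auto
        then have "dyadic_affine f a p" "dyadic_affine f p b"
          using join.IH by blast+
        then obtain s t where s: "\<And>x. x \<in> {a..p} \<Longrightarrow> f x = f a + 2 powi s * (x - a)"
          and t: "\<And>x. x \<in> {p..b} \<Longrightarrow> f x = f p + 2 powi t * (x - p)"
          by (elim dyadic_affineE) blast
        have "p \<in> {a<..<b}" using join.hyps by simp
        then have "p \<in> {0..1} - S" using join.hyps S0 by auto
        from der[OF this] obtain k :: int where k: "(f has_real_derivative 2 powi k) (at p within {0..1})" ..
        have "2 powi k = (2::real) powi s"
          using k
        proof (rule slope_unique[of _ _ _ _ a p])
          show "f x = f p + 2 powi s * (x - p)" if "x \<in> {a..p}" for x
            using s[OF that] s[of p] join by (simp add: algebra_simps)
        qed (use join in auto)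
        moreover have "2 powi k = (2::real) powi t"
          using k by (rule slope_unique[OF _ _ _ _ t]) (use join in auto)
        ultimately have "f x = f a + 2 powi s * (x - a)" if "x \<in> {a..b}" for x
          using that s[of x] t[of x] s[of p] join by (cases "x \<le> p") (auto simp: algebra_simps)
        then show "dyadic_affine f a b" by (rule dyadic_affineI)
      qed
    qed
    then show ?thesis using that by blast
  qed
  then have "dyadic_pl S f" using S by (auto simp: dyadic_pl_def dyadics_eq)
  then show thesis by (rule that)
qed

lemma dyadic_pl_imp_thompson_F:
  assumes f: "dyadic_pl S f" "f \<in> Bij {0..1}" shows "f \<in> thompson_F_carrier"
proof -
  have S: "finite S" "S \<subseteq> dyadic_reals" using f(1) by (simp_all add: dyadic_pl_def)
  have bij: "inj_on f {0..1}" "f ` {0..1} = {0..1}"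
    using f(2) by (auto simp: Bij_def bij_betw_def)
  have "\<exists>g. homeomorphism {0..1} {0..1} f g"
    using dyadic_pl_continuous[OF f(1)] bij homeomorphism_compact[of "{0..1}" f "{0..1}"] by auto
  moreover have "piecewise_linear f"
    unfolding piecewise_linear_def
  proof (intro exI[of _ S] conjI allI impI S(1))
    fix a b :: real assume "0 \<le> a \<and> a < b \<and> b \<le> 1 \<and> {a<..<b} \<inter> S = {}"
    then have "dyadic_affine f a b" using f(1) by (auto simp: dyadic_pl_def)
    then obtain s where "\<And>x. x \<in> {a..b} \<Longrightarrow> f x = f a + 2 powi s * (x - a)"
      by (rule dyadic_affineE) blast
    then have "f x = 2 powi s * x + (f a - 2 powi s * a)" if "x \<in> {a..b}" for x
      using that by (metis add_diff_eq add_diff_eq add.commute right_diff_distrib)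
    then show "\<exists>m c. \<forall>x\<in>{a..b}. f x = m * x + c" by blast
  qed
  moreover have "\<exists>S. finite S \<and> S \<subseteq> dyadics \<and> (\<forall>x\<in>{0..1} - S. \<exists>k::int.
            (f has_real_derivative 2 powi k) (at x within {0..1}))"
  proof (intro exI[of _ "S \<inter> {0..1}"] conjI ballI)
    show "finite (S \<inter> {0..1})" "S \<inter> {0..1} \<subseteq> dyadics" using S by (auto simp: dyadics_eq)
    fix x :: real assume x: "x \<in> {0..1} - S \<inter> {0..1}"
    have "open (- S)" using S(1) by (simp add: finite_imp_closed open_Compl)
    then obtain e where e: "0 < e" "ball x e \<subseteq> - S" using x by (auto simp: open_contains_ball)
    define a b where "a = max 0 (x - e)" and "b = min 1 (x + e)"
    have ab: "0 \<le> a" "a < b" "b \<le> 1" "x \<in> {a..b}"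
      using x e(1) by (auto simp: a_def b_def max_def min_def)
    have "{a<..<b} \<subseteq> ball x e"
      by (auto simp: a_def b_def dist_real_def)
    then have "{a<..<b} \<inter> S = {}" using e(2) by auto
    then have "dyadic_affine f a b" using f(1) ab by (auto simp: dyadic_pl_def)
    then obtain s where s: "\<And>x. x \<in> {a..b} \<Longrightarrow> f x = f a + 2 powi s * (x - a)"
      by (rule dyadic_affineE) blast
    have "((\<lambda>x. f a + 2 powi s * (x - a)) has_real_derivative 2 powi s) (at x within {0..1})"
      by (auto intro!: derivative_eq_intros)
    then have "(f has_real_derivative 2 powi s) (at x within {0..1})"
    proof (rule has_field_derivative_transform_within[OF _ e(1)])
      show "f a + 2 powi s * (y - a) = f y" if "y \<in> {0..1}" "dist y x < e" for y
      proof -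
        have "y \<in> {a..b}" using that by (auto simp: a_def b_def dist_real_def)
        then show ?thesis by (rule s[symmetric])
      qed
    qed (use x in auto)
    then show "\<exists>k::int. (f has_real_derivative 2 powi k) (at x within {0..1})" by blast
  qed
  ultimately show ?thesis using f(2) by (simp add: thompson_F_carrier_def)
qed

lemma thompson_F_carrier_Bij: "f \<in> thompson_F_carrier \<Longrightarrow> f \<in> Bij {0..1}"
  by (simp add: thompson_F_carrier_def)

text \<open>
  A break point of the composition is a break point of \<open>g\<close> or the preimage under \<open>g\<close> of a break
  point of \<open>f\<close>; the latter is dyadic since \<open>g\<close> reflects dyadic numbers.
\<close>

lemma dyadic_pl_mult:
  assumes f: "dyadic_pl S f" "f \<in> Bij {0..1}" and g: "dyadic_pl T g" "g \<in> Bij {0..1}"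
  shows "f \<otimes>\<^bsub>interval_bij\<^esub> g \<in> thompson_F_carrier"
proof -
  let ?h = "f \<otimes>\<^bsub>interval_bij\<^esub> g"
  let ?U = "T \<union> {x\<in>{0..1}. g x \<in> S}"
  have inj: "inj_on g {0..1}" using g(2) by (auto simp: Bij_def bij_betw_def)
  have g01: "g x \<in> {0..1}" if "x \<in> {0..1}" for x using Bij_apply_mem[OF g(2) that] .
  have h: "?h x = f (g x)" if "x \<in> {0..1}" for x
    using mult_interval_bij_apply[OF f(2) g(2) that] .
  have "finite (g -` S \<inter> {0..1})"
    using f(1) inj by (intro finite_vimage_IntI) (auto simp: dyadic_pl_def)
  moreover have "g -` S \<inter> {0..1} = {x\<in>{0..1}. g x \<in> S}" by auto
  ultimately have fin: "finite ?U" using g(1) by (simp add: dyadic_pl_def)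
  have dyad: "?U \<subseteq> dyadic_reals"
    using f(1) g(1) dyadic_pl_dyadic_iff[OF g] by (auto simp: dyadic_pl_def)
  have "dyadic_affine ?h a b" if ab: "0 \<le> a" "a < b" "b \<le> 1" "{a<..<b} \<inter> ?U = {}" for a b
  proof -
    have "dyadic_affine g a b" using g(1) ab unfolding dyadic_pl_def by blast
    then obtain s where s: "\<And>x. x \<in> {a..b} \<Longrightarrow> g x = g a + 2 powi s * (x - a)"
      by (rule dyadic_affineE) blast
    have gab: "0 \<le> g a" "g a < g b" "g b \<le> 1"
      using ab g01[of a] g01[of b] dyadic_pl_strict_mono[OF g(1), of a b] by auto
    have "{g a<..<g b} \<inter> S = {}"
    proof (rule ccontr)
      assume "{g a<..<g b} \<inter> S \<noteq> {}"
      then obtain y where y: "g a < y" "y < g b" "y \<in> S" by auto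
      have "y \<in> g ` {0..1}" using y gab g(2) by (auto simp: Bij_def bij_betw_def)
      then obtain x where x: "x \<in> {0..1}" "g x = y" by auto
      have "a < x" using y x ab dyadic_pl_mono[OF g(1), of x a] by force
      moreover have "x < b" using y x ab dyadic_pl_mono[OF g(1), of b x] by force
      ultimately show False using ab(4) x y by auto
    qed
    then have "dyadic_affine f (g a) (g b)" using f(1) gab by (auto simp: dyadic_pl_def)
    then obtain t where t: "\<And>y. y \<in> {g a..g b} \<Longrightarrow> f y = f (g a) + 2 powi t * (y - g a)"
      by (rule dyadic_affineE) blast
    have "?h x = ?h a + 2 powi (t + s) * (x - a)" if x: "x \<in> {a..b}" for x
    proof -
      have "g x \<in> {g a..g b}"
        using x ab dyadic_pl_mono[OF g(1), of a x] dyadic_pl_mono[OF g(1), of x b] by auto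
      then have "f (g x) = f (g a) + 2 powi t * (2 powi s * (x - a))"
        using t[of "g x"] s[OF x] by simp
      then show ?thesis using x ab by (simp add: h power_int_add)
    qed
    then show ?thesis by (rule dyadic_affineI)
  qed
  then have "dyadic_pl ?U ?h" using fin dyad by (auto simp: dyadic_pl_def)
  moreover have "?h \<in> Bij {0..1}"
    using f(2) g(2) interval_bij.m_closed[of f g] by (simp add: carrier_interval_bij)
  ultimately show ?thesis by (rule dyadic_pl_imp_thompson_F)
qed

lemma dyadic_pl_inv:
  assumes f: "dyadic_pl S f" "f \<in> Bij {0..1}"
  shows "inv\<^bsub>interval_bij\<^esub> f \<in> thompson_F_carrier"
proof -
  let ?g = "inv\<^bsub>interval_bij\<^esub> f"
  let ?U = "f ` (S \<inter> {0..1})"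
  have gB: "?g \<in> Bij {0..1}"
    using f(2) interval_bij.inv_closed[of f] by (simp add: carrier_interval_bij)
  note gf = inv_interval_bij_apply[OF f(2)]
  have fin: "finite ?U" using f(1) by (simp add: dyadic_pl_def)
  have dyad: "?U \<subseteq> dyadic_reals"
    using f(1) dyadic_pl_dyadic_iff[OF f] by (auto simp: dyadic_pl_def)
  have gmono: "?g x < ?g y" if "x \<in> {0..1}" "y \<in> {0..1}" "x < y" for x y
    using dyadic_pl_mono[OF f(1), of "?g y" "?g x"] gf(1)[of x] gf(1)[of y] gf(3)[of x] gf(3)[of y] that
    by (metis atLeastAtMost_iff not_less)
  have "dyadic_affine ?g a b" if ab: "0 \<le> a" "a < b" "b \<le> 1" "{a<..<b} \<inter> ?U = {}" for a b
  proof -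
    have gab: "0 \<le> ?g a" "?g a < ?g b" "?g b \<le> 1"
      using ab gf(3)[of a] gf(3)[of b] gmono[of a b] by auto
    have "{?g a<..<?g b} \<inter> S = {}"
    proof (rule ccontr)
      assume "{?g a<..<?g b} \<inter> S \<noteq> {}"
      then obtain x where x: "?g a < x" "x < ?g b" "x \<in> S" by auto
      then have "f (?g a) < f x" "f x < f (?g b)"
        using gab by (auto intro!: dyadic_pl_strict_mono[OF f(1)])
      then have "a < f x" "f x < b" using ab gf(1) by auto
      then show False using ab(4) x gab by auto
    qed
    then have "dyadic_affine f (?g a) (?g b)" using f(1) gab by (auto simp: dyadic_pl_def)
    then obtain t where t: "\<And>y. y \<in> {?g a..?g b} \<Longrightarrow> f y = f (?g a) + 2 powi t * (y - ?g a)"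
      by (rule dyadic_affineE) blast
    have "?g x = ?g a + 2 powi (- t) * (x - a)" if x: "x \<in> {a..b}" for x
    proof -
      have "?g x \<in> {?g a..?g b}"
        using x ab gmono[of a x] gmono[of x b] by (cases "x = a"; cases "x = b") auto
      then have "x = a + 2 powi t * (?g x - ?g a)"
        using t[of "?g x"] gf(1)[of x] gf(1)[of a] x ab by simp
      then have "2 powi (- t) * (x - a) = (2 powi (- t) * 2 powi t) * (?g x - ?g a)" by simp
      also have "2 powi (- t) * 2 powi t = (1::real)" by (simp add: power_int_minus)
      finally show ?thesis by simp
    qed
    then show ?thesis by (rule dyadic_affineI)
  qed
  then have "dyadic_pl ?U ?g" using fin dyad by (auto simp: dyadic_pl_def)
  then show ?thesis using gB by (rule dyadic_pl_imp_thompson_F)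
qed

lemma dyadic_pl_one: "dyadic_pl {} \<one>\<^bsub>interval_bij\<^esub>"
  by (auto simp: dyadic_pl_def dyadic_affine_def one_interval_bij_apply intro!: exI[of _ "0::int"])

lemma thompson_F_subgroup: "subgroup thompson_F_carrier interval_bij"
proof
  show "thompson_F_carrier \<subseteq> carrier interval_bij"
    using thompson_F_carrier_Bij by (auto simp: carrier_interval_bij)
  show "\<one>\<^bsub>interval_bij\<^esub> \<in> thompson_F_carrier"
    using dyadic_pl_one interval_bij.one_closed
    by (auto intro: dyadic_pl_imp_thompson_F simp: carrier_interval_bij)
  show "f \<otimes>\<^bsub>interval_bij\<^esub> g \<in> thompson_F_carrier"
    if "f \<in> thompson_F_carrier" "g \<in> thompson_F_carrier" for f g
    using that by (metis dyadic_pl_mult thompson_F_carrier_Bij thompson_F_imp_dyadic_pl)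
  show "inv\<^bsub>interval_bij\<^esub> f \<in> thompson_F_carrier" if "f \<in> thompson_F_carrier" for f
    using that by (metis dyadic_pl_inv thompson_F_carrier_Bij thompson_F_imp_dyadic_pl)
qed

lemma dyadic_reals_vine_pt [simp]: "vine_pt j \<in> dyadic_reals"
  unfolding vine_pt_def by (intro dyadic_reals_diff) auto

lemma F_gen_in_thompson_F: "F_gen j \<in> thompson_F_carrier"
proof (rule dyadic_pl_imp_thompson_F)
  show "F_gen j \<in> Bij {0..1}" by (rule F_gen_Bij)
  let ?p = "vine_pt j"
  let ?S = "{?p, vine_pt (Suc j), vine_pt (Suc (Suc j))}"
  have S: "vine_pt (Suc j) = (1 + ?p) / 2" "vine_pt (Suc (Suc j)) = (3 + ?p) / 4"
    by (simp_all add: vine_pt_Suc field_simps)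
  note c = contraction_cases[of ?p, OF vine_pt_bounds(3)]
  have "dyadic_affine (F_gen j) a b" if ab: "0 \<le> a" "a < b" "b \<le> 1" "{a<..<b} \<inter> ?S = {}" for a b
  proof -
    have val: "F_gen j x = contraction ?p x" if "x \<in> {a..b}" for x
      using that ab by (auto simp: F_gen_apply)
    have "b \<le> ?p \<or> (?p \<le> a \<and> b \<le> (1 + ?p) / 2) \<or>
        ((1 + ?p) / 2 \<le> a \<and> b \<le> (3 + ?p) / 4) \<or> (3 + ?p) / 4 \<le> a"
      using ab(2,4) by (force simp: S simp del: vine_pt_bounds)
    then show ?thesis
    proof (elim disjE conjE)
      assume "b \<le> ?p"
      then have "F_gen j x = F_gen j a + 2 powi 0 * (x - a)" if "x \<in> {a..b}" for x
        using that ab val[of x] val[of a] c(1)[of x] c(1)[of a]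
        by (simp add: power_int_minus field_simps)
      then show ?thesis by (rule dyadic_affineI)
    next
      assume "?p \<le> a" "b \<le> (1 + ?p) / 2"
      then have "F_gen j x = F_gen j a + 2 powi (-1) * (x - a)" if "x \<in> {a..b}" for x
        using that ab val[of x] val[of a] c(2)[of x] c(2)[of a]
        by (simp add: power_int_minus field_simps)
      then show ?thesis by (rule dyadic_affineI)
    next
      assume "(1 + ?p) / 2 \<le> a" "b \<le> (3 + ?p) / 4"
      then have "F_gen j x = F_gen j a + 2 powi 0 * (x - a)" if "x \<in> {a..b}" for x
        using that ab val[of x] val[of a] c(3)[of x] c(3)[of a]
        by (simp add: power_int_minus field_simps)
      then show ?thesis by (rule dyadic_affineI)
    next
      assume "(3 + ?p) / 4 \<le> a"
      then have "F_gen j x = F_gen j a + 2 powi 1 * (x - a)" if "x \<in> {a..b}" for x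
        using that ab val[of x] val[of a] c(4)[of x] c(4)[of a]
        by (simp add: power_int_minus field_simps)
      then show ?thesis by (rule dyadic_affineI)
    qed
  qed
  then show "dyadic_pl ?S (F_gen j)" by (auto simp: dyadic_pl_def)
qed



section \<open>Dyadic partitions and positive words\<close>

text \<open>
A standard dyadic interval: its end points are adjacent multiples of \<open>1 / 2 ^ e\<close>.
\<close>

definition standard_piece :: "nat \<Rightarrow> real \<Rightarrow> real \<Rightarrow> bool" where
  "standard_piece e a b \<longleftrightarrow> (\<exists>m::nat. a = real m / 2 ^ e \<and> b = (real m + 1) / 2 ^ e)"

text \<open>
  A partition of the unit interval into standard dyadic intervals, the last one beginning at \<open>d M\<close>.
  It is continued to an infinite sequence by halving the last interval again and again, so that its
  points correspond to those of the right vine.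
\<close>

definition dyadic_partition :: "nat \<Rightarrow> (nat \<Rightarrow> real) \<Rightarrow> bool" where
  "dyadic_partition M d \<longleftrightarrow> d 0 = 0 \<and>
     (\<forall>k<M. \<exists>e. standard_piece e (d k) (d (Suc k))) \<and> (\<exists>e. standard_piece e (d M) 1) \<and>
     (\<forall>k\<ge>M. d (Suc k) = (1 + d k) / 2)"

text \<open>
  Each interval of the right vine is mapped affinely onto the corresponding interval of the
  partition; \<open>2 ^ Suc k\<close> is the inverse of the length of the \<open>k\<close>-th interval of the vine.
\<close>

definition maps_vine :: "(real \<Rightarrow> real) \<Rightarrow> (nat \<Rightarrow> real) \<Rightarrow> bool" where
  "maps_vine h d \<longleftrightarrow> (\<forall>k. \<forall>x\<in>{vine_pt k..vine_pt (Suc k)}.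
     h x = d k + (d (Suc k) - d k) * ((x - vine_pt k) * 2 ^ Suc k))"

lemma maps_vineD:
  "maps_vine h d \<Longrightarrow> vine_pt k \<le> x \<Longrightarrow> x \<le> vine_pt (Suc k) \<Longrightarrow>
     h x = d k + (d (Suc k) - d k) * ((x - vine_pt k) * 2 ^ Suc k)"
  unfolding maps_vine_def by (meson atLeastAtMost_iff)

lemma standard_piece_less: "standard_piece e a b \<Longrightarrow> 0 \<le> a \<and> a < b"
  by (auto simp: standard_piece_def divide_strict_right_mono)

lemma odd_numerator_unique:
  assumes "real m / 2 ^ E = real m' / 2 ^ e" "e \<le> E" "odd m"
  shows "e = E \<and> m' = m"
proof -
  have "real m = real m' * 2 ^ E / 2 ^ e" using assms(1) by (simp add: field_simps)
  also have "\<dots> = real m' * 2 ^ (E - e)" using assms(2) by (simp add: power_diff)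
  finally have m: "m = m' * 2 ^ (E - e)"
    by (metis of_nat_eq_iff of_nat_mult of_nat_numeral of_nat_power)
  then have "E - e = 0" using assms(3) by (metis dvd_triv_right even_mult_iff even_power neq0_conv even_numeral)
  then show ?thesis using m assms(2) by simp
qed

text \<open>
  The finest piece of a partition has a sibling among the pieces, with which it forms the next
  larger standard dyadic interval: its neighbour on the side of the sibling is standard, not
  shorter, and begins or ends at an odd multiple of \<open>1 / 2 ^ E\<close>.
\<close>

lemma sibling_pieces:
  assumes e: "\<And>k. k \<le> Suc M \<Longrightarrow> standard_piece (e k) (d k) (D k)"
    and D: "\<And>k. k \<le> M \<Longrightarrow> D k = d (Suc k)" and D1: "D (Suc M) = 1" and d0: "d 0 = 0"
  obtains k E n where "k \<le> M" "d k = 2 * real n / 2 ^ E" "d (Suc k) = (2 * real n + 1) / 2 ^ E"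
    "D (Suc k) = (2 * real n + 2) / 2 ^ E"
proof -
  have "Max (e ` {..Suc M}) \<in> e ` {..Suc M}" by (intro Max_in) auto
  then obtain k where k: "k \<le> Suc M" "e k = Max (e ` {..Suc M})" by (metis atMost_iff imageE)
  have max: "e i \<le> e k" if "i \<le> Suc M" for i
    unfolding k(2) using that by (intro Max_ge) auto
  obtain m where m: "d k = real m / 2 ^ e k" "D k = (real m + 1) / 2 ^ e k"
    using e[OF k(1)] by (auto simp: standard_piece_def)
  show thesis
  proof (cases "even m")
    case True
    have "k \<noteq> Suc M"
    proof
      assume kM: "k = Suc M"
      then have "real (m + 1) = real (2 ^ e k)" using m(2) D1 by (simp add: field_simps)
      then have "m + 1 = 2 ^ e k" by (simp only: of_nat_eq_iff)
      moreover have "odd (m + 1)" using True by simp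
      ultimately have "e k = 0" by (metis even_numeral even_power neq0_conv)
      then have "m = 0" using \<open>m + 1 = 2 ^ e k\<close> by simp
      then have "d (Suc M) = 0" using m(1) kM by simp
      moreover have "0 \<le> d M \<and> d M < d (Suc M)"
        using e[of M] D[of M] standard_piece_less by fastforce
      ultimately show False by simp
    qed
    then have kM: "k \<le> M" using k(1) by simp
    obtain m' where m': "d (Suc k) = real m' / 2 ^ e (Suc k)"
      "D (Suc k) = (real m' + 1) / 2 ^ e (Suc k)"
      using e[of "Suc k"] kM by (auto simp: standard_piece_def)
    have "e (Suc k) = e k \<and> m' = m + 1"
      using m(2) m'(1) D[OF kM] True max[of "Suc k"] kM
      by (intro odd_numerator_unique) (auto simp: add.commute)
    then show thesis
      using True that[of k "m div 2" "e k"] kM m m' D[OF kM] by (auto elim!: evenE)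
  next
    case False
    have "k \<noteq> 0" using False m(1) d0 by (intro notI) (auto simp: odd_pos)
    then obtain l where l: "k = Suc l" "l \<le> M" using k(1) by (cases k) auto
    obtain m' where m': "d l = real m' / 2 ^ e l" "D l = (real m' + 1) / 2 ^ e l"
      using e[of l] l by (auto simp: standard_piece_def)
    have "e l = e k \<and> m' + 1 = m"
      using m(1) m'(2) D[OF l(2)] False max[of l] l
      by (intro odd_numerator_unique) (auto simp: add.commute)
    moreover from this False have "even m'" by auto
    ultimately show thesis
      using that[of l "m' div 2" "e k"] l m m' D[OF l(2)] by (auto elim!: evenE)
  qed
qed

text \<open>
  Composition with the \<open>k\<close>-th generator undoes the deletion of the point with index \<open>k + 1\<close> from a
  partition: the generator maps the vine to the vine with its \<open>k\<close>-th interval halved.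
\<close>

lemma maps_vine_split:
  assumes h: "maps_vine h d'" and d: "d (Suc k) = (d k + d (Suc (Suc k))) / 2"
    and d': "\<And>i. d' i = (if i \<le> k then d i else d (Suc i))"
  shows "maps_vine (\<lambda>x. h (contraction (vine_pt k) x)) d"
  unfolding maps_vine_def
proof (intro allI ballI)
  fix i x assume x: "x \<in> {vine_pt i..vine_pt (Suc i)}"
  let ?v = "vine_pt k" and ?P = "(2::real) ^ k"
  have v: "?v = 1 - 1 / ?P" by (simp add: vine_pt_def)
  have v1: "vine_pt (Suc k) = (1 + ?v) / 2" and v2: "vine_pt (Suc (Suc k)) = (3 + ?v) / 4"
    by (simp_all add: vine_pt_Suc field_simps)
  have v_le: "vine_pt (Suc i) \<le> 1" by (rule vine_pt_bounds(3))
  have P: "0 < ?P" by simp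
  consider "i < k" | "i = k" | "i = Suc k" | l where "i = Suc l" "k < l"
    by (metis Suc_lessI less_antisym not_less_eq less_linear gr_implies_not0 not0_implies_Suc Suc_less_eq)
  then show "h (contraction ?v x) = d i + (d (Suc i) - d i) * ((x - vine_pt i) * 2 ^ Suc i)"
  proof cases
    case 1
    then have "vine_pt (Suc i) \<le> ?v" by simp
    then have "x \<le> ?v" using x by (simp del: vine_pt_le_iff)
    then have "contraction ?v x = x" by (intro contraction_cases(1)) auto
    then show ?thesis using maps_vineD[OF h, of i x] x 1 by (simp add: d')
  next
    case 2
    then have x': "?v \<le> x" "x \<le> (1 + ?v) / 2" using x v1 by auto
    then have cx: "contraction ?v x = (x + ?v) / 2" by (intro contraction_cases(2)) auto
    have "h ((x + ?v) / 2) = d k + (d (Suc (Suc k)) - d k) * (((x + ?v) / 2 - ?v) * 2 ^ Suc k)"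
      using maps_vineD[OF h, of k "(x + ?v) / 2"] x' v1 by (simp add: d')
    moreover have "(d (Suc (Suc k)) - d k) * (((x + ?v) / 2 - ?v) * 2 ^ Suc k)
        = (d (Suc k) - d k) * ((x - ?v) * 2 ^ Suc k)"
      unfolding d by (simp add: field_simps)
    ultimately show ?thesis unfolding 2 cx by (simp only:)
  next
    case 3
    then have x': "(1 + ?v) / 2 \<le> x" "x \<le> (3 + ?v) / 4" using x v1 v2 by auto
    then have cx: "contraction ?v x = x - (1 - ?v) / 4" by (intro contraction_cases(3)) auto
    have "h (x - (1 - ?v) / 4) =
        d k + (d (Suc (Suc k)) - d k) * ((x - (1 - ?v) / 4 - ?v) * 2 ^ Suc k)"
      using maps_vineD[OF h, of k "x - (1 - ?v) / 4"] x' v1 by (simp add: d' field_simps)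
    also have "\<dots> = d (Suc k) + (d (Suc (Suc k)) - d (Suc k)) * ((x - (1 + ?v) / 2) * 2 ^ Suc (Suc k))"
      unfolding d v using P by (simp add: field_simps)
    finally show ?thesis using 3 cx v1 by simp
  next
    case (4 l)
    have "vine_pt (Suc (Suc k)) \<le> vine_pt i" using 4 by simp
    then have "(3 + ?v) / 4 \<le> x" "x \<le> 1"
      using x v_le unfolding v2 atLeastAtMost_iff by linarith+
    then have cx: "contraction ?v x = 2 * x - 1" by (intro contraction_cases(4)) auto
    have "vine_pt l \<le> 2 * x - 1" "2 * x - 1 \<le> vine_pt (Suc l)"
      using x 4(1) by (auto simp: vine_pt_Suc field_simps)
    then have "h (2 * x - 1) = d' l + (d' (Suc l) - d' l) * ((2 * x - 1 - vine_pt l) * 2 ^ Suc l)"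
      by (rule maps_vineD[OF h])
    also have "2 * x - 1 - vine_pt l = 2 * (x - vine_pt i)"
      using 4(1) by (simp add: vine_pt_Suc field_simps)
    finally show ?thesis using 4 cx by (simp add: d' mult.assoc mult.commute mult.left_commute)
  qed
qed

lemma F_word_append_apply:
  "t \<in> {0..1} \<Longrightarrow> F_word (u @ v) t = F_word u (F_word v t)"
  by (simp add: F_gen.pos_val_append mult_interval_bij_apply F_word_Bij)

lemma F_word_single_apply: "t \<in> {0..1} \<Longrightarrow> F_word [k] t = contraction (vine_pt k) t"
  using F_word_Cons_apply[of t k "[]"] F_word_Nil_apply[of t] by (simp del: pos_val_simps)

text \<open>
  Merging two siblings gives a coarser partition, and undoing the merger amounts to composing with
  a generator. If the siblings are the last two intervals, then the point between them already
  belongs to the infinite continuation of the coarser partition and no generator is needed. If the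
  partition begins with \<open>j\<close> intervals of the vine, then these do not take part in mergers before the
  vine is reached, so that all letters are at least \<open>j\<close>.
\<close>

lemma positive_word_of_partition:
  assumes "dyadic_partition M d" "\<And>i. i \<le> j \<Longrightarrow> d i = vine_pt i"
  shows "\<exists>w. (\<forall>i\<in>set w. j \<le> i) \<and> maps_vine (F_word w) d"
  using assms
proof (induction M arbitrary: d)
  case 0
  have "d k = vine_pt k" for k
    using 0 by (induction k) (auto simp: dyadic_partition_def vine_pt_Suc)
  moreover have "maps_vine (F_word []) vine_pt"
    unfolding maps_vine_def
  proof (intro allI ballI)
    fix k x assume "x \<in> {vine_pt k..vine_pt (Suc k)}"
    then have "x \<in> {0..1}"
      using vine_pt_bounds(1)[of k] vine_pt_bounds(3)[of "Suc k"] by (simp del: vine_pt_bounds)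
    moreover have "(vine_pt (Suc k) - vine_pt k) * 2 ^ Suc k = 1"
      by (simp add: vine_pt_def field_simps)
    then have "(vine_pt (Suc k) - vine_pt k) * ((x - vine_pt k) * 2 ^ Suc k) = x - vine_pt k"
      by (metis mult.assoc mult.commute mult_1)
    then have eq: "vine_pt k + (vine_pt (Suc k) - vine_pt k) * ((x - vine_pt k) * 2 ^ Suc k) = x"
      by linarith
    ultimately show "F_word [] x = vine_pt k +
        (vine_pt (Suc k) - vine_pt k) * ((x - vine_pt k) * 2 ^ Suc k)"
      unfolding eq by (intro F_word_Nil_apply)
  qed
  ultimately show ?case by (intro exI[of _ "[]"]) (auto simp: maps_vine_def)
next
  case (Suc M)
  define D where "D k = (if k \<le> M then d (Suc k) else 1)" for k
  have d0: "d 0 = 0" and pieces: "\<And>k. k \<le> M \<Longrightarrow> \<exists>e. standard_piece e (d k) (d (Suc k))"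
    and last: "\<exists>e. standard_piece e (d (Suc M)) 1"
    and tail: "\<And>k. Suc M \<le> k \<Longrightarrow> d (Suc k) = (1 + d k) / 2"
    using Suc.prems(1) by (auto simp: dyadic_partition_def less_Suc_eq_le)
  have "\<exists>e. standard_piece e (d k) (D k)" if "k \<le> Suc M" for k
    using that pieces last by (cases "k \<le> M") (auto simp: D_def le_Suc_eq)
  then obtain e where e: "\<And>k. k \<le> Suc M \<Longrightarrow> standard_piece (e k) (d k) (D k)"
    by metis
  obtain k E n where k: "k \<le> M" and dk: "d k = 2 * real n / 2 ^ E"
    "d (Suc k) = (2 * real n + 1) / 2 ^ E" "D (Suc k) = (2 * real n + 2) / 2 ^ E"
    by (rule sibling_pieces[of M e d D]) (use e d0 in \<open>auto simp: D_def\<close>)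
  have less1: "d i < 1" if "i \<le> Suc M" for i
    using that
  proof (induction "Suc M - i" arbitrary: i)
    case 0
    then have "i = Suc M" by simp
    then show ?case using last standard_piece_less by blast
  next
    case (Suc q)
    then have "d (Suc i) < 1" by simp
    moreover have "d i < d (Suc i)"
      using pieces[of i] Suc standard_piece_less by fastforce
    ultimately show ?case by simp
  qed
  have "D (Suc k) \<le> 1" using less1[of "Suc (Suc k)"] by (auto simp: D_def)
  then have "2 * real n + 2 \<le> 2 ^ E" using dk(3) by (simp add: field_simps)
  then have "E \<noteq> 0" by (intro notI) auto
  then obtain E' where E': "E = Suc E'" by (cases E) auto
  have merged: "standard_piece E' (d k) (D (Suc k))"
    unfolding standard_piece_def by (intro exI[of _ n]) (simp add: dk E' field_simps)
  have mid: "d (Suc k) = (d k + D (Suc k)) / 2"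
    unfolding dk by (simp add: field_simps)
  show ?case
  proof (cases "k = M")
    case True
    have "dyadic_partition M d"
      unfolding dyadic_partition_def
    proof (intro conjI allI impI)
      show "\<exists>e. standard_piece e (d M) 1" using merged True by (auto simp: D_def)
      show "d (Suc i) = (1 + d i) / 2" if "M \<le> i" for i
        using that tail[of i] mid True by (cases "i = M") (auto simp: D_def add.commute)
    qed (use d0 pieces in auto)
    then show ?thesis using Suc.prems(2) by (rule Suc.IH)
  next
    case False
    then have kM: "k < M" and Dk: "D (Suc k) = d (Suc (Suc k))" using k by (auto simp: D_def)
    \<comment> \<open>Otherwise the siblings are the halves of the part right of \<open>vine_pt k\<close>, and nothing is left
      for the pieces after them.\<close>
    have jk: "j \<le> k"
    proof (rule ccontr)
      assume "\<not> j \<le> k"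
      then have "d k = vine_pt k" "d (Suc k) = vine_pt (Suc k)" using Suc.prems(2) by auto
      then have "d (Suc (Suc k)) = 1" using mid Dk by (simp add: vine_pt_Suc field_simps)
      moreover have "d (Suc (Suc k)) < 1" using kM by (intro less1) auto
      ultimately show False by simp
    qed
    define d' where "d' i = (if i \<le> k then d i else d (Suc i))" for i
    have "dyadic_partition M d'"
      unfolding dyadic_partition_def
    proof (intro conjI allI impI)
      show "d' 0 = 0" using d0 by (simp add: d'_def)
      show "\<exists>e. standard_piece e (d' i) (d' (Suc i))" if "i < M" for i
        using that pieces[of i] pieces[of "Suc i"] merged Dk
        by (cases i k rule: linorder_cases) (auto simp: d'_def)
      show "\<exists>e. standard_piece e (d' M) 1" using last kM by (simp add: d'_def)
      show "d' (Suc i) = (1 + d' i) / 2" if "M \<le> i" for i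
        using that kM tail[of "Suc i"] by (simp add: d'_def)
    qed
    moreover have "d' i = vine_pt i" if "i \<le> j" for i
      using that jk Suc.prems(2) by (simp add: d'_def)
    ultimately obtain w where w: "\<forall>i\<in>set w. j \<le> i" "maps_vine (F_word w) d'"
      using Suc.IH by blast
    have "maps_vine (\<lambda>x. F_word w (contraction (vine_pt k) x)) d"
      using w(2) mid[unfolded Dk] d'_def by (rule maps_vine_split)
    moreover have "F_word (w @ [k]) x = F_word w (contraction (vine_pt k) x)"
      if "x \<in> {vine_pt i..vine_pt (Suc i)}" for i x
    proof -
      have "x \<in> {0..1}"
        using that vine_pt_bounds(1)[of i] vine_pt_bounds(3)[of "Suc i"] by (simp del: vine_pt_bounds)
      then show ?thesis by (simp add: F_word_append_apply F_word_single_apply del: pos_val_simps)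
    qed
    ultimately have "maps_vine (F_word (w @ [k])) d"
      unfolding maps_vine_def by metis
    then show ?thesis using w(1) jk by (intro exI[of _ "w @ [k]"]) auto
  qed
qed

lemma vine_cover:
  assumes "0 \<le> x" "x < 1" obtains k where "vine_pt k \<le> x" "x \<le> vine_pt (Suc k)"
proof -
  obtain n where "(1/2::real) ^ n < 1 - x"
    using real_arch_pow_inv[of "1 - x" "1/2"] assms by auto
  then have ex: "x < vine_pt n" by (simp add: vine_pt_def power_one_over)
  define m where "m = (LEAST n. x < vine_pt n)"
  have m: "x < vine_pt m" unfolding m_def using ex by (rule LeastI)
  then obtain k where k: "m = Suc k" using assms by (cases m) auto
  have "\<not> x < vine_pt k" using not_less_Least[of k "\<lambda>n. x < vine_pt n"] k by (simp add: m_def)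
  then show thesis using that[of k] m k by simp
qed

text \<open>
  On an interval of linearity \<open>f x = 2 powi s * x + c\<close> with a dyadic number \<open>c\<close>. As soon as
  \<open>c\<close> is a multiple of \<open>1 / 2 ^ e\<close>, where \<open>e = N - s\<close>, the cells of the grid with mesh \<open>1 / 2 ^ N\<close> are
  mapped onto cells of the grid with mesh \<open>1 / 2 ^ e\<close>. For large \<open>N\<close>, moreover, the break points
  belong to the grid.
\<close>

lemma dyadic_pl_fine_grid:
  assumes f: "dyadic_pl S f" "f \<in> Bij {0..1}"
  obtains N0 where "\<And>N i. N0 \<le> N \<Longrightarrow> i < 2 ^ N \<Longrightarrow>
      dyadic_affine f (real i / 2 ^ N) ((real i + 1) / 2 ^ N) \<and>
      (\<exists>e. standard_piece e (f (real i / 2 ^ N)) (f ((real i + 1) / 2 ^ N)))"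
proof -
  define good where "good N i \<longleftrightarrow> dyadic_affine f (real i / 2 ^ N) ((real i + 1) / 2 ^ N) \<and>
      (\<exists>e. standard_piece e (f (real i / 2 ^ N)) (f ((real i + 1) / 2 ^ N)))" for N i :: nat
  have S: "finite S" "S \<subseteq> dyadic_reals" using f(1) by (simp_all add: dyadic_pl_def)
  have "a \<in> dyadic_reals \<longrightarrow> b \<in> dyadic_reals \<longrightarrow> (\<exists>N0. \<forall>N\<ge>N0. \<forall>i.
      a \<le> real i / 2 ^ N \<and> (real i + 1) / 2 ^ N \<le> b \<longrightarrow> good N i)"
    if "0 \<le> a" "a < b" "b \<le> 1" for a b
    using S(1) that
  proof (induction rule: subdivision_induct)
    case (piece a b)
    then have aff: "dyadic_affine f a b" using f(1) unfolding dyadic_pl_def by blast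
    then obtain s where s: "\<And>x. x \<in> {a..b} \<Longrightarrow> f x = f a + 2 powi s * (x - a)"
      by (rule dyadic_affineE) blast
    show ?case
    proof (intro impI)
      assume ab: "a \<in> dyadic_reals" "b \<in> dyadic_reals"
      define c where "c = f a - 2 powi s * a"
      have "f a \<in> dyadic_reals" using ab piece dyadic_pl_dyadic_iff[OF f, of a] by auto
      then have "c \<in> dyadic_reals" unfolding c_def using ab by (intro dyadic_reals_diff) auto
      then obtain n where n: "c * 2 ^ n \<in> \<int>" by (auto simp: dyadic_reals_def)
      \<comment> \<open>The bound ensures \<open>n \<le> N - s\<close> for both signs of \<open>s\<close>.\<close>
      have "good N i" if N: "n + nat \<bar>s\<bar> \<le> N" and i: "a \<le> real i / 2 ^ N" "(real i + 1) / 2 ^ N \<le> b"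
        for N i :: nat
      proof -
        define e where "e = nat (int N - s)"
        have e: "n \<le> e" "int e = int N - s" using N by (auto simp: e_def)
        have "(2::real) ^ e = 2 powi (int N - s)" unfolding e(2)[symmetric] by simp
        also have "\<dots> = 2 ^ N / 2 powi s" by (simp add: power_int_diff)
        finally have pe: "2 powi s * (2::real) ^ e = 2 ^ N" by simp
        have val: "f (y / 2 ^ N) = (y + c * 2 ^ e) / 2 ^ e" if "y / 2 ^ N \<in> {a..b}" for y
        proof -
          have "f (y / 2 ^ N) = 2 powi s * y / 2 ^ N + c"
            using s[OF that] by (simp add: c_def algebra_simps)
          also have "\<dots> = (y + c * 2 ^ e) / 2 ^ e"
            unfolding pe[symmetric] by (simp add: field_simps)
          finally show ?thesis .
        qed
        have step: "real i / 2 ^ N \<le> (real i + 1) / 2 ^ N" by (simp add: divide_right_mono)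
        have mem: "real i / 2 ^ N \<in> {a..b}" "(real i + 1) / 2 ^ N \<in> {a..b}"
          using i step by auto
        have "c * 2 ^ e \<in> \<int>" using n e(1) by (rule dyadic_reals_scale_mono)
        then obtain z where z: "c * 2 ^ e = real_of_int z" by (auto elim: Ints_cases)
        have "0 \<le> f (real i / 2 ^ N)"
          using mem(1) piece Bij_apply_mem[OF f(2), of "real i / 2 ^ N"]
          unfolding atLeastAtMost_iff by linarith
        moreover have "real i + real_of_int z = f (real i / 2 ^ N) * 2 ^ e"
          using val[OF mem(1)] z by simp
        ultimately have "0 \<le> real i + real_of_int z" by simp
        then have "0 \<le> int i + z" by linarith
        then obtain m where m: "int i + z = int m" by (metis nonneg_int_cases)
        then have rm: "real i + real_of_int z = real m" by (metis of_int_add of_int_of_nat_eq)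
        have "standard_piece e (f (real i / 2 ^ N)) (f ((real i + 1) / 2 ^ N))"
          unfolding standard_piece_def val[OF mem(1)] val[OF mem(2)] z
          using rm by (intro exI[of _ m]) (simp add: algebra_simps)
        moreover have "dyadic_affine f (real i / 2 ^ N) ((real i + 1) / 2 ^ N)"
          using aff i by (rule dyadic_affine_subinterval)
        ultimately show ?thesis by (auto simp: good_def)
      qed
      then show "\<exists>N0. \<forall>N\<ge>N0. \<forall>i. a \<le> real i / 2 ^ N \<and> (real i + 1) / 2 ^ N \<le> b \<longrightarrow> good N i"
        by blast
    qed
  next
    case (join a p b)
    have p: "p \<in> dyadic_reals" using join S(2) by auto
    show ?case
    proof (intro impI)
      assume ab: "a \<in> dyadic_reals" "b \<in> dyadic_reals"
      obtain N1 where N1: "\<And>N i. N1 \<le> N \<Longrightarrow> a \<le> real i / 2 ^ N \<Longrightarrow> (real i + 1) / 2 ^ N \<le> p \<Longrightarrow> good N i"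
        using join.IH(1) ab p by blast
      obtain N2 where N2: "\<And>N i. N2 \<le> N \<Longrightarrow> p \<le> real i / 2 ^ N \<Longrightarrow> (real i + 1) / 2 ^ N \<le> b \<Longrightarrow> good N i"
        using join.IH(2) ab p by blast
      obtain n where n: "p * 2 ^ n \<in> \<int>" using p by (auto simp: dyadic_reals_def)
      have "good N i" if N: "max n (max N1 N2) \<le> N"
        and i: "a \<le> real i / 2 ^ N" "(real i + 1) / 2 ^ N \<le> b" for N i :: nat
      proof -
        have "p * 2 ^ N \<in> \<int>" using n by (rule dyadic_reals_scale_mono) (use N in auto)
        then obtain z where z: "p * 2 ^ N = real_of_int z" by (auto elim: Ints_cases)
        then have pz: "p = real_of_int z / 2 ^ N" by (simp add: field_simps)
        have "int i + 1 \<le> z \<or> z \<le> int i" by linarith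
        then show ?thesis
        proof
          assume "int i + 1 \<le> z"
          then have "real i + 1 \<le> real_of_int z" by linarith
          then have "(real i + 1) / 2 ^ N \<le> p" unfolding pz by (simp add: divide_right_mono)
          then show ?thesis using N1 N i by simp
        next
          assume "z \<le> int i"
          then have "real_of_int z \<le> real i" by linarith
          then have "p \<le> real i / 2 ^ N" unfolding pz by (simp add: divide_right_mono)
          then show ?thesis using N2 N i by simp
        qed
      qed
      then show "\<exists>N0. \<forall>N\<ge>N0. \<forall>i. a \<le> real i / 2 ^ N \<and> (real i + 1) / 2 ^ N \<le> b \<longrightarrow> good N i"
        by blast
    qed
  qed
  from this[of 0 1] obtain N0 where N0: "\<And>N i. N0 \<le> N \<Longrightarrow> (real i + 1) / 2 ^ N \<le> 1 \<Longrightarrow> good N i"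
    by auto
  show thesis
  proof (rule that[of N0])
    fix N i :: nat assume "N0 \<le> N" "i < 2 ^ N"
    moreover from this have "real (i + 1) \<le> real (2 ^ N)" by (simp only: of_nat_le_iff)
    then have "(real i + 1) / 2 ^ N \<le> 1" by simp
    ultimately show "dyadic_affine f (real i / 2 ^ N) ((real i + 1) / 2 ^ N) \<and>
      (\<exists>e. standard_piece e (f (real i / 2 ^ N)) (f ((real i + 1) / 2 ^ N)))"
      using N0 by (simp add: good_def)
  qed
qed

text \<open>
  The partition of the interval from \<open>vine_pt j\<close> to \<open>1\<close> into \<open>2 ^ N\<close> equal parts, preceded by the
  vine and continued by halving the last part repeatedly.
\<close>

definition grid :: "nat \<Rightarrow> nat \<Rightarrow> nat \<Rightarrow> real" where
  "grid j N k = (if k < j then vine_pt k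
     else if k < j + 2 ^ N then vine_pt j + real (k - j) / 2 ^ (j + N)
     else 1 - 1 / 2 ^ (j + N + (Suc k - (j + 2 ^ N))))"

lemma grid_vine: "k \<le> j \<Longrightarrow> grid j N k = vine_pt k"
  by (auto simp: grid_def)

lemma grid_cell:
  assumes "j \<le> k" "k < j + 2 ^ N"
  obtains i where "i < 2 ^ (j + N)" "grid j N k = real i / 2 ^ (j + N)"
    "Suc k < j + 2 ^ N \<Longrightarrow> grid j N (Suc k) = (real i + 1) / 2 ^ (j + N)"
    "Suc k = j + 2 ^ N \<Longrightarrow> 1 = (real i + 1) / 2 ^ (j + N)"
proof -
  define i where "i = (2 ^ j - 1) * 2 ^ N + (k - j)"
  have ri: "real i = (2 ^ j - 1) * 2 ^ N + real (k - j)"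
    by (simp add: i_def of_nat_diff)
  have pt: "vine_pt j = (2 ^ j - 1) * 2 ^ N / 2 ^ (j + N)"
    by (simp add: vine_pt_def power_add field_simps)
  have 1: "grid j N k = real i / 2 ^ (j + N)"
    using assms unfolding grid_def pt ri by (simp add: add_divide_distrib)
  have 2: "grid j N (Suc k) = (real i + 1) / 2 ^ (j + N)" if "Suc k < j + 2 ^ N"
    using assms that unfolding grid_def pt ri by (simp add: add_divide_distrib Suc_diff_le)
  have 3: "1 = (real i + 1) / 2 ^ (j + N)" if "Suc k = j + 2 ^ N"
  proof -
    have "Suc (k - j) = 2 ^ N" using that assms(1) by simp
    then have "real (Suc (k - j)) = real (2 ^ N)" by (simp only:)
    then have "real (k - j) = 2 ^ N - 1" by simp
    then show ?thesis unfolding ri by (simp add: power_add field_simps)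
  qed
  have "k - j < 2 ^ N" using assms by auto
  then have "real (k - j) < 2 ^ N" by (metis of_nat_less_iff of_nat_numeral of_nat_power)
  then have "real i < 2 ^ (j + N)" unfolding ri by (simp add: power_add algebra_simps)
  then have "real i < real (2 ^ (j + N))" by simp
  then have "i < 2 ^ (j + N)" by (simp only: of_nat_less_iff)
  then show thesis using 1 2 3 by (rule that)
qed

lemma grid_tail:
  assumes "j + 2 ^ N \<le> Suc k" shows "grid j N (Suc k) = (1 + grid j N k) / 2"
proof -
  have g: "grid j N i = 1 - 1 / 2 ^ (j + N + (Suc i - (j + 2 ^ N)))" if "j + 2 ^ N \<le> Suc i" for i
  proof (cases "Suc i = j + 2 ^ N")
    case True
    have "(1::nat) \<le> 2 ^ N" by simp
    then have "j \<le> i" "i < j + 2 ^ N" using True by linarith+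
    then obtain q where "grid j N i = real q / 2 ^ (j + N)" "1 = (real q + 1) / 2 ^ (j + N)"
      using True by (metis grid_cell)
    then show ?thesis using True by (simp add: add_divide_distrib)
  next
    case False
    then show ?thesis using that by (simp add: grid_def)
  qed
  have "Suc (Suc k) - (j + 2 ^ N) = Suc (Suc k - (j + 2 ^ N))" using assms by (rule Suc_diff_le)
  moreover have "grid j N k = 1 - 1 / 2 ^ (j + N + (Suc k - (j + 2 ^ N)))"
    using assms by (rule g)
  moreover have "grid j N (Suc k) = 1 - 1 / 2 ^ (j + N + (Suc (Suc k) - (j + 2 ^ N)))"
    using assms by (intro g) linarith
  ultimately show ?thesis by (simp only:) (simp add: diff_divide_distrib)
qed

lemma vine_standard_piece: "standard_piece (Suc k) (vine_pt k) (vine_pt (Suc k))"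
  unfolding standard_piece_def
  by (intro exI[of _ "2 ^ Suc k - 2"]) (simp add: vine_pt_def field_simps of_nat_diff)

lemma grid_partition:
  assumes M: "Suc M = j + 2 ^ N"
  shows "dyadic_partition M (grid j N)"
  unfolding dyadic_partition_def
proof (intro conjI allI impI)
  show "grid j N 0 = 0" using grid_vine[of 0 j] by simp
  show "\<exists>e. standard_piece e (grid j N k) (grid j N (Suc k))" if k: "k < M" for k
  proof (cases "k < j")
    case True
    then show ?thesis using vine_standard_piece[of k] grid_vine[of k j] grid_vine[of "Suc k" j] by auto
  next
    case False
    then have "j \<le> k" "k < j + 2 ^ N" "Suc k < j + 2 ^ N" using k M by linarith+
    then obtain i where "grid j N k = real i / 2 ^ (j + N)" "grid j N (Suc k) = (real i + 1) / 2 ^ (j + N)"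
      by (metis grid_cell)
    then show ?thesis by (auto simp: standard_piece_def)
  qed
  have "(1::nat) \<le> 2 ^ N" by simp
  then have "j \<le> M" "M < j + 2 ^ N" using M by linarith+
  then obtain i where "grid j N M = real i / 2 ^ (j + N)" "1 = (real i + 1) / 2 ^ (j + N)"
    using M by (metis grid_cell)
  then show "\<exists>e. standard_piece e (grid j N M) 1"
    unfolding standard_piece_def by blast
next
  fix k assume "M \<le> k"
  then show "grid j N (Suc k) = (1 + grid j N k) / 2"
    using M by (intro grid_tail) linarith
qed

text \<open>
  If \<open>v\<close> is the word of a sufficiently fine partition, then \<open>f\<close> maps the partition to another one,
  with word \<open>u\<close>. The composition of \<open>f\<close> and the map of \<open>v\<close> sends the vine to the image partition, and
  so does the map of \<open>u\<close>.
\<close>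

lemma F_eq_fraction:
  assumes f: "f \<in> thompson_F_carrier" and fixes_left: "\<And>x. x \<in> {0..vine_pt j} \<Longrightarrow> f x = x"
  obtains u v where "\<forall>i\<in>set u. j \<le> i" "\<forall>i\<in>set v. j \<le> i"
    "f = F_word u \<otimes>\<^bsub>interval_bij\<^esub> inv\<^bsub>interval_bij\<^esub> F_word v"
proof -
  have fB: "f \<in> Bij {0..1}" using f by (rule thompson_F_carrier_Bij)
  obtain S where S: "dyadic_pl S f" using f by (rule thompson_F_imp_dyadic_pl)
  note f01 = dyadic_pl_endpoints[OF S fB]
  obtain N where N: "\<And>L i. N \<le> L \<Longrightarrow> i < 2 ^ L \<Longrightarrow>
      dyadic_affine f (real i / 2 ^ L) ((real i + 1) / 2 ^ L) \<and>
      (\<exists>e. standard_piece e (f (real i / 2 ^ L)) (f ((real i + 1) / 2 ^ L)))"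
    using dyadic_pl_fine_grid[OF S fB] by blast
  define d where "d = grid j N"
  obtain M where M: "Suc M = j + 2 ^ N"
    by (metis add_gr_0 gr0_implies_Suc zero_less_numeral zero_less_power)
  then have part: "dyadic_partition M d" unfolding d_def by (rule grid_partition)
  have dv: "d i = vine_pt i" if "i \<le> j" for i using that by (simp add: d_def grid_vine)
  have vine_below: "{vine_pt k..vine_pt (Suc k)} \<subseteq> {0..vine_pt j}" if "k < j" for k
  proof -
    have k: "vine_pt (Suc k) \<le> vine_pt j" using that by simp
    show ?thesis
    proof
      fix x assume "x \<in> {vine_pt k..vine_pt (Suc k)}"
      then show "x \<in> {0..vine_pt j}"
        unfolding atLeastAtMost_iff using k vine_pt_bounds(1)[of k] by linarith
    qed
  qed
  have inner: "dyadic_affine f (d k) (d (Suc k)) \<and> (\<exists>e. standard_piece e (f (d k)) (f (d (Suc k))))"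
    if "k < M" for k
  proof (cases "k < j")
    case True
    have id: "f x = x" if "x \<in> {vine_pt k..vine_pt (Suc k)}" for x
      using that vine_below[OF True] by (intro fixes_left) blast
    have "dyadic_affine f (vine_pt k) (vine_pt (Suc k))"
      by (rule dyadic_affineI[where s = 0]) (simp add: id)
    moreover have "f (vine_pt k) = vine_pt k" "f (vine_pt (Suc k)) = vine_pt (Suc k)"
      by (rule id, simp)+
    ultimately show ?thesis using vine_standard_piece[of k] True by (auto simp: dv)
  next
    case False
    then have "j \<le> k" "k < j + 2 ^ N" "Suc k < j + 2 ^ N" using that M by linarith+
    then obtain i where "i < 2 ^ (j + N)" "d k = real i / 2 ^ (j + N)"
      "d (Suc k) = (real i + 1) / 2 ^ (j + N)"
      unfolding d_def by (metis grid_cell)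
    then show ?thesis using N[of "j + N" i] by simp
  qed
  have last: "dyadic_affine f (d M) 1 \<and> (\<exists>e. standard_piece e (f (d M)) 1)"
  proof -
    have "(1::nat) \<le> 2 ^ N" by simp
    then have "j \<le> M" "M < j + 2 ^ N" using M by linarith+
    then obtain i where "i < 2 ^ (j + N)" "d M = real i / 2 ^ (j + N)"
      "1 = (real i + 1) / 2 ^ (j + N)"
      unfolding d_def using M by (metis grid_cell)
    then show ?thesis using N[of "j + N" i] f01 by simp
  qed
  have tail: "d (Suc k) = (1 + d k) / 2" if "M \<le> k" for k
    using part that by (simp add: dyadic_partition_def)
  have dM: "d M < 1"
    using part standard_piece_less unfolding dyadic_partition_def by blast
  have d_tail: "d M \<le> d k \<and> d k < 1" if "M \<le> k" for k
    using that
  proof (induction k rule: dec_induct)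
    case (step n)
    then show ?case using tail[of n] by simp
  qed (use dM in simp)
  have aff: "dyadic_affine f (d k) (d (Suc k))" for k
  proof (cases "k < M")
    case True
    then show ?thesis using inner by blast
  next
    case False
    then have "d M \<le> d k" "d (Suc k) \<le> 1" using d_tail[of k] d_tail[of "Suc k"] by auto
    then show ?thesis by (rule dyadic_affine_subinterval[OF last[THEN conjunct1]])
  qed
  have d_less: "d k < d (Suc k)" for k
  proof (cases "k < M")
    case True
    then show ?thesis using part standard_piece_less unfolding dyadic_partition_def by blast
  next
    case False
    then show ?thesis using tail[of k] d_tail[of k] by simp
  qed
  have img: "dyadic_partition M (\<lambda>k. f (d k))"
    unfolding dyadic_partition_def
  proof (intro conjI allI impI)
    show "f (d 0) = 0" using part f01 by (simp add: dyadic_partition_def)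
    show "f (d (Suc k)) = (1 + f (d k)) / 2" if k: "M \<le> k" for k
    proof -
      obtain s where s: "\<And>x. x \<in> {d M..1} \<Longrightarrow> f x = f (d M) + 2 powi s * (x - d M)"
        using last[THEN conjunct1] by (rule dyadic_affineE) blast
      have "f (d k) = f (d M) + 2 powi s * (d k - d M)"
        "f (d (Suc k)) = f (d M) + 2 powi s * (d (Suc k) - d M)"
        "1 = f (d M) + 2 powi s * (1 - d M)"
        using s[of "d k"] s[of "d (Suc k)"] s[of 1] d_tail[of k] d_tail[of "Suc k"] k f01 dM by auto
      then show ?thesis unfolding tail[OF k] by (simp add: field_simps)
    qed
  qed (use inner last in auto)
  have img_vine: "f (d i) = vine_pt i" if "i \<le> j" for i
    using that fixes_left[of "vine_pt i"] by (simp add: dv)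
  obtain v where v: "\<forall>i\<in>set v. j \<le> i" "maps_vine (F_word v) d"
    using positive_word_of_partition[OF part dv] by blast
  obtain u where u: "\<forall>i\<in>set u. j \<le> i" "maps_vine (F_word u) (\<lambda>k. f (d k))"
    using positive_word_of_partition[OF img img_vine] by blast
  have "f \<otimes>\<^bsub>interval_bij\<^esub> F_word v = F_word u"
  proof (rule Bij_eqI)
    show "f \<otimes>\<^bsub>interval_bij\<^esub> F_word v \<in> Bij {0..1}"
      using fB F_word_Bij[of v] interval_bij.m_closed[of f "F_word v"]
      by (simp add: carrier_interval_bij)
    fix x :: real assume x: "x \<in> {0..1}"
    have "f (F_word v x) = F_word u x"
    proof (cases "x = 1")
      case True
      have fix1: "F_word w 1 = 1" for w
        by (induction w) (simp_all add: F_word_Nil_apply F_word_Cons_apply contraction_cases(4)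
            del: pos_val_simps)
      show ?thesis using True fix1 f01 by simp
    next
      case False
      then obtain k where k: "vine_pt k \<le> x" "x \<le> vine_pt (Suc k)"
        using vine_cover[of x] x by auto
      define l where "l = (x - vine_pt k) * 2 ^ Suc k"
      have len: "(vine_pt (Suc k) - vine_pt k) * 2 ^ Suc k = 1"
        by (simp add: vine_pt_def field_simps)
      have "l \<le> (vine_pt (Suc k) - vine_pt k) * 2 ^ Suc k"
        unfolding l_def using k by (intro mult_right_mono) auto
      then have "l \<le> 1" by (simp only: len)
      moreover have "0 \<le> l" unfolding l_def using k by simp
      ultimately have l: "0 \<le> l" "l \<le> 1" by simp_all
      define y where "y = d k + (d (Suc k) - d k) * l"
      have y: "F_word v x = y"
        using maps_vineD[OF v(2) k] by (simp add: y_def l_def)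
      define e where "e = (d (Suc k) - d k) * l"
      have "e \<le> (d (Suc k) - d k) * 1"
        unfolding e_def using d_less[of k] l by (intro mult_left_mono) auto
      moreover have "0 \<le> e"
        unfolding e_def using d_less[of k] l by (intro mult_nonneg_nonneg) auto
      moreover have "y = d k + e" by (simp add: y_def e_def)
      ultimately have "y \<in> {d k..d (Suc k)}" by simp
      moreover obtain s where s: "\<And>x. x \<in> {d k..d (Suc k)} \<Longrightarrow> f x = f (d k) + 2 powi s * (x - d k)"
        using aff[of k] by (rule dyadic_affineE) blast
      ultimately have "f y = f (d k) + 2 powi s * (y - d k)" by blast
      then have "f y = f (d k) + 2 powi s * ((d (Suc k) - d k) * l)"
        by (simp add: y_def)
      also have "\<dots> = f (d k) + (f (d (Suc k)) - f (d k)) * l"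
        using s[of "d (Suc k)"] d_less[of k] by simp
      also have "\<dots> = F_word u x"
        using maps_vineD[OF u(2) k] by (simp add: l_def)
      finally show ?thesis by (simp add: y)
    qed
    then show "(f \<otimes>\<^bsub>interval_bij\<^esub> F_word v) x = F_word u x"
      using x by (simp add: mult_interval_bij_apply fB F_word_Bij)
  qed (rule F_word_Bij)
  then have "f = F_word u \<otimes>\<^bsub>interval_bij\<^esub> inv\<^bsub>interval_bij\<^esub> F_word v"
    using fB by (simp add: interval_bij.inv_solve_right carrier_interval_bij F_word_Bij)
  with u(1) v(1) show thesis by (rule that)
qed

text \<open>Every standard generator has slope \<open>2\<close> at \<open>1\<close>.\<close>

lemma F_word_near_1:
  "\<exists>\<eta>\<in>{0..<1}. \<forall>t\<in>{\<eta>..1}. F_word w t = 1 - 2 ^ length w * (1 - t)"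
proof (induction w)
  case Nil
  show ?case by (intro bexI[of _ 0]) (auto simp: F_word_Nil_apply simp del: pos_val_simps)
next
  case (Cons i w)
  then obtain \<eta> where \<eta>: "0 \<le> \<eta>" "\<eta> < 1"
    "\<And>t. t \<in> {\<eta>..1} \<Longrightarrow> F_word w t = 1 - 2 ^ length w * (1 - t)"
    by auto
  \<comment> \<open>The distance from \<open>1\<close> up to which the generator is a dilation.\<close>
  define c where "c = (1 - vine_pt i) / 4"
  have c: "0 < c" by (simp add: c_def)
  define \<theta> where "\<theta> = max \<eta> (1 - c / 2 ^ length w)"
  have "0 \<le> \<theta>" "\<theta> < 1" using \<eta> c by (auto simp: \<theta>_def)
  moreover have "F_word (i # w) t = 1 - 2 ^ length (i # w) * (1 - t)" if t: "t \<in> {\<theta>..1}" for t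
  proof -
    have "1 - t \<le> c / 2 ^ length w" using t by (simp add: \<theta>_def)
    then have "2 ^ length w * (1 - t) \<le> c" by (simp add: field_simps)
    moreover have "0 \<le> 2 ^ length w * (1 - t)" using t by simp
    ultimately have "(3 + vine_pt i) / 4 \<le> 1 - 2 ^ length w * (1 - t)"
      "1 - 2 ^ length w * (1 - t) \<le> 1"
      by (auto simp: c_def field_simps)
    then have "contraction (vine_pt i) (1 - 2 ^ length w * (1 - t))
        = 2 * (1 - 2 ^ length w * (1 - t)) - 1"
      by (intro contraction_cases(4)) auto
    moreover have "t \<in> {0..1}" "t \<in> {\<eta>..1}" using t \<eta> by (auto simp: \<theta>_def)
    ultimately show ?thesis using \<eta>(3)[of t] by (simp add: F_word_Cons_apply del: pos_val_simps)
  qed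
  ultimately show ?case by (intro bexI[of _ \<theta>]) auto
qed

text \<open>
The slope of \<open>f\<close> at \<open>1\<close> is the quotient of the slopes of the two words.
\<close>

lemma fraction_length_eq:
  assumes f: "f \<in> Bij {0..1}" "f \<otimes>\<^bsub>interval_bij\<^esub> F_word v = F_word u"
    and \<delta>: "\<delta> < 1" "\<And>x. x \<in> {\<delta>..1} \<Longrightarrow> f x = x"
  shows "length u = length v"
proof -
  obtain \<eta> where \<eta>: "0 \<le> \<eta>" "\<eta> < 1"
    "\<And>t. t \<in> {\<eta>..1} \<Longrightarrow> F_word u t = 1 - 2 ^ length u * (1 - t)"
    using F_word_near_1[of u] by auto
  obtain \<theta> where \<theta>: "0 \<le> \<theta>" "\<theta> < 1"
    "\<And>t. t \<in> {\<theta>..1} \<Longrightarrow> F_word v t = 1 - 2 ^ length v * (1 - t)"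
    using F_word_near_1[of v] by auto
  \<comment> \<open>Close enough to \<open>1\<close> for \<open>F_word v t\<close> to be fixed by \<open>f\<close>.\<close>
  define t where "t = max (max \<eta> \<theta>) (1 - (1 - \<delta>) / 2 ^ length v)"
  have t: "t < 1" "t \<in> {\<eta>..1}" "t \<in> {\<theta>..1}" "t \<in> {0..1}"
    using \<eta> \<theta> \<delta>(1) by (auto simp: t_def)
  have "1 - t \<le> (1 - \<delta>) / 2 ^ length v" by (auto simp: t_def)
  then have "2 ^ length v * (1 - t) \<le> 1 - \<delta>" by (simp add: field_simps)
  then have "F_word v t \<in> {\<delta>..1}" using \<theta>(3)[OF t(3)] t(1) by simp
  then have "f (F_word v t) = F_word v t" by (rule \<delta>(2))
  moreover have "f (F_word v t) = F_word u t"
    using mult_interval_bij_apply[OF f(1) F_word_Bij t(4), of v] f(2) by simp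
  ultimately have "(2::real) ^ length u = 2 ^ length v"
    using \<eta>(3)[OF t(2)] \<theta>(3)[OF t(3)] t(1) by simp
  then show ?thesis by simp
qed



section \<open>The relations on consecutive integers\<close>

lemma (in group) commutator_eq_one_iff:
  assumes "a \<in> carrier G" "b \<in> carrier G"
  shows "a \<otimes> (b \<otimes> (inv a \<otimes> inv b)) = \<one> \<longleftrightarrow> a \<otimes> b = b \<otimes> a"
proof -
  have "a \<otimes> (b \<otimes> (inv a \<otimes> inv b)) = (a \<otimes> b) \<otimes> inv (b \<otimes> a)"
    using assms by (simp add: inv_mult_group m_assoc)
  then show ?thesis
    using assms by (simp add: inv_solve_right')
qed

lemma (in group) consec_rels_hold:
  assumes h: "h \<in> I \<rightarrow> carrier G"
    and triple: "\<And>i. i - 1 \<in> I \<Longrightarrow> i \<in> I \<Longrightarrow> i + 1 \<in> I \<Longrightarrow>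
      h (i - 1) \<otimes> (h i \<otimes> h (i + 1)) = h i \<otimes> (h (i + 1) \<otimes> (h (i - 1) \<otimes> h i))"
    and commute: "\<And>i j. i \<in> I \<Longrightarrow> j \<in> I \<Longrightarrow> i + 2 \<le> j \<Longrightarrow> h i \<otimes> h j = h j \<otimes> h i"
    and rel: "(u, v) \<in> consec_rels I"
  shows "word_val G h u = word_val G h v"
proof -
  have c: "h i \<in> carrier G" if "i \<in> I" for i using h that by auto
  have "h i \<otimes> h j = h j \<otimes> h i" if "i \<in> I" "j \<in> I" "2 \<le> \<bar>i - j\<bar>" for i j
    using that commute[of i j] commute[of j i] by (cases "i \<le> j") auto
  then show ?thesis
    using rel triple by (auto simp: consec_rels_def c commutator_eq_one_iff)
qed

text \<open>This turns relations of the presentation into equations between products in the group.\<close>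

lemma word_val_presented_group:
  assumes "w \<in> gen_words X"
  shows "word_val (presented_group X R) (\<lambda>x. word_class X R [(x, True)]) w = word_class X R w"
proof -
  interpret P: group "presented_group X R" by (rule group_presented_group)
  have inv: "inv\<^bsub>presented_group X R\<^esub> word_class X R [(x, True)] = word_class X R [(x, False)]"
    if "x \<in> X" for x
  proof (rule P.inv_equality)
    show "word_class X R [(x, False)] \<otimes>\<^bsub>presented_group X R\<^esub> word_class X R [(x, True)]
        = \<one>\<^bsub>presented_group X R\<^esub>"
      using that word_eq.cancel[of x X R False]
      by (simp add: presented_group_mult one_presented_group word_class_eq_iff)
  qed (use that in \<open>auto simp: carrier_presented_group\<close>)
  show ?thesis
    using assms
  proof (induction w)
    case (Cons p w)
    then show ?case
      by (cases p) (auto simp: inv presented_group_mult)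
  qed (simp add: one_presented_group)
qed

lemma presented_group_relation:
  assumes "(u, v) \<in> R" "u \<in> gen_words X" "v \<in> gen_words X"
  shows "word_val (presented_group X R) (\<lambda>x. word_class X R [(x, True)]) u
       = word_val (presented_group X R) (\<lambda>x. word_class X R [(x, True)]) v"
  using assms word_eq.relation[of u v R X] by (simp add: word_val_presented_group word_class_eq_iff)

text \<open>
  A relation holds in the presented group because both of its sides evaluate to their classes,
  which the relation identifies.
\<close>

lemma consec_group_consecutive_family:
  fixes n :: nat
  assumes n: "4 \<le> n"
  defines "G \<equiv> consec_group {0..int n}"
  shows "consecutive_family G
    (\<lambda>i. if i \<le> n then word_class {0..int n} (consec_rels {0..int n}) [(int i, True)] else \<one>\<^bsub>G\<^esub>) n"
proof -
  let ?I = "{0..int n}"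
  let ?c = "\<lambda>x. word_class ?I (consec_rels ?I) [(x, True)]"
  let ?g = "\<lambda>i. if i \<le> n then ?c (int i) else \<one>\<^bsub>G\<^esub>"
  interpret G: group G unfolding G_def consec_group_def by (rule group_presented_group)
  have c: "?c x \<in> carrier G" if "x \<in> ?I" for x
    using that by (auto simp: G_def consec_group_def carrier_presented_group)
  have rel: "word_val G ?c u = word_val G ?c v"
    if "(u, v) \<in> consec_rels ?I" "u \<in> gen_words ?I" "v \<in> gen_words ?I" for u v
    unfolding G_def consec_group_def using that by (rule presented_group_relation)
  show ?thesis
  proof unfold_locales
    show "4 \<le> n" by (rule n)
    show "?g i \<in> carrier G" for i using c by auto
    show "?g i \<otimes>\<^bsub>G\<^esub> (?g (Suc i) \<otimes>\<^bsub>G\<^esub> ?g (Suc (Suc i)))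
        = ?g (Suc i) \<otimes>\<^bsub>G\<^esub> (?g (Suc (Suc i)) \<otimes>\<^bsub>G\<^esub> (?g i \<otimes>\<^bsub>G\<^esub> ?g (Suc i)))"
      if i: "Suc (Suc i) \<le> n" for i
    proof -
      \<comment> \<open>The relation is centred at the middle one of its three indices.\<close>
      let ?j = "int (Suc i)"
      have "([(?j - 1, True), (?j, True), (?j + 1, True)],
          [(?j, True), (?j + 1, True), (?j - 1, True), (?j, True)]) \<in> consec_rels ?I"
        unfolding consec_rels_def using i by auto
      from rel[OF this] show ?thesis using i c by (simp add: add.commute)
    qed
    show "?g i \<otimes>\<^bsub>G\<^esub> ?g j = ?g j \<otimes>\<^bsub>G\<^esub> ?g i" if ij: "i + 2 \<le> j" "j \<le> n" for i j
    proof -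
      have "([(int i, True), (int j, True), (int i, False), (int j, False)], []) \<in> consec_rels ?I"
        unfolding consec_rels_def using ij by auto
      from rel[OF this] show ?thesis using ij c by (simp add: G.commutator_eq_one_iff)
    qed
  qed
qed

section \<open>The finite presentation of \<open>F\<close>\<close>

text \<open>
  The slides with indices below \<open>n\<close> have supports whose closures do not contain \<open>1\<close>. The last letter
  goes to a standard generator instead, as if the slide \<open>n\<close> had been completed by a trivial factor
  in place of the generator with index \<open>n + 1\<close>.
\<close>

definition F_images :: "nat \<Rightarrow> int \<Rightarrow> real \<Rightarrow> real" where
  "F_images n x = (if x < int n then F_gen.slide (nat x) else F_gen (nat x))"

lemma F_images_closed: "F_images n \<in> I \<rightarrow> carrier interval_bij"
  using F_gen.X_closed F_gen.slide_closed by (auto simp: F_images_def)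

text \<open>
  Only relations that involve the letter \<open>n\<close> are different from relations between slides; they hold
  because the telescoping products begin or end in the same way.
\<close>

lemma F_images_relations:
  assumes "(u, v) \<in> consec_rels {0..int n}"
  shows "word_val interval_bij (F_images n) u = word_val interval_bij (F_images n) v"
proof (rule interval_bij.consec_rels_hold[OF F_images_closed _ _ assms])
  fix i :: int assume i: "i - 1 \<in> {0..int n}" "i \<in> {0..int n}" "i + 1 \<in> {0..int n}"
  define k where "k = nat (i - 1)"
  have k: "nat i = Suc k" "nat (i + 1) = Suc (Suc k)" "nat (i - 1) = k" using i by (auto simp: k_def)
  have vals: "F_images n (i - 1) = F_gen.slide k" "F_images n i = F_gen.slide (Suc k)"
    "F_images n (i + 1) = (if i + 1 < int n then F_gen.slide (Suc (Suc k)) else F_gen (Suc (Suc k)))"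
    unfolding F_images_def k using i by auto
  show "F_images n (i - 1) \<otimes>\<^bsub>interval_bij\<^esub> (F_images n i \<otimes>\<^bsub>interval_bij\<^esub> F_images n (i + 1))
      = F_images n i \<otimes>\<^bsub>interval_bij\<^esub> (F_images n (i + 1) \<otimes>\<^bsub>interval_bij\<^esub>
          (F_images n (i - 1) \<otimes>\<^bsub>interval_bij\<^esub> F_images n i))"
    unfolding vals using F_gen.slide_triple[of k] F_gen.slide_triple_X[of k] F_gen.slide_slide_X[of k]
    by (cases "i + 1 < int n") simp_all
next
  fix i j :: int assume "i \<in> {0..int n}" "j \<in> {0..int n}" "i + 2 \<le> j"
  then show "F_images n i \<otimes>\<^bsub>interval_bij\<^esub> F_images n j = F_images n j \<otimes>\<^bsub>interval_bij\<^esub> F_images n i"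
    using F_gen.slide_commutes[of "nat i" "nat j"] F_gen.slide_commutes_X[of "nat i" "nat j"]
    by (auto simp: F_images_def)
qed

text \<open>
  The tails of the generators form a Thompson family in the presented group, and they are mapped to
  the standard generators. As all letters are quotients of members of this family, all elements are
  fractions, and a fraction with trivial image is trivial.
\<close>

lemma F_images_faithful:
  assumes n: "4 \<le> n" and w: "w \<in> gen_words {0..int n}"
    and one: "word_val interval_bij (F_images n) w = \<one>\<^bsub>interval_bij\<^esub>"
  shows "word_eq {0..int n} (consec_rels {0..int n}) w []"
proof -
  let ?I = "{0..int n}"
  let ?R = "consec_rels ?I"
  define G where "G = presented_group ?I ?R"
  define c where "c = (\<lambda>x. word_class ?I ?R [(x, True)])"
  define g where "g = (\<lambda>i. if i \<le> n then c (int i) else \<one>\<^bsub>G\<^esub>)"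
  interpret consecutive_family G g n
    using consec_group_consecutive_family[OF n] unfolding G_def g_def c_def consec_group_def .
  interpret T: thompson_family G thompson_gen by (rule thompson_family)
  define \<phi> where "\<phi> = presented_lift interval_bij (F_images n)"
  have lift: "\<phi> (word_class ?I ?R v) = word_val interval_bij (F_images n) v"
    if "v \<in> gen_words ?I" for v
    unfolding \<phi>_def using that F_images_relations
    by (intro interval_bij.presented_lift_word_class[OF F_images_closed])
  have hom: "\<phi> \<in> hom G interval_bij"
    unfolding \<phi>_def G_def using F_images_relations
    by (intro interval_bij.presented_lift_hom[OF F_images_closed])
  interpret h: group_hom G interval_bij \<phi> by unfold_locales (rule hom)
  have \<phi>_g: "\<phi> (g i) = F_images n (int i)" if "i \<le> n" for i
    using that lift[of "[(int i, True)]"] F_images_closed[of n "{int i}"]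
    by (auto simp: g_def c_def)
  have tail_img: "\<phi> (tail i) = F_gen i" if "i \<le> n" for i
    using that
  proof (induction "n - i" arbitrary: i)
    case 0
    then have "i = n" by simp
    then show ?case using \<phi>_g[of n] F_gen.X_closed[of n]
      by (simp add: tail_rec[of n] tail_beyond F_images_def)
  next
    case (Suc m)
    then have "\<phi> (tail (Suc i)) = F_gen (Suc i)" by simp
    moreover have "i < n" using Suc.hyps(2) by linarith
    ultimately show ?case using \<phi>_g[of i]
      by (simp add: tail_rec[of i] F_images_def F_gen.slide_mult_X)
  qed
  have img: "\<phi> (thompson_gen i) = F_gen i" for i
  proof (induction i rule: thompson_gen.induct)
    case (3 j)
    then show ?case
      by (simp add: tail_img F_gen.X_rel interval_bij.inv_cancel_left)
  qed (use n in \<open>simp_all add: tail_img\<close>)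
  have "word_val G c v \<in> T.fractions" if "v \<in> gen_words ?I" for v
    using that
  proof (induction v)
    case Nil
    show ?case by (simp add: T.one_fraction)
  next
    case (Cons p v)
    obtain x b where p: "p = (x, b)" by (cases p)
    then have x: "0 \<le> x" "x \<le> int n" and v: "v \<in> gen_words ?I" using Cons.prems by auto
    define i where "i = nat x"
    have i: "i \<le> n" and cg: "c x = g i" using x by (auto simp: i_def g_def)
    let ?a = "word_val G c v"
    have a: "?a \<in> T.fractions" using Cons.IH v .
    then have ac: "?a \<in> carrier G" using T.fractions_subset by auto
    have "(if b then g i else inv\<^bsub>G\<^esub> g i) \<otimes>\<^bsub>G\<^esub> ?a \<in> T.fractions"
    proof (cases "i = n")
      case True
      then show ?thesis
        using a by (simp add: g_eq_thompson_gen(2) T.X_mult_fraction T.inv_X_mult_fraction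
            del: thompson_gen.simps)
    next
      case False
      then have "g i = thompson_gen i \<otimes>\<^bsub>G\<^esub> inv\<^bsub>G\<^esub> thompson_gen (Suc i)"
        using i by (intro g_eq_thompson_gen(1)) auto
      then show ?thesis
        using a ac by (simp add: inv_mult_group m_assoc T.X_mult_fraction T.inv_X_mult_fraction
            del: thompson_gen.simps)
    qed
    then show ?case by (simp only: p cg word_val_Cons)
  qed
  then have "word_class ?I ?R w \<in> T.fractions"
    using w by (simp add: G_def c_def word_val_presented_group)
  then have "word_class ?I ?R w = \<one>\<^bsub>G\<^esub>"
    using T.hom_to_F_gen_inj[OF hom img] lift[OF w] one by simp
  then show ?thesis
    using w by (simp add: G_def one_presented_group word_class_eq_iff)
qed

lemma F_word_in_subgroup:
  assumes "subgroup H interval_bij" "\<And>i. i \<in> set w \<Longrightarrow> F_gen i \<in> H"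
  shows "F_word w \<in> H"
  using assms(2)
proof (induction w)
  case Nil
  then show ?case using subgroup.one_closed[OF assms(1)] by simp
next
  case (Cons i w)
  then show ?case using subgroup.m_closed[OF assms(1)] by simp
qed

text \<open>
  Telescoping recovers the standard generators up to \<open>n\<close> from the images of the letters, and
  conjugation by the first one yields all others.
\<close>

lemma F_images_generate:
  assumes n: "4 \<le> n"
  shows "generate interval_bij (F_images n ` {0..int n}) = thompson_F_carrier"
proof
  let ?H = "generate interval_bij (F_images n ` {0..int n})"
  have slide: "F_gen.slide i \<in> thompson_F_carrier" for i
    unfolding F_gen.slide_def using thompson_F_subgroup F_gen_in_thompson_F
    by (simp add: subgroup.m_closed subgroup.m_inv_closed)
  show "?H \<subseteq> thompson_F_carrier"
    using slide F_gen_in_thompson_F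
    by (intro interval_bij.generate_subgroup_incl thompson_F_subgroup) (auto simp: F_images_def)
  have H: "subgroup ?H interval_bij"
    using F_images_closed[of n "{0..int n}"] by (intro interval_bij.generate_is_subgroup) auto
  have low: "F_gen i \<in> ?H" if "i \<le> n" for i
    using that
  proof (induction "n - i" arbitrary: i)
    case 0
    then have "F_gen i = F_images n (int n)" by (simp add: F_images_def)
    then show ?case by (auto intro: generate.incl)
  next
    case (Suc m)
    then have "F_gen (Suc i) \<in> ?H" by simp
    moreover have "i < n" using Suc.hyps(2) by linarith
    then have "F_gen.slide i = F_images n (int i)" by (simp add: F_images_def)
    then have "F_gen.slide i \<in> ?H" using Suc by (auto intro!: generate.incl)
    ultimately have "F_gen.slide i \<otimes>\<^bsub>interval_bij\<^esub> F_gen (Suc i) \<in> ?H"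
      using H by (simp add: subgroup.m_closed)
    then show ?case by (simp only: F_gen.slide_mult_X)
  qed
  have gens: "F_gen i \<in> ?H" for i
  proof (induction i)
    case 0
    then show ?case using low by simp
  next
    case (Suc i)
    show ?case
    proof (cases "i = 0")
      case True
      then show ?thesis using low n by simp
    next
      case False
      then have "F_gen (Suc i) = inv\<^bsub>interval_bij\<^esub> F_gen 0 \<otimes>\<^bsub>interval_bij\<^esub>
          (F_gen i \<otimes>\<^bsub>interval_bij\<^esub> F_gen 0)"
        using F_gen.X_rel[of 0 i] by (simp add: interval_bij.inv_cancel_left)
      then show ?thesis using Suc low[of 0] H by (simp add: subgroup.m_closed subgroup.m_inv_closed)
    qed
  qed
  show "thompson_F_carrier \<subseteq> ?H"
  proof
    fix f assume f: "f \<in> thompson_F_carrier"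
    then obtain S where "dyadic_pl S f" by (rule thompson_F_imp_dyadic_pl)
    then have "f 0 = 0" using f thompson_F_carrier_Bij dyadic_pl_endpoints by blast
    then have "f x = x" if "x \<in> {0..vine_pt 0}" for x using that by simp
    then obtain u v where "f = F_word u \<otimes>\<^bsub>interval_bij\<^esub> inv\<^bsub>interval_bij\<^esub> F_word v"
      using F_eq_fraction[OF f] by blast
    then show "f \<in> ?H"
      using F_word_in_subgroup[OF H] gens H by (simp add: subgroup.m_closed subgroup.m_inv_closed)
  qed
qed

lemma consec_group_finite:
  assumes "4 \<le> n" shows "consec_group {0..int n} \<cong> thompson_F"
proof -
  have "consec_group {0..int n} \<cong>
      interval_bij\<lparr>carrier := generate interval_bij (F_images n ` {0..int n})\<rparr>"
    unfolding consec_group_def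
    using F_images_closed F_images_relations F_images_faithful[OF assms]
    by (rule interval_bij.presented_group_iso)
  then show ?thesis by (simp add: F_images_generate[OF assms] thompson_F_def)
qed

section \<open>The presentation of \<open>D\<close>\<close>

definition slide_image :: "int \<Rightarrow> real \<Rightarrow> real" where
  "slide_image x = F_gen.slide (nat x)"

lemma slide_image_closed: "slide_image \<in> I \<rightarrow> carrier interval_bij"
  using F_gen.slide_closed by (auto simp: slide_image_def)

lemma slide_image_relations:
  assumes "(u, v) \<in> consec_rels {0..}"
  shows "word_val interval_bij slide_image u = word_val interval_bij slide_image v"
proof (rule interval_bij.consec_rels_hold[OF slide_image_closed _ _ assms])
  fix i :: int assume i: "i - 1 \<in> {0..}" "i \<in> {0..}" "i + 1 \<in> {0..}"
  define k where "k = nat (i - 1)"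
  have k: "nat i = Suc k" "nat (i + 1) = Suc (Suc k)" "nat (i - 1) = k" using i by (auto simp: k_def)
  show "slide_image (i - 1) \<otimes>\<^bsub>interval_bij\<^esub> (slide_image i \<otimes>\<^bsub>interval_bij\<^esub> slide_image (i + 1))
      = slide_image i \<otimes>\<^bsub>interval_bij\<^esub> (slide_image (i + 1) \<otimes>\<^bsub>interval_bij\<^esub>
          (slide_image (i - 1) \<otimes>\<^bsub>interval_bij\<^esub> slide_image i))"
    using F_gen.slide_triple[of k] by (simp add: slide_image_def k)
next
  fix i j :: int assume "i \<in> {0..}" "j \<in> {0..}" "i + 2 \<le> j"
  then show "slide_image i \<otimes>\<^bsub>interval_bij\<^esub> slide_image j = slide_image j \<otimes>\<^bsub>interval_bij\<^esub> slide_image i"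
    using F_gen.slide_commutes[of "nat i" "nat j"] by (simp add: slide_image_def)
qed

lemma letters_bounded:
  obtains k :: int where "\<And>x. x \<in> fst ` set (w :: int gen_word) \<Longrightarrow> \<bar>x\<bar> < k"
proof -
  have "\<bar>x\<bar> < Max (insert 0 (abs ` fst ` set w)) + 1" if "x \<in> fst ` set w" for x
  proof -
    have "\<bar>x\<bar> \<le> Max (insert 0 (abs ` fst ` set w))" using that by (intro Max_ge) auto
    then show ?thesis by simp
  qed
  then show thesis by (rule that)
qed

text \<open>
  A word involves finitely many letters only. For large \<open>n\<close> its value does not change if it is read
  in the finite presentation, where it is already trivial.
\<close>

lemma slide_image_faithful:
  assumes w: "w \<in> gen_words {0..}"
    and one: "word_val interval_bij slide_image w = \<one>\<^bsub>interval_bij\<^esub>"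
  shows "word_eq {0..} (consec_rels {0..}) w []"
proof -
  obtain k where k: "\<And>x. x \<in> fst ` set w \<Longrightarrow> \<bar>x\<bar> < k" by (rule letters_bounded[of w]) blast
  define n where "n = max 4 (nat k)"
  have w': "w \<in> gen_words {0..<int n}"
    using w k by (fastforce simp: gen_words_iff n_def)
  have "word_val interval_bij (F_images n) w = word_val interval_bij slide_image w"
    by (rule interval_bij.word_val_cong[OF _ w']) (simp add: F_images_def slide_image_def)
  moreover have "w \<in> gen_words {0..int n}" using w' by (auto simp: gen_words_iff)
  ultimately have "word_eq {0..int n} (consec_rels {0..int n}) w []"
    using one by (intro F_images_faithful) (auto simp: n_def)
  then have "word_eq {0..} (consec_rels {0..}) (rename id w) (rename id [])"
    by (rule word_eq_rename) (auto simp: consec_rels_def rename_def)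
  then show ?thesis by (simp add: rename_id)
qed

definition fixes_near_1 :: "(real \<Rightarrow> real) \<Rightarrow> bool" where
  "fixes_near_1 f \<longleftrightarrow> (\<exists>\<delta>\<in>{0<..<1}. \<forall>x\<in>{\<delta>..1}. f x = x)"

definition fixes_near_0 :: "(real \<Rightarrow> real) \<Rightarrow> bool" where
  "fixes_near_0 f \<longleftrightarrow> (\<exists>\<epsilon>\<in>{0<..<1}. \<forall>x\<in>{0..\<epsilon>}. f x = x)"

lemma fixes_mult:
  assumes f: "f \<in> Bij {0..1}" and g: "g \<in> Bij {0..1}"
  shows "fixes_near_1 f \<Longrightarrow> fixes_near_1 g \<Longrightarrow> fixes_near_1 (f \<otimes>\<^bsub>interval_bij\<^esub> g)"
    "fixes_near_0 f \<Longrightarrow> fixes_near_0 g \<Longrightarrow> fixes_near_0 (f \<otimes>\<^bsub>interval_bij\<^esub> g)"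
proof -
  assume "fixes_near_1 f" "fixes_near_1 g"
  then obtain \<delta> \<delta>' where "\<delta> \<in> {0<..<1}" "\<delta>' \<in> {0<..<1}" "\<forall>x\<in>{\<delta>..1}. f x = x" "\<forall>x\<in>{\<delta>'..1}. g x = x"
    unfolding fixes_near_1_def by blast
  then show "fixes_near_1 (f \<otimes>\<^bsub>interval_bij\<^esub> g)"
    unfolding fixes_near_1_def
    by (intro bexI[of _ "max \<delta> \<delta>'"]) (auto simp: mult_interval_bij_apply[OF f g])
next
  assume "fixes_near_0 f" "fixes_near_0 g"
  then obtain \<delta> \<delta>' where "\<delta> \<in> {0<..<1}" "\<delta>' \<in> {0<..<1}" "\<forall>x\<in>{0..\<delta>}. f x = x" "\<forall>x\<in>{0..\<delta>'}. g x = x"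
    unfolding fixes_near_0_def by blast
  then show "fixes_near_0 (f \<otimes>\<^bsub>interval_bij\<^esub> g)"
    unfolding fixes_near_0_def
    by (intro bexI[of _ "min \<delta> \<delta>'"]) (auto simp: mult_interval_bij_apply[OF f g])
qed

lemma fixes_inv:
  assumes f: "f \<in> Bij {0..1}"
  shows "fixes_near_1 f \<Longrightarrow> fixes_near_1 (inv\<^bsub>interval_bij\<^esub> f)"
    "fixes_near_0 f \<Longrightarrow> fixes_near_0 (inv\<^bsub>interval_bij\<^esub> f)"
proof -
  have *: "(inv\<^bsub>interval_bij\<^esub> f) x = x" if "x \<in> {0..1}" "f x = x" for x
    using inv_interval_bij_apply(2)[OF f that(1)] that(2) by simp
  show "fixes_near_1 f \<Longrightarrow> fixes_near_1 (inv\<^bsub>interval_bij\<^esub> f)"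
    unfolding fixes_near_1_def by (elim bexE, rule bexI) (auto intro!: *)
  show "fixes_near_0 f \<Longrightarrow> fixes_near_0 (inv\<^bsub>interval_bij\<^esub> f)"
    unfolding fixes_near_0_def by (elim bexE, rule bexI) (auto intro!: *)
qed

lemma fixes_one: "fixes_near_1 \<one>\<^bsub>interval_bij\<^esub>" "fixes_near_0 \<one>\<^bsub>interval_bij\<^esub>"
  unfolding fixes_near_1_def fixes_near_0_def
  by (auto simp: one_interval_bij_apply intro!: exI[of _ "1/2"])

definition D_carrier :: "(real \<Rightarrow> real) set" where
  "D_carrier = {f \<in> thompson_F_carrier. fixes_near_1 f}"

definition F'_carrier :: "(real \<Rightarrow> real) set" where
  "F'_carrier = {f \<in> thompson_F_carrier. fixes_near_0 f \<and> fixes_near_1 f}"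

lemma thompson_D_eq: "thompson_D = interval_bij\<lparr>carrier := D_carrier\<rparr>"
  by (simp add: thompson_D_def thompson_F_def D_carrier_def fixes_near_1_def)

lemma thompson_F'_eq: "thompson_F' = interval_bij\<lparr>carrier := F'_carrier\<rparr>"
proof -
  have "{f \<in> thompson_F_carrier. \<exists>\<delta>\<in>{0<..<1}. \<exists>\<epsilon>\<in>{0<..<1}.
        (\<forall>x\<in>{0..\<epsilon>}. f x = x) \<and> (\<forall>x\<in>{\<delta>..1}. f x = x)} = F'_carrier"
    unfolding F'_carrier_def fixes_near_0_def fixes_near_1_def by blast
  then show ?thesis by (simp add: thompson_F'_def thompson_F_def)
qed

lemma D_subgroup: "subgroup D_carrier interval_bij"
proof -
  interpret F: subgroup thompson_F_carrier interval_bij by (rule thompson_F_subgroup)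
  show ?thesis
    by (standard, unfold D_carrier_def)
      (auto simp: fixes_mult fixes_inv fixes_one thompson_F_carrier_Bij carrier_interval_bij)
qed

lemma F'_subgroup: "subgroup F'_carrier interval_bij"
proof -
  interpret F: subgroup thompson_F_carrier interval_bij by (rule thompson_F_subgroup)
  show ?thesis
    by (standard, unfold F'_carrier_def)
      (auto simp: fixes_mult fixes_inv fixes_one thompson_F_carrier_Bij carrier_interval_bij)
qed

text \<open>Near \<open>1\<close> all standard generators are the same dilation, so it cancels in a slide.\<close>

lemma slide_in_D: "F_gen.slide i \<in> D_carrier"
proof -
  have F: "F_gen.slide i \<in> thompson_F_carrier"
    unfolding F_gen.slide_def using thompson_F_subgroup F_gen_in_thompson_F
    by (simp add: subgroup.m_closed subgroup.m_inv_closed)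
  have "F_gen.slide i x = x" if x: "x \<in> {vine_pt (Suc (Suc i))..1}" for x
  proof -
    \<comment> \<open>The common preimage of \<open>x\<close> under the generators with indices \<open>i\<close> and \<open>i + 1\<close>.\<close>
    define y where "y = (x + 1) / 2"
    have y: "vine_pt (Suc (Suc (Suc i))) \<le> y" "y \<le> 1"
      using x unfolding y_def vine_pt_Suc[of "Suc (Suc i)"] by auto
    then have y01: "y \<in> {0..1}"
      using vine_pt_bounds(1)[of "Suc (Suc (Suc i))"] unfolding atLeastAtMost_iff by linarith
    have x01: "x \<in> {0..1}"
      using x vine_pt_bounds(1)[of "Suc (Suc i)"] unfolding atLeastAtMost_iff by linarith
    have dil: "F_gen k y = x" if "k \<le> Suc i" for k
    proof -
      have "vine_pt (Suc (Suc k)) \<le> vine_pt (Suc (Suc (Suc i)))" using that by simp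
      then have "(3 + vine_pt k) / 4 \<le> y" using y(1) by (simp add: vine_pt_Suc field_simps)
      then have "F_gen k y = 2 * y - 1"
        unfolding F_gen_apply[OF y01] using y(2) by (intro contraction_cases(4)) auto
      then show ?thesis by (simp add: y_def field_simps)
    qed
    have "(inv\<^bsub>interval_bij\<^esub> F_gen (Suc i)) x = y"
      using inv_interval_bij_apply(2)[OF F_gen_Bij y01, of "Suc i"] dil[of "Suc i"] by simp
    then have "F_gen.slide i x = F_gen i y"
      unfolding F_gen.slide_def
      using mult_interval_bij_apply[OF F_gen_Bij _ x01, of "inv\<^bsub>interval_bij\<^esub> F_gen (Suc i)" i]
        interval_bij.inv_closed[of "F_gen (Suc i)"]
      by (simp add: carrier_interval_bij F_gen_Bij)
    then show ?thesis using dil[of i] by simp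
  qed
  moreover have "vine_pt (Suc (Suc i)) \<in> {0<..<1}"
    using vine_pt_less_iff[of 0 "Suc (Suc i)"] by simp
  ultimately have "fixes_near_1 (F_gen.slide i)"
    unfolding fixes_near_1_def by blast
  then show ?thesis using F by (simp add: D_carrier_def)
qed

text \<open>
  Writing \<open>f\<close> as a fraction, one gets a numerator and a denominator of the same length because \<open>f\<close>
  has slope \<open>1\<close> at \<open>1\<close>.
\<close>

lemma fixing_in_generate_slides:
  assumes f: "f \<in> D_carrier" and id: "\<And>x. x \<in> {0..vine_pt j} \<Longrightarrow> f x = x"
  shows "f \<in> generate interval_bij (F_gen.slide ` {j..})"
proof -
  have fF: "f \<in> thompson_F_carrier" and "fixes_near_1 f" using f by (auto simp: D_carrier_def)
  then obtain \<delta> where \<delta>: "\<delta> < 1" "\<And>x. x \<in> {\<delta>..1} \<Longrightarrow> f x = x"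
    by (auto simp: fixes_near_1_def)
  have fB: "f \<in> Bij {0..1}" using fF by (rule thompson_F_carrier_Bij)
  obtain u v where uv: "\<forall>i\<in>set u. j \<le> i" "\<forall>i\<in>set v. j \<le> i"
    "f = F_word u \<otimes>\<^bsub>interval_bij\<^esub> inv\<^bsub>interval_bij\<^esub> F_word v"
    using F_eq_fraction[OF fF id] by blast
  have "f \<otimes>\<^bsub>interval_bij\<^esub> F_word v = F_word u"
    by (simp add: uv(3) interval_bij.m_assoc)
  then have "length u = length v" using fB \<delta> by (intro fraction_length_eq)
  then show ?thesis unfolding uv(3) using uv by (intro F_gen.balanced_fraction_in_generate)
qed

lemma slide_image_generate: "generate interval_bij (slide_image ` {0..}) = D_carrier"
proof -
  have eq: "slide_image ` {0..} = F_gen.slide ` {0..}"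
  proof
    show "slide_image ` {0..} \<subseteq> F_gen.slide ` {0..}" by (auto simp: slide_image_def)
    show "F_gen.slide ` {0..} \<subseteq> slide_image ` {0..}"
      by (auto simp: slide_image_def intro!: image_eqI[of _ _ "int _"])
  qed
  show ?thesis
  proof
    show "generate interval_bij (slide_image ` {0..}) \<subseteq> D_carrier"
      using slide_in_D by (intro interval_bij.generate_subgroup_incl D_subgroup) (auto simp: eq)
    show "D_carrier \<subseteq> generate interval_bij (slide_image ` {0..})"
    proof
      fix f assume f: "f \<in> D_carrier"
      then have fF: "f \<in> thompson_F_carrier" by (simp add: D_carrier_def)
      then obtain S where "dyadic_pl S f" by (rule thompson_F_imp_dyadic_pl)
      then have "f 0 = 0" using fF thompson_F_carrier_Bij dyadic_pl_endpoints by blast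
      then have "f \<in> generate interval_bij (F_gen.slide ` {0..})"
        using f by (intro fixing_in_generate_slides) auto
      then show "f \<in> generate interval_bij (slide_image ` {0..})" by (simp only: eq)
    qed
  qed
qed

lemma consec_group_nonneg: "consec_group {0..} \<cong> thompson_D"
proof -
  have "consec_group {0..} \<cong>
      interval_bij\<lparr>carrier := generate interval_bij (slide_image ` {0..})\<rparr>"
    unfolding consec_group_def
    using slide_image_closed slide_image_relations slide_image_faithful
    by (rule interval_bij.presented_group_iso)
  then show ?thesis by (simp add: slide_image_generate thompson_D_eq)
qed

section \<open>The presentation of \<open>F'\<close>\<close>

text \<open>
  Conjugation by the generator with index \<open>0\<close> shifts the slides with positive index. It therefore
  extends this part of the sequence of slides to a family indexed by all integers, on which
  conjugation by powers of the generator acts by shifts. Hence every statement about finitely many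
  letters can be reduced to positive indices.
\<close>

definition twist :: "int \<Rightarrow> (real \<Rightarrow> real) \<Rightarrow> real \<Rightarrow> real" where
  "twist k f = inv\<^bsub>interval_bij\<^esub> (F_gen 0 [^]\<^bsub>interval_bij\<^esub> k) \<otimes>\<^bsub>interval_bij\<^esub>
     (f \<otimes>\<^bsub>interval_bij\<^esub> F_gen 0 [^]\<^bsub>interval_bij\<^esub> k)"

lemma twist_closed [simp]: "f \<in> carrier interval_bij \<Longrightarrow> twist k f \<in> carrier interval_bij"
  by (simp add: twist_def interval_bij.int_pow_closed)

lemma twist_mult:
  assumes "f \<in> carrier interval_bij" "g \<in> carrier interval_bij"
  shows "twist k (f \<otimes>\<^bsub>interval_bij\<^esub> g) = twist k f \<otimes>\<^bsub>interval_bij\<^esub> twist k g"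
  using assms by (simp add: twist_def interval_bij.m_assoc interval_bij.inv_cancel_left)

lemma twist_one [simp]: "twist k \<one>\<^bsub>interval_bij\<^esub> = \<one>\<^bsub>interval_bij\<^esub>"
  by (simp add: twist_def)

lemma twist_inv:
  assumes "f \<in> carrier interval_bij"
  shows "twist k (inv\<^bsub>interval_bij\<^esub> f) = inv\<^bsub>interval_bij\<^esub> twist k f"
  using assms by (simp add: twist_def interval_bij.inv_mult_group interval_bij.m_assoc)

lemma twist_twist:
  assumes "f \<in> carrier interval_bij" shows "twist k (twist l f) = twist (l + k) f"
  using assms
  by (simp add: twist_def interval_bij.int_pow_mult interval_bij.inv_mult_group interval_bij.m_assoc)

lemma twist_0 [simp]: "f \<in> carrier interval_bij \<Longrightarrow> twist 0 f = f"
  by (simp add: twist_def)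

lemma twist_1_slide: "0 < i \<Longrightarrow> twist 1 (F_gen.slide i) = F_gen.slide (Suc i)"
  using F_gen.slide_conj_X0[of i] by (simp add: twist_def interval_bij.m_assoc)

definition twisted_slide :: "int \<Rightarrow> real \<Rightarrow> real" where
  "twisted_slide x = twist (x - 1) (F_gen.slide 1)"

lemma twisted_slide_closed: "twisted_slide \<in> I \<rightarrow> carrier interval_bij"
  by (simp add: twisted_slide_def)

lemma twist_twisted_slide: "twist k (twisted_slide x) = twisted_slide (x + k)"
  by (simp add: twisted_slide_def twist_twist algebra_simps)

lemma twisted_slide_pos: "1 \<le> x \<Longrightarrow> twisted_slide x = slide_image x"
proof (induction x rule: int_ge_induct)
  case base
  show ?case by (simp add: twisted_slide_def slide_image_def)
next
  case (step x)
  have "twisted_slide (x + 1) = twist 1 (twisted_slide x)" by (simp add: twist_twisted_slide)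
  also have "\<dots> = F_gen.slide (Suc (nat x))"
    using step by (simp add: slide_image_def twist_1_slide)
  finally show ?case using step.hyps by (simp add: slide_image_def nat_add_distrib)
qed

lemma twisted_slide_relations:
  assumes "(u, v) \<in> consec_rels UNIV"
  shows "word_val interval_bij twisted_slide u = word_val interval_bij twisted_slide v"
proof (rule interval_bij.consec_rels_hold[OF twisted_slide_closed _ _ assms])
  fix i :: int
  let ?s = "twisted_slide"
  have eq: "?s (i - 1) = twist (i - 2) (F_gen.slide 1)"
    "?s i = twist (i - 2) (F_gen.slide (Suc 1))"
    "?s (i + 1) = twist (i - 2) (F_gen.slide (Suc (Suc 1)))"
    using twisted_slide_pos[of 1] twisted_slide_pos[of 2] twisted_slide_pos[of 3]
      twist_twisted_slide[of "i - 2" 1] twist_twisted_slide[of "i - 2" 2] twist_twisted_slide[of "i - 2" 3]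
    by (simp_all add: slide_image_def eval_nat_numeral add.commute)
  show "?s (i - 1) \<otimes>\<^bsub>interval_bij\<^esub> (?s i \<otimes>\<^bsub>interval_bij\<^esub> ?s (i + 1))
      = ?s i \<otimes>\<^bsub>interval_bij\<^esub> (?s (i + 1) \<otimes>\<^bsub>interval_bij\<^esub> (?s (i - 1) \<otimes>\<^bsub>interval_bij\<^esub> ?s i))"
    unfolding eq using F_gen.slide_triple[of 1] by (simp flip: twist_mult)
next
  fix i j :: int assume ij: "i + 2 \<le> j"
  let ?s = "twisted_slide"
  have "?s (1 + (j - i)) = F_gen.slide (nat (1 + (j - i)))"
    using ij by (simp add: twisted_slide_pos slide_image_def)
  moreover have "?s 1 = F_gen.slide 1" by (simp add: twisted_slide_pos slide_image_def)
  ultimately have "?s 1 \<otimes>\<^bsub>interval_bij\<^esub> ?s (1 + (j - i)) = ?s (1 + (j - i)) \<otimes>\<^bsub>interval_bij\<^esub> ?s 1"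
    using F_gen.slide_commutes[of 1 "nat (1 + (j - i))"] ij by simp
  then have "twist (i - 1) (?s 1 \<otimes>\<^bsub>interval_bij\<^esub> ?s (1 + (j - i)))
      = twist (i - 1) (?s (1 + (j - i)) \<otimes>\<^bsub>interval_bij\<^esub> ?s 1)" by simp
  then show "?s i \<otimes>\<^bsub>interval_bij\<^esub> ?s j = ?s j \<otimes>\<^bsub>interval_bij\<^esub> ?s i"
    using twisted_slide_closed[of UNIV] by (simp add: Pi_iff twist_mult twist_twisted_slide)
qed

lemma word_val_twisted_slide:
  "word_val interval_bij twisted_slide (rename (\<lambda>x. x + k) w) =
     twist k (word_val interval_bij twisted_slide w)"
proof (induction w)
  case (Cons p w)
  obtain x b where p: "p = (x, b)" by (cases p)
  have "twisted_slide x \<in> carrier interval_bij"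
    "word_val interval_bij twisted_slide w \<in> carrier interval_bij"
    using twisted_slide_closed[of UNIV] interval_bij.word_val_closed[of _ UNIV]
    by (auto simp: gen_words_iff)
  then show ?case using Cons by (simp add: p twist_mult twist_inv twist_twisted_slide)
qed simp

lemma consec_rels_shift:
  assumes "(u, v) \<in> consec_rels I"
  shows "(rename (\<lambda>x. x - k) u, rename (\<lambda>x. x - k) v) \<in> consec_rels UNIV"
proof -
  consider i where "u = [(i - 1, True), (i, True), (i + 1, True)]"
      "v = [(i, True), (i + 1, True), (i - 1, True), (i, True)]"
    | i j where "u = [(i, True), (j, True), (i, False), (j, False)]" "v = []" "2 \<le> \<bar>i - j\<bar>"
    using assms unfolding consec_rels_def by blast
  then show ?thesis
  proof cases
    case (1 i)
    then show ?thesis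
      unfolding consec_rels_def by (intro UnI1 CollectI exI[of _ "i - k"]) (simp add: algebra_simps)
  next
    case (2 i j)
    then show ?thesis
      unfolding consec_rels_def by (intro UnI2 CollectI exI[of _ "i - k"] exI[of _ "j - k"]) simp
  qed
qed

lemma twisted_slide_faithful:
  assumes one: "word_val interval_bij twisted_slide w = \<one>\<^bsub>interval_bij\<^esub>"
  shows "word_eq UNIV (consec_rels UNIV) w []"
proof -
  obtain k where k: "\<And>x. x \<in> fst ` set w \<Longrightarrow> \<bar>x\<bar> < k" by (rule letters_bounded[of w]) blast
  let ?v = "rename (\<lambda>x. x + k) w"
  have v: "?v \<in> gen_words {1..}"
    using k by (fastforce simp: gen_words_iff rename_def)
  have "word_val interval_bij slide_image ?v = word_val interval_bij twisted_slide ?v"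
    by (rule interval_bij.word_val_cong[OF _ v]) (simp add: twisted_slide_pos)
  also have "\<dots> = \<one>\<^bsub>interval_bij\<^esub>" by (simp add: word_val_twisted_slide one)
  finally have "word_eq {0..} (consec_rels {0..}) ?v []"
    using v by (intro slide_image_faithful) (auto simp: gen_words_iff)
  then have "word_eq UNIV (consec_rels UNIV) (rename (\<lambda>x. x - k) ?v) (rename (\<lambda>x. x - k) [])"
    by (rule word_eq_rename) (auto intro: consec_rels_shift)
  moreover have "rename (\<lambda>x. x - k) ?v = w"
    by (simp add: rename_def apfst_def map_prod_def o_def case_prod_unfold)
  ultimately show ?thesis by simp
qed

text \<open>
  The power of the generator by which \<open>f\<close> is conjugated fixes \<open>0\<close> and \<open>1\<close> and is increasing, so it
  maps neighbourhoods of the end points to neighbourhoods of the end points.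
\<close>

lemma twist_in_F':
  assumes f: "f \<in> F'_carrier" shows "twist k f \<in> F'_carrier"
proof -
  let ?a = "F_gen 0 [^]\<^bsub>interval_bij\<^esub> k"
  interpret F: subgroup thompson_F_carrier interval_bij by (rule thompson_F_subgroup)
  have fF: "f \<in> thompson_F_carrier" and fix0: "fixes_near_0 f" and fix1: "fixes_near_1 f"
    using f by (auto simp: F'_carrier_def)
  have a: "?a \<in> thompson_F_carrier"
    using F_gen_in_thompson_F interval_bij.subgroup_int_pow_closed thompson_F_subgroup by blast
  have aB: "?a \<in> Bij {0..1}" and fB: "f \<in> Bij {0..1}"
    using a fF by (auto intro: thompson_F_carrier_Bij)
  obtain S where S: "dyadic_pl S ?a" using a by (rule thompson_F_imp_dyadic_pl)
  let ?b = "inv\<^bsub>interval_bij\<^esub> ?a"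
  note ab = inv_interval_bij_apply[OF aB]
  note a01 = dyadic_pl_endpoints[OF S aB]
  have bB: "?b \<in> Bij {0..1}"
    using aB interval_bij.inv_closed[of ?a] by (simp add: carrier_interval_bij)
  have faB: "f \<otimes>\<^bsub>interval_bij\<^esub> ?a \<in> Bij {0..1}"
    using aB fB interval_bij.m_closed[of f ?a] by (simp add: carrier_interval_bij)
  have pt: "twist k f x = x" if "x \<in> {0..1}" "f (?a x) = ?a x" for x
    unfolding twist_def using that ab(2)[of x]
    by (simp add: mult_interval_bij_apply bB faB fB aB del: atLeastAtMost_iff)
  have b_mem: "?b y \<in> {0<..<1}" if "y \<in> {0<..<1}" for y
  proof -
    have "y \<in> {0..1}" using that by auto
    then have "?b y \<in> {0..1}" "?a (?b y) = y" using ab by auto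
    then show ?thesis using that a01 by (auto simp: less_le)
  qed
  obtain \<epsilon> where \<epsilon>: "\<epsilon> \<in> {0<..<1}" "\<forall>x\<in>{0..\<epsilon>}. f x = x"
    using fix0 by (auto simp: fixes_near_0_def)
  have "fixes_near_0 (twist k f)"
    unfolding fixes_near_0_def
  proof (intro bexI[of _ "?b \<epsilon>"] ballI)
    fix x assume x: "x \<in> {0..?b \<epsilon>}"
    have be: "?b \<epsilon> \<in> {0<..<1}" "?a (?b \<epsilon>) = \<epsilon>" using b_mem \<epsilon> ab(1)[of \<epsilon>] by auto
    then have x01: "x \<in> {0..1}" using x by auto
    have "?a x \<le> \<epsilon>" using dyadic_pl_mono[OF S, of x "?b \<epsilon>"] x be by auto
    moreover have "0 \<le> ?a x" using Bij_apply_mem[OF aB x01] by simp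
    ultimately show "twist k f x = x" using \<epsilon>(2) by (intro pt x01) auto
  qed (use b_mem \<epsilon> in auto)
  moreover
  obtain \<delta> where \<delta>: "\<delta> \<in> {0<..<1}" "\<forall>x\<in>{\<delta>..1}. f x = x"
    using fix1 by (auto simp: fixes_near_1_def)
  have "fixes_near_1 (twist k f)"
    unfolding fixes_near_1_def
  proof (intro bexI[of _ "?b \<delta>"] ballI)
    fix x assume x: "x \<in> {?b \<delta>..1}"
    have be: "?b \<delta> \<in> {0<..<1}" "?a (?b \<delta>) = \<delta>" using b_mem \<delta> ab(1)[of \<delta>] by auto
    then have x01: "x \<in> {0..1}" using x by auto
    have "\<delta> \<le> ?a x" using dyadic_pl_mono[OF S, of "?b \<delta>" x] x be by auto
    moreover have "?a x \<le> 1" using Bij_apply_mem[OF aB x01] by simp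
    ultimately show "twist k f x = x" using \<delta>(2) by (intro pt x01) auto
  qed (use b_mem \<delta> in auto)
  moreover have "twist k f \<in> thompson_F_carrier"
    unfolding twist_def using a fF by (intro F.m_closed F.m_inv_closed)
  ultimately show ?thesis by (simp add: F'_carrier_def)
qed

lemma F_gen_0_pow_apply:
  "t \<in> {0..1/2} \<Longrightarrow> (F_gen 0 [^]\<^bsub>interval_bij\<^esub> (m::nat)) t = t / 2 ^ m"
proof (induction m arbitrary: t)
  case 0
  then show ?case by (simp add: one_interval_bij_apply)
next
  case (Suc m)
  have B: "F_gen 0 [^]\<^bsub>interval_bij\<^esub> m \<in> Bij {0..1}"
    using interval_bij.nat_pow_closed[of "F_gen 0" m] by (simp add: carrier_interval_bij F_gen_Bij)
  have t: "t \<in> {0..1}" using Suc.prems by auto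
  have half: "F_gen 0 t = t / 2"
    using contraction_cases(2)[of 0 t] Suc.prems by (simp add: F_gen_apply)
  have "(F_gen 0 [^]\<^bsub>interval_bij\<^esub> Suc m) t = (F_gen 0 [^]\<^bsub>interval_bij\<^esub> m) (F_gen 0 t)"
    using mult_interval_bij_apply[OF B F_gen_Bij t, of 0] by simp
  also have "\<dots> = (F_gen 0 [^]\<^bsub>interval_bij\<^esub> m) (t / 2)" by (simp only: half)
  finally have "(F_gen 0 [^]\<^bsub>interval_bij\<^esub> Suc m) t = (F_gen 0 [^]\<^bsub>interval_bij\<^esub> m) (t / 2)" .
  then show ?case using Suc.IH[of "t / 2"] Suc.prems by simp
qed

text \<open>
  A map in \<open>F'\<close> is conjugated by a power of the generator with index \<open>0\<close> that is large enough for
  the support to move to the right of \<open>1 / 2\<close>. The conjugate is a product of slides with positive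
  indices, and undoing the conjugation shifts these indices.
\<close>

lemma twisted_slide_generate: "generate interval_bij (range twisted_slide) = F'_carrier"
proof
  let ?H = "generate interval_bij (range twisted_slide)"
  have "fixes_near_0 (F_gen.slide 1)"
    unfolding fixes_near_0_def
  proof (intro bexI[of _ "1/2"] ballI)
    fix x :: real assume x: "x \<in> {0..1/2}"
    then have x01: "x \<in> {0..1}" by auto
    have id: "F_gen k x = x" if "1 \<le> k" for k
    proof -
      have "vine_pt 1 \<le> vine_pt k" using that by simp
      moreover have "vine_pt 1 = 1 / 2" by (simp add: vine_pt_def)
      ultimately have "x \<le> vine_pt k" using x unfolding atLeastAtMost_iff by linarith
      then show ?thesis by (simp add: F_gen_apply[OF x01] contraction_cases(1))
    qed
    have "(inv\<^bsub>interval_bij\<^esub> F_gen 2) x = x"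
      using inv_interval_bij_apply(2)[OF F_gen_Bij x01, of 2] id[of 2] by simp
    then show "F_gen.slide 1 x = x"
      unfolding F_gen.slide_def
      using mult_interval_bij_apply[OF F_gen_Bij _ x01, of "inv\<^bsub>interval_bij\<^esub> F_gen 2" 1]
        interval_bij.inv_closed[of "F_gen 2"] id[of 1]
      by (simp add: carrier_interval_bij F_gen_Bij eval_nat_numeral)
  qed auto
  then have "F_gen.slide 1 \<in> F'_carrier"
    using slide_in_D[of 1] by (simp add: F'_carrier_def D_carrier_def)
  then show "?H \<subseteq> F'_carrier"
    using twist_in_F' by (intro interval_bij.generate_subgroup_incl F'_subgroup)
      (auto simp: twisted_slide_def)
  have H_eq: "?H = word_val interval_bij twisted_slide ` gen_words UNIV"
    using interval_bij.word_val_image[OF twisted_slide_closed, of UNIV] by simp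
  have twist_H: "twist k f \<in> ?H" if "f \<in> ?H" for f k
  proof -
    obtain w where "f = word_val interval_bij twisted_slide w" using \<open>f \<in> ?H\<close> H_eq by auto
    then have "twist k f = word_val interval_bij twisted_slide (rename (\<lambda>x. x + k) w)"
      by (simp add: word_val_twisted_slide)
    then show ?thesis unfolding H_eq by (auto simp: gen_words_iff)
  qed
  show "F'_carrier \<subseteq> ?H"
  proof
    fix f assume f: "f \<in> F'_carrier"
    then obtain \<epsilon> where \<epsilon>: "0 < \<epsilon>" "\<forall>x\<in>{0..\<epsilon>}. f x = x"
      by (auto simp: F'_carrier_def fixes_near_0_def)
    obtain m where m: "(1/2::real) ^ m < \<epsilon>"
      using real_arch_pow_inv[of \<epsilon> "1/2"] \<epsilon> by auto
    let ?g = "twist (int m) f" and ?a = "F_gen 0 [^]\<^bsub>interval_bij\<^esub> m"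
    have g: "?g \<in> F'_carrier" using f by (rule twist_in_F')
    have fB: "f \<in> Bij {0..1}" using f by (auto simp: F'_carrier_def intro: thompson_F_carrier_Bij)
    have aB: "?a \<in> Bij {0..1}"
      using interval_bij.nat_pow_closed[of "F_gen 0" m] by (simp add: carrier_interval_bij F_gen_Bij)
    have "?g x = x" if x: "x \<in> {0..vine_pt 1}" for x
    proof -
      have x: "x \<in> {0..1/2}" and x01: "x \<in> {0..1}" using x by (auto simp: vine_pt_def)
      have ax: "?a x = x / 2 ^ m" using x by (rule F_gen_0_pow_apply)
      have "x * (1/2) ^ m \<le> 1 * (1/2) ^ m" using x by (intro mult_right_mono) auto
      then have "x / 2 ^ m < \<epsilon>" using m by (simp add: power_one_over field_simps)
      then have "f (?a x) = ?a x" using \<epsilon>(2) x by (simp add: ax)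
      moreover have "inv\<^bsub>interval_bij\<^esub> ?a \<in> Bij {0..1}" "f \<otimes>\<^bsub>interval_bij\<^esub> ?a \<in> Bij {0..1}"
        using aB fB interval_bij.inv_closed[of ?a] interval_bij.m_closed[of f ?a]
        by (simp_all add: carrier_interval_bij)
      ultimately show ?thesis
        unfolding twist_def int_pow_int using inv_interval_bij_apply(2)[OF aB x01]
        by (simp add: mult_interval_bij_apply x01 fB aB del: atLeastAtMost_iff)
    qed
    then have "?g \<in> generate interval_bij (F_gen.slide ` {1..})"
      using g by (intro fixing_in_generate_slides) (auto simp: F'_carrier_def D_carrier_def)
    moreover have "F_gen.slide i \<in> range twisted_slide" if "1 \<le> i" for i
      using that twisted_slide_pos[of "int i"] by (intro range_eqI[of _ _ "int i"]) (simp add: slide_image_def)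
    then have "generate interval_bij (F_gen.slide ` {1..}) \<subseteq> ?H"
      by (intro interval_bij.mono_generate) auto
    ultimately have "?g \<in> ?H" by blast
    then have "twist (- int m) ?g \<in> ?H" by (rule twist_H)
    then show "f \<in> ?H" using fB by (simp add: twist_twist carrier_interval_bij)
  qed
qed

lemma consec_group_UNIV: "consec_group UNIV \<cong> thompson_F'"
proof -
  have "consec_group UNIV \<cong> interval_bij\<lparr>carrier := generate interval_bij (range twisted_slide)\<rparr>"
    unfolding consec_group_def
    using twisted_slide_closed twisted_slide_relations twisted_slide_faithful
    by (rule interval_bij.presented_group_iso)
  then show ?thesis by (simp add: twisted_slide_generate thompson_F'_eq)
qed

theorem theorem3p1:
  shows "(\<forall>n::nat. n \<ge> 4 \<longrightarrow> consec_group {0..int n} \<cong> thompson_F)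
    \<and> consec_group UNIV \<cong> thompson_F'
    \<and> consec_group {0..} \<cong> thompson_D"
  using consec_group_finite consec_group_UNIV consec_group_nonneg by simp

end
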